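(* The edge- and vertex-weighted maximum induced tree problem is solvable in polynomial time on chordal graphs: there is a polynomial-time algorithm which, given a chordal graph $G=(V,E)$ and rational weights $c\in\mathbb{Q}^V$, $d\in\mathbb{Q}^E$, finds an induced tree $W\subseteq V$ of $G$ maximizing $\sum_{v\in W}c_v+\sum_{e\in E(W)}d_e$.
   Context: All graphs are finite and simple. A graph is chordal if it has no induced cycle of length at least 4. An induced tree of $G$ is a (nonempty) vertex set $W\subseteq V$ such that the induced subgraph $G[W]$ is a tree. $E(W)$ is the set of edges of $G$ with both endpoints in $W$. Weights may be of arbitrary sign. *)

theory Defs
  imports "HOL-Library.Log_Nat" "HOL-Computational_Algebra.Polynomial"
begin

section \<open>Graphs and the maximum induced tree problem\<close>

text \<open>A graph is given by its vertex set and its set of edges, each edge being a two-element set.\<close>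

definition simple_graph :: "'a set \<Rightarrow> 'a set set \<Rightarrow> bool" where
  "simple_graph V E \<longleftrightarrow> finite V \<and> (\<forall>e\<in>E. e \<subseteq> V \<and> card e = 2)"

definition edges_in :: "'a set set \<Rightarrow> 'a set \<Rightarrow> 'a set set" where
  "edges_in E W = {e \<in> E. e \<subseteq> W}"

text \<open>A cycle is given by the list of its vertices in cyclic order, without repetition.\<close>

definition cycle_edges :: "'a list \<Rightarrow> 'a set set" where
  "cycle_edges xs = {{xs ! i, xs ! (Suc i mod length xs)} | i. i < length xs}"

definition is_cycle :: "'a set set \<Rightarrow> 'a list \<Rightarrow> bool" where
  "is_cycle E xs \<longleftrightarrow> 3 \<le> length xs \<and> distinct xs \<and> cycle_edges xs \<subseteq> E"

definition is_induced_cycle :: "'a set set \<Rightarrow> 'a list \<Rightarrow> bool" where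
  "is_induced_cycle E xs \<longleftrightarrow> is_cycle E xs \<and> edges_in E (set xs) = cycle_edges xs"

definition chordal :: "'a set set \<Rightarrow> bool" where
  "chordal E \<longleftrightarrow> \<not> (\<exists>xs. 4 \<le> length xs \<and> is_induced_cycle E xs)"

definition connected_graph :: "'a set \<Rightarrow> 'a set set \<Rightarrow> bool" where
  "connected_graph V E \<longleftrightarrow>
     V \<noteq> {} \<and> (\<forall>u\<in>V. \<forall>v\<in>V. (u, v) \<in> {(x, y). {x, y} \<in> E}\<^sup>*)"

definition is_tree :: "'a set \<Rightarrow> 'a set set \<Rightarrow> bool" where
  "is_tree V E \<longleftrightarrow> simple_graph V E \<and> connected_graph V E \<and> \<not> (\<exists>xs. is_cycle E xs)"

definition induced_tree :: "'a set \<Rightarrow> 'a set set \<Rightarrow> 'a set \<Rightarrow> bool" where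
  "induced_tree V E W \<longleftrightarrow> W \<subseteq> V \<and> is_tree W (edges_in E W)"

definition tree_weight :: "'a set set \<Rightarrow> ('a \<Rightarrow> rat) \<Rightarrow> ('a set \<Rightarrow> rat) \<Rightarrow> 'a set \<Rightarrow> rat" where
  "tree_weight E c d W = (\<Sum>v\<in>W. c v) + (\<Sum>e\<in>edges_in E W. d e)"

definition max_induced_tree ::
    "'a set \<Rightarrow> 'a set set \<Rightarrow> ('a \<Rightarrow> rat) \<Rightarrow> ('a set \<Rightarrow> rat) \<Rightarrow> 'a set \<Rightarrow> bool" where
  "max_induced_tree V E c d W \<longleftrightarrow>
     induced_tree V E W \<and>
     (\<forall>W'. induced_tree V E W' \<longrightarrow> tree_weight E c d W' \<le> tree_weight E c d W)"


section \<open>Random access machines with logarithmic cost\<close>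

text \<open>
  The machine model is the random access machine over the integers under the logarithmic
  cost criterion (Cook--Reckhow; Aho--Hopcroft--Ullman), with programs in structured form.
  The memory consists of arrays, numbered by naturals, of integer cells indexed by integers;
  a program mentions only finitely many of the arrays, because array numbers are constants.
  Every operation is charged the binary lengths of all addresses, operands and results that
  it handles.  This makes running times polynomially related to those of Turing machines,
  although multiplication and division are primitive.
\<close>

datatype aop = Add | Sub | Mul | Div

datatype aexp = Const int | Read nat aexp | Op aop aexp aexp

datatype bexp = Less aexp aexp | Eq aexp aexp | Not bexp | And bexp bexp

datatype com =
    Skip
  | Write nat aexp aexp
  | Seq com com
  | If bexp com com
  | While bexp com

type_synonym state = "nat \<Rightarrow> int \<Rightarrow> int"

text \<open>Binary length of the absolute value, plus one bit for the sign.\<close>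

definition bits :: "int \<Rightarrow> nat" where
  "bits k = floorlog 2 (nat \<bar>k\<bar>) + 1"

fun aop_val :: "aop \<Rightarrow> int \<Rightarrow> int \<Rightarrow> int" where
  "aop_val Add x y = x + y"
| "aop_val Sub x y = x - y"
| "aop_val Mul x y = x * y"
| "aop_val Div x y = x div y"

fun aval :: "aexp \<Rightarrow> state \<Rightarrow> int" where
  "aval (Const k) s = k"
| "aval (Read a i) s = s a (aval i s)"
| "aval (Op f x y) s = aop_val f (aval x s) (aval y s)"

fun acost :: "aexp \<Rightarrow> state \<Rightarrow> nat" where
  "acost (Const k) s = bits k"
| "acost (Read a i) s = acost i s + bits (aval i s) + bits (s a (aval i s))"
| "acost (Op f x y) s = acost x s + acost y s
     + bits (aval x s) + bits (aval y s) + bits (aop_val f (aval x s) (aval y s))"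

fun bval :: "bexp \<Rightarrow> state \<Rightarrow> bool" where
  "bval (Less x y) s \<longleftrightarrow> aval x s < aval y s"
| "bval (Eq x y) s \<longleftrightarrow> aval x s = aval y s"
| "bval (Not b) s \<longleftrightarrow> \<not> bval b s"
| "bval (And b b') s \<longleftrightarrow> bval b s \<and> bval b' s"

fun bcost :: "bexp \<Rightarrow> state \<Rightarrow> nat" where
  "bcost (Less x y) s = acost x s + acost y s + bits (aval x s) + bits (aval y s)"
| "bcost (Eq x y) s = acost x s + acost y s + bits (aval x s) + bits (aval y s)"
| "bcost (Not b) s = bcost b s + 1"
| "bcost (And b b') s = bcost b s + bcost b' s + 1"

text \<open>\<open>exec p s t s'\<close>: program \<open>p\<close>, started in \<open>s\<close>, halts in \<open>s'\<close> at total cost \<open>t\<close>.\<close>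

inductive exec :: "com \<Rightarrow> state \<Rightarrow> nat \<Rightarrow> state \<Rightarrow> bool" where
  Skip: "exec Skip s 1 s"
| Write: "exec (Write a i e) s
            (acost i s + acost e s + bits (aval i s) + bits (aval e s))
            (s(a := (s a)(aval i s := aval e s)))"
| Seq: "exec p s t s' \<Longrightarrow> exec q s' t' s'' \<Longrightarrow> exec (Seq p q) s (t + t') s''"
| IfTrue: "bval b s \<Longrightarrow> exec p s t s' \<Longrightarrow> exec (If b p q) s (bcost b s + t) s'"
| IfFalse: "\<not> bval b s \<Longrightarrow> exec q s t s' \<Longrightarrow> exec (If b p q) s (bcost b s + t) s'"
| WhileFalse: "\<not> bval b s \<Longrightarrow> exec (While b p) s (bcost b s) s"
| WhileTrue: "bval b s \<Longrightarrow> exec p s t s' \<Longrightarrow> exec (While b p) s' t' s''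
                \<Longrightarrow> exec (While b p) s (bcost b s + t + t') s''"

lemma exec_deterministic:
  assumes "exec p s t s'" and "exec p s u s''"
  shows "t = u \<and> s' = s''"
  using assms
proof (induction arbitrary: u s'' rule: exec.induct)
  case (Seq p s t s' q t' s3)
  from Seq.prems show ?case
    by (cases rule: exec.cases) (use Seq.IH in blast)+
next
  case (WhileTrue b s p t s' t' s3)
  from WhileTrue.prems show ?case
    by (cases rule: exec.cases) (use WhileTrue.IH WhileTrue.hyps in blast)+
qed (erule exec.cases; fastforce)+

text \<open>
  Input and output are lists of integers: the entries are in array 0, starting at index 0,
  and the length is in cell 0 of array 1.  Initially all other cells contain 0.
\<close>

definition initial_state :: "int list \<Rightarrow> state" where
  "initial_state xs = (\<lambda>a i.
     if a = 0 \<and> 0 \<le> i \<and> i < int (length xs) then xs ! nat i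
     else if a = 1 \<and> i = 0 then int (length xs)
     else 0)"

definition output_is :: "state \<Rightarrow> int list \<Rightarrow> bool" where
  "output_is s ys \<longleftrightarrow> s 1 0 = int (length ys) \<and> (\<forall>i<length ys. s 0 (int i) = ys ! i)"

definition halts_with :: "com \<Rightarrow> int list \<Rightarrow> nat \<Rightarrow> int list \<Rightarrow> bool" where
  "halts_with p xs t ys \<longleftrightarrow> (\<exists>s. exec p (initial_state xs) t s \<and> output_is s ys)"

definition input_length :: "int list \<Rightarrow> nat" where
  "input_length xs = (\<Sum>x\<leftarrow>xs. bits x)"


section \<open>Encoding of instances and solutions\<close>

definition encode_rat :: "rat \<Rightarrow> int list" where
  "encode_rat r = [fst (quotient_of r), snd (quotient_of r)]"

text \<open>
  The vertices are the numbers below \<open>n\<close>.  The number \<open>n\<close> is followed by the vertex weights and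
  then, row by row, by the adjacency matrix, with the edge weight attached to every entry
  (and the weight 0, encoded by \<open>0, 1\<close>, attached to the entries for non-edges).
\<close>

definition encode_instance ::
    "nat \<Rightarrow> nat set set \<Rightarrow> (nat \<Rightarrow> rat) \<Rightarrow> (nat set \<Rightarrow> rat) \<Rightarrow> int list" where
  "encode_instance n E c d =
     int n # concat (map (\<lambda>v. encode_rat (c v)) [0..<n])
     @ concat (map (\<lambda>(u, v). if {u, v} \<in> E then 1 # encode_rat (d {u, v}) else [0, 0, 1])
         (List.product [0..<n] [0..<n]))"

definition encode_vertex_set :: "nat set \<Rightarrow> int list" where
  "encode_vertex_set W = map int (sorted_list_of_set W)"

end

theory Submission
  imports Defs
begin

text \<open>
  Let \<open>v\<close> be a simplicial vertex of \<open>G\<close>, with neighbourhood \<open>N\<close>.  An induced tree is triangle-free, so it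
  meets the clique \<open>N\<close> in at most two vertices, and \<open>v\<close> can be added to an induced tree \<open>W\<close> of \<open>G - v\<close>
  if and only if \<open>W\<close> meets \<open>N\<close> in exactly one vertex \<open>u\<close>.  The best choice for \<open>v\<close> then gains
  \<open>g\<^sub>u = max 0 (c\<^sub>v + d\<^sub>v\<^sub>u)\<close>.  Adding \<open>g\<^sub>u\<close> to \<open>c\<^sub>u\<close> for all \<open>u \<in> N\<close> and subtracting \<open>g\<^sub>u + g\<^sub>w\<close> from
  \<open>d\<^sub>u\<^sub>w\<close> for all \<open>u, w \<in> N\<close> accounts for this gain in all three cases, and hence reduces the problem to
  \<open>G - v\<close>, up to the candidate \<open>{v}\<close>.  By Dirac's theorem a chordal graph can be eliminated in this way
  vertex by vertex; the optimum is the largest vertex weight at the end, and an optimal tree is found by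
  going through the eliminated vertices in reverse order.  Weights grow by a factor of at most five per
  step, so their length stays polynomial once they are scaled to integers.
\<close>

section \<open>Simplicial vertices of chordal graphs\<close>

text \<open>The edge set \<open>E\<close> is never changed: an induced subgraph is represented by
  its vertex set \<open>A\<close> alone, so chordality is assumed once, for \<open>E\<close>, and
  need not be passed on to subgraphs. The final weight of a vertex \<open>r\<close> can be read as
  the largest weight of an induced tree whose last eliminated vertex is \<open>r\<close>: whatever
  is eliminated before \<open>r\<close> has been credited by then, and from its own elimination on
  the weight of \<open>r\<close> is frozen. The obstacle of the second half is the logarithmic cost.
  Each operation is charged for the numbers it touches, so a time bound needs a bound on every value
  that occurs, including cells that represent no edge and operands that do not decide a test. This
  is organised around two parameters: \<open>M\<close> bounds all numbers and \<open>m\<close>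
  bounds all iteration counts. An operation is safe if it stays within \<open>M\<close>, and the
  running time is then a fixed polynomial in \<open>m\<close> times the length of
  \<open>M\<close>.\<close>

definition simplicial :: "'a set set \<Rightarrow> 'a set \<Rightarrow> 'a \<Rightarrow> bool" where
  "simplicial E A v \<longleftrightarrow>
     v \<in> A \<and> (\<forall>u\<in>A. \<forall>w\<in>A. {v, u} \<in> E \<and> {v, w} \<in> E \<and> u \<noteq> w \<longrightarrow> {u, w} \<in> E)"

definition loopless :: "'a set set \<Rightarrow> bool" where
  "loopless E \<longleftrightarrow> (\<forall>e\<in>E. card e = 2)"

lemma looplessD: "loopless E \<Longrightarrow> {x, y} \<in> E \<Longrightarrow> x \<noteq> y"
  by (auto simp: loopless_def)

lemma loopless_edgeE:
  assumes "loopless E" "e \<in> E"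
  obtains x y where "e = {x, y}" "x \<noteq> y"
  using assms by (auto simp: loopless_def card_2_iff)

section \<open>Shortest walks and chordless cycles\<close>

fun walk :: "'a set set \<Rightarrow> 'a list \<Rightarrow> bool" where
  "walk E [] \<longleftrightarrow> True"
| "walk E [x] \<longleftrightarrow> True"
| "walk E (x # y # xs) \<longleftrightarrow> {x, y} \<in> E \<and> walk E (y # xs)"

lemma walk_append:
  "walk E (xs @ ys) \<longleftrightarrow>
     walk E xs \<and> walk E ys \<and> (xs \<noteq> [] \<and> ys \<noteq> [] \<longrightarrow> {last xs, hd ys} \<in> E)"
proof (induction xs rule: induct_list012)
  case (2 x)
  then show ?case by (cases ys) auto
qed auto

lemma walk_nth: "walk E xs \<Longrightarrow> Suc i < length xs \<Longrightarrow> {xs ! i, xs ! Suc i} \<in> E"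
proof (induction xs arbitrary: i rule: induct_list012)
  case (3 x y zs)
  then show ?case by (cases i) auto
qed auto

lemma rtrancl_walk:
  assumes "(x, y) \<in> {(x, y). x \<in> C \<and> y \<in> C \<and> {x, y} \<in> E}\<^sup>*" "x \<in> C"
  shows "\<exists>p. walk E p \<and> p \<noteq> [] \<and> hd p = x \<and> last p = y \<and> set p \<subseteq> C"
  using assms
proof (induction rule: rtrancl_induct)
  case base
  then show ?case by (intro exI[of _ "[x]"]) auto
next
  case (step y z)
  then obtain p where "walk E p \<and> p \<noteq> [] \<and> hd p = x \<and> last p = y \<and> set p \<subseteq> C" by blast
  with step show ?case by (intro exI[of _ "p @ [z]"]) (auto simp: walk_append)
qed

text \<open>A chord from \<open>p ! i\<close> to \<open>p ! k\<close> with \<open>k > i + 1\<close>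
  would let the part in between be cut out. A repeated vertex reduces to this: \<open>p ! i\<close>
  is then adjacent to the successor of \<open>p ! j\<close>, or, if \<open>p ! j\<close> is the end,
  the walk can stop at \<open>p ! i\<close>.\<close>

lemma shortest_walk_chordless:
  assumes p: "walk E p" "p \<noteq> []" "hd p = x" "last p = y" "set p \<subseteq> B"
    and min: "\<And>q. walk E q \<Longrightarrow> q \<noteq> [] \<Longrightarrow> hd q = x \<Longrightarrow> last q = y \<Longrightarrow> set q \<subseteq> B \<Longrightarrow> length p \<le> length q"
    and ij: "i < j" "j < length p" "p ! i = p ! j \<or> {p ! i, p ! j} \<in> E"
  shows "p ! i \<noteq> p ! j \<and> j = Suc i"
proof -
  have short: False if k: "i < k" "k < length p" and e: "{p ! i, p ! k} \<in> E" and ki: "Suc i < k" for k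
  proof -
    let ?q = "take (Suc i) p @ drop k p"
    have "walk E (take (Suc i) p)" "walk E (drop k p)"
      using p(1) walk_append[of E "take (Suc i) p" "drop (Suc i) p"]
        walk_append[of E "take k p" "drop k p"] by auto
    moreover have "last (take (Suc i) p) = p ! i"
      using ij by (simp add: take_Suc_conv_app_nth)
    moreover have "hd (drop k p) = p ! k" using k by (simp add: hd_drop_conv_nth)
    ultimately have "walk E ?q" using e by (simp add: walk_append)
    moreover have "hd ?q = x" using p by (cases p) auto
    moreover have "last ?q = y" using p k by simp
    moreover have "set ?q \<subseteq> B" using p(5) by (auto dest: in_set_takeD in_set_dropD)
    moreover have "?q \<noteq> []" using p(2) by simp
    ultimately have "length p \<le> length ?q" by (intro min) auto
    then show False using k ki by simp
  qed
  have neq: "p ! i \<noteq> p ! j"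
  proof
    assume eq: "p ! i = p ! j"
    show False
    proof (cases "Suc j < length p")
      case True
      have "{p ! i, p ! Suc j} \<in> E" using walk_nth[OF p(1) True] eq by simp
      with short[of "Suc j"] True ij show False by simp
    next
      case False
      then have j: "j = length p - 1" using ij by simp
      let ?q = "take (Suc i) p"
      have "walk E ?q" using p(1) walk_append[of E "take (Suc i) p" "drop (Suc i) p"] by auto
      moreover have "hd ?q = x" using p by (cases p) auto
      moreover have "last ?q = y"
        using ij eq j p by (simp add: take_Suc_conv_app_nth last_conv_nth)
      moreover have "set ?q \<subseteq> B" using p(5) by (auto dest: in_set_takeD)
      moreover have "?q \<noteq> []" using p(2) by simp
      ultimately have "length p \<le> length ?q" by (intro min) auto
      then show False using ij by simp
    qed
  qed
  with ij have "{p ! i, p ! j} \<in> E" by simp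
  with short[of j] ij have "\<not> Suc i < j" by blast
  with neq ij show ?thesis by simp
qed

lemma cycle_edges_subset_Pow: "cycle_edges xs \<subseteq> Pow (set xs)"
proof -
  have "Suc i mod length xs < length xs" if "i < length xs" for i
    using that by (intro mod_less_divisor) auto
  then show ?thesis by (auto simp: cycle_edges_def)
qed

text \<open>Two non-adjacent neighbours of \<open>v\<close> joined by a walk that otherwise avoids the closed
  neighbourhood of \<open>v\<close> would close, along a shortest such walk, a chordless cycle through \<open>v\<close>.\<close>

lemma chordal_attachment_clique:
  assumes ch: "chordal E" and ll: "loopless E"
    and C: "\<And>c. c \<in> C \<Longrightarrow> c \<noteq> v \<and> {v, c} \<notin> E"
    and x: "{v, x} \<in> E" and y: "{v, y} \<in> E" and xy: "x \<noteq> y"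
    and w: "walk E w" "w \<noteq> []" "hd w = x" "last w = y" "set w \<subseteq> C \<union> {x, y}"
  shows "{x, y} \<in> E"
proof (rule ccontr)
  assume nxy: "{x, y} \<notin> E"
  define P where "P q \<longleftrightarrow> walk E q \<and> q \<noteq> [] \<and> hd q = x \<and> last q = y \<and> set q \<subseteq> C \<union> {x, y}" for q
  have "P w" using w by (simp add: P_def)
  then obtain p where p: "P p" and min: "\<And>q. P q \<Longrightarrow> length p \<le> length q"
    using exists_least_iff[of "\<lambda>k. \<exists>q. P q \<and> length q = k"] by (metis not_less)
  have chl: "p ! i \<noteq> p ! j \<and> j = Suc i"
    if "i < j" "j < length p" "p ! i = p ! j \<or> {p ! i, p ! j} \<in> E" for i j
    using shortest_walk_chordless[of E p x y "C \<union> {x, y}" i j] p min that unfolding P_def by blast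
  have p0: "p ! 0 = x" and pl: "p ! (length p - 1) = y" and pne: "p \<noteq> []"
    using p by (auto simp: P_def hd_conv_nth last_conv_nth)
  \<comment> \<open>One vertex would give \<open>x = y\<close> and two would give the edge in
    question; hence \<open>v # p\<close> has length at least 4, as chordality requires.\<close>
  have len: "3 \<le> length p"
  proof (rule ccontr)
    assume "\<not> ?thesis"
    moreover have "length p \<noteq> 0" using pne by simp
    ultimately have "length p = 1 \<or> length p = 2" by linarith
    then show False
    proof
      assume "length p = 1" with p0 pl xy show False by simp
    next
      assume 2: "length p = 2"
      with p have "{p ! 0, p ! Suc 0} \<in> E" by (intro walk_nth) (auto simp: P_def)
      with p0 pl 2 nxy show False by simp
    qed
  qed
  have dist: "distinct p"
    unfolding distinct_conv_nth by (metis chl linorder_neqE_nat)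
  have int: "p ! i \<in> C" if "0 < i" "Suc i < length p" for i
  proof -
    have "p ! i \<in> set p" using that by simp
    then have "p ! i \<in> C \<union> {x, y}" using p unfolding P_def by blast
    moreover have "p ! i \<noteq> x" using p0 pne that nth_eq_iff_index_eq[OF dist, of i 0] by auto
    moreover have "p ! i \<noteq> y" using pl pne that nth_eq_iff_index_eq[OF dist, of i "length p - 1"] by auto
    ultimately show ?thesis by auto
  qed
  let ?c = "v # p"
  have vp: "v \<notin> set p"
  proof
    assume "v \<in> set p"
    with p have "v \<in> C \<union> {x, y}" by (auto simp: P_def)
    with C x y looplessD[OF ll] show False by blast
  qed
  have sub: "cycle_edges ?c \<subseteq> E"
  proof
    fix e assume "e \<in> cycle_edges ?c"
    then obtain i where i: "i < length ?c" "e = {?c ! i, ?c ! (Suc i mod length ?c)}"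
      by (auto simp: cycle_edges_def)
    consider "i = 0" | "0 < i" "i < length p" | "i = length p" using i by fastforce
    then show "e \<in> E"
    proof cases
      case 1 then show ?thesis using i x p0 pne by simp
    next
      case 2
      then have "e = {p ! (i - 1), p ! Suc (i - 1)}" using i by (cases i) auto
      then show ?thesis using 2 p walk_nth[of E p "i - 1"] by (simp add: P_def)
    next
      case 3 then show ?thesis using i y pl pne by (simp add: nth_Cons' insert_commute)
    qed
  qed
  \<comment> \<open>A chord of the cycle would join two vertices of \<open>p\<close>, excluded by
    minimality, or \<open>v\<close> and an interior vertex of \<open>p\<close>, excluded because
    these lie in \<open>C\<close>.\<close>
  have "edges_in E (set ?c) \<subseteq> cycle_edges ?c"
  proof
    fix e assume e: "e \<in> edges_in E (set ?c)"
    then have eE: "e \<in> E" and ec: "e \<subseteq> set ?c" by (auto simp: edges_in_def)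
    obtain a b where "e = {a, b}" "a \<noteq> b" using loopless_edgeE[OF ll eE] .
    with eE ec have ab: "e = {a, b}" "a \<noteq> b" "a \<in> set ?c" "b \<in> set ?c" "{a, b} \<in> E" by auto
    obtain i j where i: "i < length ?c" "?c ! i = a" and j: "j < length ?c" "?c ! j = b"
      using ab(3,4) unfolding in_set_conv_nth by blast
    have "\<exists>i j. e = {?c ! i, ?c ! j} \<and> j < length ?c \<and> i < j \<and> {?c ! i, ?c ! j} \<in> E"
    proof (cases i j rule: linorder_cases)
      case less
      then show ?thesis using i j ab(1,5) by blast
    next
      case equal
      then show ?thesis using i j ab(2) by blast
    next
      case greater
      moreover have "e = {b, a}" "{b, a} \<in> E" using ab(1,5) by (simp_all add: insert_commute)
      ultimately show ?thesis using i j by blast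
    qed
    then obtain i j where "e = {?c ! i, ?c ! j}" "j < length ?c" "i < j" "{?c ! i, ?c ! j} \<in> E"
      by blast
    \<comment> \<open>Position \<open>Suc j\<close> of \<open>v # p\<close> is position
      \<open>j\<close> of \<open>p\<close>; from here on \<open>j\<close> counts along
      \<open>p\<close> and \<open>i\<close> along the cycle.\<close>
    then obtain i j where ij: "e = {?c ! i, ?c ! Suc j}" "i \<le> j" "j < length p" "{?c ! i, ?c ! Suc j} \<in> E"
      by (cases j) auto
    show "e \<in> cycle_edges ?c"
    proof (cases i)
      case 0
      have "j = 0 \<or> j = length p - 1"
        using int[of j] C ij 0 by fastforce
      then show ?thesis
      proof
        assume "j = 0"
        then show ?thesis unfolding cycle_edges_def mem_Collect_eq using 0 ij pne
          by (intro exI[of _ 0]) auto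
      next
        assume "j = length p - 1"
        then show ?thesis unfolding cycle_edges_def mem_Collect_eq using 0 ij pne
          by (intro exI[of _ "length p"]) (auto simp: insert_commute nth_Cons')
      qed
    next
      case (Suc k)
      with ij have "j = Suc k" using chl[of k j] by auto
      then show ?thesis unfolding cycle_edges_def mem_Collect_eq using Suc ij
        by (intro exI[of _ i]) auto
    qed
  qed
  moreover have "cycle_edges ?c \<subseteq> edges_in E (set ?c)"
    using sub cycle_edges_subset_Pow[of ?c] unfolding edges_in_def by blast
  ultimately have "is_induced_cycle E ?c"
    using sub dist vp len by (auto simp: is_induced_cycle_def is_cycle_def)
  moreover have "4 \<le> length ?c" using len by simp
  ultimately show False using ch unfolding chordal_def by blast
qed

text \<open>Dirac's argument. The second conjunct strengthens the claim for the induction: a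
  simplicial vertex exists outside the closed neighbourhood of any \<open>v\<close> that misses some
  vertex. Take a component \<open>C\<close> of the non-neighbours of \<open>v\<close> and its
  attachment set \<open>S\<close> among the neighbours; \<open>S\<close> is a clique by
  \<open>chordal_attachment_clique\<close>. A vertex of \<open>C\<close> sees nothing outside
  \<open>C \<union> S\<close>, so it is simplicial in \<open>A\<close> once it is simplicial in that
  smaller set.\<close>

lemma chordal_simplicial_aux:
  assumes ch: "chordal E" and ll: "loopless E" and fin: "finite A"
  shows "(A \<noteq> {} \<longrightarrow> (\<exists>z. simplicial E A z)) \<and>
    (\<forall>v\<in>A. (\<exists>u\<in>A. u \<noteq> v \<and> {v, u} \<notin> E) \<longrightarrow> (\<exists>z. simplicial E A z \<and> z \<noteq> v \<and> {v, z} \<notin> E))"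
  using fin
proof (induction A rule: finite_psubset_induct)
  case (psubset A)
  have two: "\<exists>z. simplicial E A z \<and> z \<noteq> v \<and> {v, z} \<notin> E"
    if v: "v \<in> A" and u: "u \<in> A" "u \<noteq> v" "{v, u} \<notin> E" for v u
  proof -
    define B where "B = {c \<in> A. c \<noteq> v \<and> {v, c} \<notin> E}"
    define R where "R = {(x, y). x \<in> B \<and> y \<in> B \<and> {x, y} \<in> E}"
    define C where "C = {c. (u, c) \<in> R\<^sup>*}"
    define S where "S = {s \<in> A - C. \<exists>c\<in>C. {c, s} \<in> E}"
    have uB: "u \<in> B" using u by (auto simp: B_def)
    have CB: "C \<subseteq> B"
    proof
      fix c assume "c \<in> C"
      then have "(u, c) \<in> R\<^sup>*" by (simp add: C_def)
      then show "c \<in> B" using uB by (cases rule: rtranclE) (auto simp: R_def)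
    qed
    have uC: "u \<in> C" by (simp add: C_def)
    \<comment> \<open>A vertex of \<open>B\<close> adjacent to \<open>C\<close> would already belong
      to the component, so the attachments are neighbours of \<open>v\<close>.\<close>
    have SN: "{v, s} \<in> E" "s \<noteq> v" if "s \<in> S" for s
    proof -
      from that obtain c where c: "c \<in> C" "{c, s} \<in> E" "s \<in> A" "s \<notin> C" by (auto simp: S_def)
      have "s \<notin> B"
      proof
        assume "s \<in> B"
        then have "(c, s) \<in> R" using c CB by (auto simp: R_def)
        with c(1) have "s \<in> C" by (auto simp: C_def)
        with c show False by simp
      qed
      moreover have "{v, c} \<notin> E" using c(1) CB by (auto simp: B_def)
      then show "s \<noteq> v" using c(2) by (auto simp: insert_commute)
      ultimately show "{v, s} \<in> E" using c by (auto simp: B_def)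
    qed
    have symR: "R\<inverse> = R" by (auto simp: R_def insert_commute)
    \<comment> \<open>Each of \<open>x\<close> and \<open>y\<close> has a neighbour in the connected
      set \<open>C\<close>, which yields a walk from \<open>x\<close> to \<open>y\<close> through
      \<open>C\<close>.\<close>
    have Scl: "{x, y} \<in> E" if xy: "x \<in> S" "y \<in> S" "x \<noteq> y" for x y
    proof -
      obtain a where a: "a \<in> C" "{a, x} \<in> E" using xy by (auto simp: S_def)
      obtain b where b: "b \<in> C" "{b, y} \<in> E" using xy by (auto simp: S_def)
      have "(a, u) \<in> R\<^sup>*" using a(1) symR by (metis C_def mem_Collect_eq rtrancl_converseI)
      with b(1) have ab: "(a, b) \<in> R\<^sup>*" by (auto simp: C_def)
      have "(a, b) \<in> {(x, y). x \<in> C \<and> y \<in> C \<and> {x, y} \<in> E}\<^sup>*"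
        using ab
      proof (induction rule: rtrancl_induct)
        case (step y z)
        have "y \<in> C" using step(1) a(1) by (auto simp: C_def)
        moreover from this step(2) have "z \<in> C" by (auto simp: C_def)
        ultimately have "(y, z) \<in> {(x, y). x \<in> C \<and> y \<in> C \<and> {x, y} \<in> E}"
          using step(2) by (auto simp: R_def)
        with step(3) show ?case by (rule rtrancl_into_rtrancl)
      qed simp
      from rtrancl_walk[OF this a(1)] obtain p where
        p: "walk E p" "p \<noteq> []" "hd p = a" "last p = b" "set p \<subseteq> C" by blast
      have w: "walk E (x # p @ [y])"
      proof -
        have "walk E (p @ [y])" using p b by (simp add: walk_append)
        moreover have "{x, hd (p @ [y])} \<in> E" using p a by (simp add: insert_commute)
        ultimately show ?thesis using p(2) by (cases p) auto
      qed
      show ?thesis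
        by (rule chordal_attachment_clique[OF ch ll, of C v x y "x # p @ [y]"])
          (use w p CB SN xy in \<open>auto simp: B_def\<close>)
    qed
    let ?H = "C \<union> S"
    have HA: "?H \<subset> A"
    proof -
      have "?H \<subseteq> A" using CB by (auto simp: B_def S_def)
      moreover have "v \<notin> ?H" using CB SN by (auto simp: B_def)
      ultimately show ?thesis using v by blast
    qed
    have CA: "C \<subset> A" using HA by blast
    have nbr: "a \<in> ?H" if "c \<in> C" "a \<in> A" "{c, a} \<in> E" for c a
      using that by (auto simp: S_def)
    have fin: "\<exists>z. simplicial E A z \<and> z \<noteq> v \<and> {v, z} \<notin> E"
      if z: "z \<in> C" and s: "simplicial E ?H z" for z
    proof (intro exI conjI)
      show "simplicial E A z"
        using s z nbr HA unfolding simplicial_def by blast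
      show "z \<noteq> v" "{v, z} \<notin> E" using z CB by (auto simp: B_def)
    qed
    \<comment> \<open>If some \<open>s\<close> in \<open>S\<close> misses a vertex, the strengthened
      hypothesis for \<open>s\<close> gives a simplicial vertex not adjacent to \<open>s\<close>,
      which cannot lie in the clique \<open>S\<close>. Otherwise every \<open>s\<close> sees all of
      \<open>?H\<close>, and a simplicial vertex of \<open>C\<close> alone stays simplicial in
      \<open>?H\<close>.\<close>
    show ?thesis
    proof (cases "\<exists>s\<in>S. \<exists>h\<in>?H. h \<noteq> s \<and> {s, h} \<notin> E")
      case True
      then obtain s where s: "s \<in> S" "\<exists>h\<in>?H. h \<noteq> s \<and> {s, h} \<notin> E" by blast
      with psubset.IH[OF HA] obtain z where z: "simplicial E ?H z" "z \<noteq> s" "{s, z} \<notin> E"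
        by blast
      have "z \<notin> S" using Scl[of s z] z s by auto
      then have "z \<in> C" using z by (auto simp: simplicial_def)
      with z fin show ?thesis by blast
    next
      case False
      from psubset.IH[OF CA] uC obtain z where z: "simplicial E C z" by blast
      have "simplicial E ?H z"
        unfolding simplicial_def
      proof (intro conjI ballI impI)
        show "z \<in> ?H" using z by (simp add: simplicial_def)
        fix a b assume ab: "a \<in> ?H" "b \<in> ?H" "{z, a} \<in> E \<and> {z, b} \<in> E \<and> a \<noteq> b"
        show "{a, b} \<in> E"
        proof (cases "a \<in> S \<or> b \<in> S")
          case True
          then show ?thesis using False ab by (metis insert_commute)
        next
          case False
          then show ?thesis using z ab by (auto simp: simplicial_def)
        qed
      qed
      moreover have "z \<in> C" using z by (simp add: simplicial_def)
      ultimately show ?thesis using fin[of z] by blast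
    qed
  qed
  \<comment> \<open>Without a non-adjacent pair \<open>A\<close> is a clique and any of its vertices
    will do.\<close>
  moreover have "\<exists>z. simplicial E A z" if "A \<noteq> {}"
  proof (cases "\<exists>v\<in>A. \<exists>u\<in>A. u \<noteq> v \<and> {v, u} \<notin> E")
    case True
    with two show ?thesis by blast
  next
    case False
    from that obtain x where "x \<in> A" by blast
    with False show ?thesis unfolding simplicial_def by metis
  qed
  ultimately show ?case by blast
qed

lemma chordal_simplicial:
  assumes "chordal E" "loopless E" "finite A" "A \<noteq> {}"
  shows "\<exists>z. simplicial E A z"
  using chordal_simplicial_aux[OF assms(1-3)] assms(4) by blast

section \<open>Eliminating simplicial vertices\<close>

abbreviation tree_on :: "'a set set \<Rightarrow> 'a set \<Rightarrow> bool" where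
  "tree_on E W \<equiv> is_tree W (edges_in E W)"

abbreviation adj_within :: "'a set set \<Rightarrow> 'a set \<Rightarrow> ('a \<times> 'a) set" where
  "adj_within E W \<equiv> {(x, y). {x, y} \<in> edges_in E W}"

lemma cycle_edges_subset_edges_in:
  assumes "3 \<le> length xs"
  shows "cycle_edges xs \<subseteq> edges_in E W \<longleftrightarrow> cycle_edges xs \<subseteq> E \<and> set xs \<subseteq> W"
proof -
  have "cycle_edges xs \<subseteq> Pow (set xs)" by (rule cycle_edges_subset_Pow)
  moreover have "set xs \<subseteq> \<Union>(cycle_edges xs)"
    unfolding cycle_edges_def in_set_conv_nth subset_iff by blast
  ultimately show ?thesis unfolding edges_in_def by blast
qed

text \<open>The cycle condition is moved to the ambient \<open>E\<close>, so that acyclicity passes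
  to subsets of \<open>W\<close> at once.\<close>

lemma tree_on_iff:
  assumes "loopless E"
  shows "tree_on E W \<longleftrightarrow> finite W \<and> W \<noteq> {} \<and> (\<forall>u\<in>W. \<forall>v\<in>W. (u, v) \<in> (adj_within E W)\<^sup>*)
     \<and> \<not> (\<exists>xs. is_cycle E xs \<and> set xs \<subseteq> W)"
proof -
  have "simple_graph W (edges_in E W) \<longleftrightarrow> finite W"
    using assms by (auto simp: simple_graph_def edges_in_def loopless_def)
  moreover have "is_cycle (edges_in E W) xs \<longleftrightarrow> is_cycle E xs \<and> set xs \<subseteq> W" for xs
    using cycle_edges_subset_edges_in[of xs E W] unfolding is_cycle_def by blast
  ultimately show ?thesis unfolding is_tree_def connected_graph_def by simp
qed

lemma tree_on_finite: "tree_on E W \<Longrightarrow> finite W"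
  and tree_on_nonempty: "tree_on E W \<Longrightarrow> W \<noteq> {}"
  by (auto simp: is_tree_def simple_graph_def connected_graph_def)

lemma tree_on_singleton:
  assumes "loopless E"
  shows "tree_on E {v}"
proof -
  have "\<not> is_cycle E xs" if "set xs \<subseteq> {v}" for xs
  proof
    assume c: "is_cycle E xs"
    have "length xs = card (set xs)" using c by (simp add: is_cycle_def distinct_card)
    also have "\<dots> \<le> 1" using card_mono[OF _ that] by simp
    finally show False using c by (simp add: is_cycle_def)
  qed
  then show ?thesis by (auto simp: tree_on_iff[OF assms])
qed

text \<open>These are the predecessor and the successor of \<open>v\<close> on the cycle; they
  differ because the length is at least 3.\<close>

lemma is_cycle_two_neighbours:
  assumes "is_cycle E xs" "v \<in> set xs"
  shows "\<exists>a\<in>set xs. \<exists>b\<in>set xs. a \<noteq> b \<and> {v, a} \<in> E \<and> {v, b} \<in> E"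
proof -
  from assms obtain i where i: "i < length xs" "v = xs ! i" by (auto simp: in_set_conv_nth)
  have c: "3 \<le> length xs" "distinct xs" "cycle_edges xs \<subseteq> E"
    using assms by (auto simp: is_cycle_def)
  have e: "{xs ! j, xs ! (Suc j mod length xs)} \<in> E" if "j < length xs" for j
    using c(3) that unfolding cycle_edges_def by blast
  define j where "j = (if i = 0 then length xs - 1 else i - 1)"
  have j: "j < length xs" "Suc j mod length xs = i" using i c(1) by (auto simp: j_def)
  define k where "k = Suc i mod length xs"
  have k: "k < length xs" "k \<noteq> j"
    using i c(1) by (auto simp: j_def k_def mod_Suc split: if_splits)
  have "{v, xs ! k} \<in> E" using e[OF i(1)] i by (simp add: k_def)
  moreover have "{v, xs ! j} \<in> E" using e[OF j(1)] j i by (simp add: insert_commute)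
  moreover have "xs ! k \<noteq> xs ! j" using k j c(2) by (simp add: nth_eq_iff_index_eq)
  ultimately show ?thesis using k(1) j(1) by (metis nth_mem)
qed

lemma triangle_is_cycle:
  assumes "{x, y} \<in> E" "{y, z} \<in> E" "{z, x} \<in> E" "distinct [x, y, z]"
  shows "is_cycle E [x, y, z]"
proof -
  have "cycle_edges [x, y, z] \<subseteq> {{x, y}, {y, z}, {z, x}}"
  proof
    fix e assume "e \<in> cycle_edges [x, y, z]"
    then obtain i where i: "i < length [x, y, z]"
        "e = {[x, y, z] ! i, [x, y, z] ! (Suc i mod length [x, y, z])}"
      unfolding cycle_edges_def by blast
    from i(1) have "i < 3" by simp
    then consider "i = 0" | "i = 1" | "i = 2" by linarith
    then show "e \<in> {{x, y}, {y, z}, {z, x}}" by cases (simp_all add: i(2))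
  qed
  then show ?thesis using assms by (auto simp: is_cycle_def)
qed

lemma tree_on_no_triangle:
  assumes "loopless E" "tree_on E W" "x \<in> W" "y \<in> W" "z \<in> W" "{x, y} \<in> E" "{y, z} \<in> E"
  shows "{z, x} \<notin> E"
proof
  assume "{z, x} \<in> E"
  with assms have "is_cycle E [x, y, z]"
    by (intro triangle_is_cycle) (auto dest: looplessD[of E])
  with assms show False unfolding tree_on_iff[OF assms(1)] by fastforce
qed

text \<open>A cycle through \<open>v\<close> would need two neighbours of \<open>v\<close> in
  \<open>W\<close>, and a cycle avoiding \<open>v\<close> lies in \<open>W\<close>.\<close>

lemma tree_on_insert_leaf:
  assumes ll: "loopless E" and W: "tree_on E W" and v: "v \<notin> W"
    and u: "{x\<in>W. {v, x} \<in> E} = {u}"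
  shows "tree_on E (insert v W)"
proof -
  let ?R = "adj_within E (insert v W)"
  have con: "(a, b) \<in> ?R\<^sup>*" if "a \<in> W" "b \<in> W" for a b
  proof -
    have "(a, b) \<in> (adj_within E W)\<^sup>*" using W that by (simp add: tree_on_iff[OF ll])
    moreover have "adj_within E W \<subseteq> ?R" by (auto simp: edges_in_def)
    ultimately show ?thesis using rtrancl_mono by blast
  qed
  have "u \<in> W" "(u, v) \<in> ?R" "(v, u) \<in> ?R"
    using u by (auto simp: edges_in_def insert_commute)
  then have "(a, v) \<in> ?R\<^sup>*" "(v, a) \<in> ?R\<^sup>*" if "a \<in> W" for a
    using con[of a u] con[of u a] that by (auto intro: rtrancl_into_rtrancl converse_rtrancl_into_rtrancl)
  moreover have False if c: "is_cycle E xs" "set xs \<subseteq> insert v W" for xs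
  proof (cases "v \<in> set xs")
    case True
    then obtain a b where ab: "a \<in> set xs" "b \<in> set xs" "a \<noteq> b" "{v, a} \<in> E" "{v, b} \<in> E"
      using is_cycle_two_neighbours[OF c(1)] by blast
    then have "a \<in> {x\<in>W. {v, x} \<in> E}" "b \<in> {x\<in>W. {v, x} \<in> E}"
      using c(2) looplessD[OF ll] by auto
    with u ab show False by auto
  next
    case False
    with c W show False unfolding tree_on_iff[OF ll] by blast
  qed
  ultimately show ?thesis using W con unfolding tree_on_iff[OF ll] by auto
qed

text \<open>Two neighbours of \<open>v\<close> in \<open>W\<close> would be adjacent and form a
  triangle with \<open>v\<close>, while connectedness supplies at least one. So \<open>v\<close> is
  a leaf.\<close>

lemma tree_on_remove_simplicial:
  assumes ll: "loopless E" and W: "tree_on E W" and v: "v \<in> W" "W \<noteq> {v}"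
    and s: "simplicial E A v" "W \<subseteq> A"
  shows "\<exists>u. {x\<in>W - {v}. {v, x} \<in> E} = {u} \<and> tree_on E (W - {v})"
proof -
  let ?R = "adj_within E W" and ?S = "adj_within E (W - {v})"
  obtain a where a: "a \<in> W" "a \<noteq> v" using v by blast
  have "(v, a) \<in> ?R\<^sup>*" using W v(1) a(1) by (simp add: tree_on_iff[OF ll])
  then obtain u where u: "(v, u) \<in> ?R" using a(2) by (auto elim: converse_rtranclE)
  then have uW: "{v, u} \<in> E" "u \<in> W" "u \<noteq> v" by (auto simp: edges_in_def dest: looplessD[OF ll])
  have uniq: "x = u" if "x \<in> W" "{v, x} \<in> E" for x
  proof (rule ccontr)
    assume "x \<noteq> u"
    then have "{x, u} \<in> E" using s that uW by (auto simp: simplicial_def)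
    then show False using tree_on_no_triangle[OF ll W, of v u x] v that uW
      by (simp add: insert_commute)
  qed
  \<comment> \<open>A walk through \<open>v\<close> enters and leaves it via \<open>u\<close>.
    Standing at \<open>u\<close> while the walk stands at \<open>v\<close> therefore gives a walk in
    \<open>W - {v}\<close>.\<close>
  have avoid: "(x, y) \<in> ?R\<^sup>* \<Longrightarrow> x \<in> W - {v} \<Longrightarrow> (x, if y = v then u else y) \<in> ?S\<^sup>*" for x y
  proof (induction rule: rtrancl_induct)
    case (step y z)
    then have e: "{y, z} \<in> E" "y \<in> W" "z \<in> W" "y \<noteq> z"
      by (auto simp: edges_in_def dest: looplessD[OF ll])
    consider "y = v" | "z = v" | "y \<noteq> v" "z \<noteq> v" by blast
    then show ?case
    proof cases
      case 1 then show ?thesis using e step uniq[of z] by auto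
    next
      case 2 then show ?thesis using e step uniq[of y] by (auto simp: insert_commute)
    next
      case 3
      then have "(y, z) \<in> ?S" using e by (auto simp: edges_in_def)
      with 3 step show ?thesis by (auto intro: rtrancl_into_rtrancl)
    qed
  qed auto
  have con: "(x, y) \<in> ?S\<^sup>*" if "x \<in> W - {v}" "y \<in> W - {v}" for x y
  proof -
    have "(x, y) \<in> ?R\<^sup>*" using W that by (simp add: tree_on_iff[OF ll])
    from avoid[OF this that(1)] that(2) show ?thesis by simp
  qed
  have "tree_on E (W - {v})"
    unfolding tree_on_iff[OF ll]
  proof (intro conjI ballI)
    show "finite (W - {v})" using tree_on_finite[OF W] by simp
    show "W - {v} \<noteq> {}" using a by blast
    show "(x, y) \<in> ?S\<^sup>*" if "x \<in> W - {v}" "y \<in> W - {v}" for x y using con that by blast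
    show "\<not> (\<exists>xs. is_cycle E xs \<and> set xs \<subseteq> W - {v})"
      using W unfolding tree_on_iff[OF ll] by blast
  qed
  moreover have "{x\<in>W - {v}. {v, x} \<in> E} = {u}" using uW uniq by blast
  ultimately show ?thesis by blast
qed

section \<open>Integer weights of induced trees and their update when a vertex is eliminated\<close>

definition weight :: "'a set set \<Rightarrow> ('a \<Rightarrow> int) \<Rightarrow> ('a set \<Rightarrow> int) \<Rightarrow> 'a set \<Rightarrow> int" where
  "weight E c d W = (\<Sum>v\<in>W. c v) + (\<Sum>e\<in>edges_in E W. d e)"

lemma finite_edges_in: "finite W \<Longrightarrow> finite (edges_in E W)"
  unfolding edges_in_def by (rule finite_subset[of _ "Pow W"]) auto

lemma edges_in_singleton: "loopless E \<Longrightarrow> edges_in E {u} = {}"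
  unfolding edges_in_def loopless_def by (auto simp: subset_singleton_iff)

lemma edges_in_empty: "loopless E \<Longrightarrow> edges_in E {} = {}"
  unfolding edges_in_def loopless_def by auto

lemma edges_in_pair:
  assumes "loopless E" "{u, w} \<in> E"
  shows "edges_in E {u, w} = {{u, w}}"
proof -
  have "e = {u, w}" if "e \<in> E" "e \<subseteq> {u, w}" for e
  proof -
    obtain x y where "e = {x, y}" "x \<noteq> y" using loopless_edgeE[OF assms(1) \<open>e \<in> E\<close>] .
    with that(2) show ?thesis by auto
  qed
  then show ?thesis using assms by (auto simp: edges_in_def)
qed

lemma weight_singleton: "loopless E \<Longrightarrow> weight E c d {v} = c v"
  by (simp add: weight_def edges_in_singleton)

lemma weight_insert_leaf:
  assumes ll: "loopless E" and W: "finite W" and v: "v \<notin> W" and u: "{x\<in>W. {v, x} \<in> E} = {u}"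
  shows "weight E c d (insert v W) = weight E c d W + c v + d {v, u}"
proof -
  have "edges_in E (insert v W) = insert {v, u} (edges_in E W)"
  proof (intro equalityI subsetI)
    fix e assume e: "e \<in> edges_in E (insert v W)"
    then have eE: "e \<in> E" and eW: "e \<subseteq> insert v W" by (auto simp: edges_in_def)
    obtain x y where "e = {x, y}" "x \<noteq> y" using loopless_edgeE[OF ll eE] .
    with eE eW have xy: "e = {x, y}" "x \<noteq> y" "{x, y} \<in> E" "x \<in> insert v W" "y \<in> insert v W"
      by auto
    show "e \<in> insert {v, u} (edges_in E W)"
    proof (cases "x = v \<or> y = v")
      case True
      then obtain z where z: "e = {v, z}" "z \<in> W" "{v, z} \<in> E"
        using xy by (metis insertE insert_commute)
      then have "z \<in> {x\<in>W. {v, x} \<in> E}" by simp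
      with u z show ?thesis by simp
    next
      case False with xy show ?thesis by (auto simp: edges_in_def)
    qed
  next
    fix e assume "e \<in> insert {v, u} (edges_in E W)"
    with u show "e \<in> edges_in E (insert v W)" by (auto simp: edges_in_def)
  qed
  moreover have "{v, u} \<notin> edges_in E W" using v by (auto simp: edges_in_def)
  ultimately show ?thesis using W v by (simp add: weight_def finite_edges_in)
qed

text \<open>Here \<open>A\<close> holds the vertices left after the removal of \<open>v\<close>. The
  value 0 off the neighbourhood lets the vertex update be stated uniformly and sums over a tree be
  restricted to the neighbours of \<open>v\<close>.\<close>

definition gain where
  "gain E A c d v u = (if u \<in> A \<and> {v, u} \<in> E then max 0 (c v + d {v, u}) else (0::int))"

definition c_step where
  "c_step E A v c d = (\<lambda>u. c u + gain E A c d v u)"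

text \<open>Summing over the edge itself avoids ordering its ends: for \<open>e = {u, w}\<close>
  with distinct ends it is the gain of \<open>u\<close> plus that of \<open>w\<close>.\<close>

definition d_step where
  "d_step E A v c d =
     (\<lambda>e. d e - (if e \<subseteq> {u\<in>A. {v, u} \<in> E} then \<Sum>u\<in>e. gain E A c d v u else 0))"

text \<open>Since \<open>W\<close> is triangle-free and the neighbours of \<open>v\<close> form a clique, \<open>W\<close> contains at most two
  of them: the vertex update credits the gain of \<open>v\<close> when there is one, and the edge update
  cancels it when there are two.\<close>

lemma weight_step:
  assumes ll: "loopless E" and s: "simplicial E (insert v A) v" and W: "tree_on E W" "W \<subseteq> A"
  shows "weight E (c_step E A v c d) (d_step E A v c d) W =
    (if \<exists>u. {x\<in>W. {v, x} \<in> E} = {u} then weight E c d W + gain E A c d v (THE u. {x\<in>W. {v, x} \<in> E} = {u})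
     else weight E c d W)"
proof -
  let ?g = "gain E A c d v"
  let ?S = "{x\<in>W. {v, x} \<in> E}"
  have finW: "finite W" using W(1) by (rule tree_on_finite)
  have "(\<Sum>x\<in>W. ?g x) = (\<Sum>x\<in>?S. ?g x)"
    using finW by (intro sum.mono_neutral_right) (auto simp: gain_def)
  moreover have "(\<Sum>e\<in>edges_in E W. if e \<subseteq> {u\<in>A. {v, u} \<in> E} then \<Sum>u\<in>e. ?g u else 0)
      = (\<Sum>e\<in>edges_in E ?S. \<Sum>u\<in>e. ?g u)"
  proof -
    have "(\<Sum>e\<in>edges_in E W. if e \<subseteq> {u\<in>A. {v, u} \<in> E} then \<Sum>u\<in>e. ?g u else 0)
      = (\<Sum>e\<in>{e \<in> edges_in E W. e \<subseteq> {u\<in>A. {v, u} \<in> E}}. \<Sum>u\<in>e. ?g u)"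
      by (simp add: sum.inter_filter[OF finite_edges_in[OF finW]])
    also have "{e \<in> edges_in E W. e \<subseteq> {u\<in>A. {v, u} \<in> E}} = edges_in E ?S"
      using W(2) by (auto simp: edges_in_def)
    finally show ?thesis .
  qed
  ultimately have eq: "weight E (c_step E A v c d) (d_step E A v c d) W =
      weight E c d W + (\<Sum>x\<in>?S. ?g x) - (\<Sum>e\<in>edges_in E ?S. \<Sum>u\<in>e. ?g u)"
    by (simp add: weight_def c_step_def d_step_def sum.distrib sum_subtractf)
  have adj: "{x, y} \<in> E" if "x \<in> ?S" "y \<in> ?S" "x \<noteq> y" for x y
    using s that W(2) by (auto simp: simplicial_def)
  consider "?S = {}" | u where "?S = {u}" | u w where "?S = {u, w}" "u \<noteq> w"
  proof (cases "?S = {} \<or> (\<exists>u. ?S = {u})")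
    case False
    then obtain u where u: "u \<in> ?S" by blast
    with False obtain w where w: "w \<in> ?S" "w \<noteq> u" by blast
    have "x = u \<or> x = w" if "x \<in> ?S" for x
      using tree_on_no_triangle[OF ll W(1), of u w x] adj[of u w] adj[of w x] adj[of x u] that u w
      by auto
    with u w have "?S = {u, w}" by blast
    with w that show ?thesis by blast
  qed (use that in blast)
  then show ?thesis
  proof cases
    case 1 then show ?thesis unfolding eq by (simp add: edges_in_empty[OF ll] del: Collect_empty_eq)
  next
    case 2 then show ?thesis unfolding eq by (simp add: edges_in_singleton[OF ll])
  next
    case 3
    then have "{u, w} \<in> E" by (intro adj) auto
    with 3 show ?thesis unfolding eq by (simp add: edges_in_pair[OF ll] doubleton_eq_iff)
  qed
qed

section \<open>Complete elimination orders and the reconstruction of an optimal tree\<close>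

fun eliminate where
  "eliminate E A [] cd = cd"
| "eliminate E A (v # vs) cd = eliminate E (A - {v}) vs
     (c_step E (A - {v}) v (fst cd) (snd cd), d_step E (A - {v}) v (fst cd) (snd cd))"

text \<open>A perfect elimination order that need not exhaust \<open>A\<close>, so that the prefix
  built so far can be described during the run.\<close>

fun elim_order where
  "elim_order E A [] \<longleftrightarrow> True"
| "elim_order E A (v # vs) \<longleftrightarrow> simplicial E A v \<and> elim_order E (A - {v}) vs"

text \<open>Vertices eliminated after \<open>r\<close> find an empty \<open>W\<close> and are not
  added, \<open>r\<close> starts the tree, and vertices eliminated before \<open>r\<close> may be
  attached as leaves. Only the final weights are passed, because memory holds no others by
  then.\<close>

fun recover where
  "recover E cF dF r [] = {}"
| "recover E cF dF r (v # vs) =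
     (if v = r then {r} else
      (let W = recover E cF dF r vs in
       if \<exists>u. {x\<in>W. {v, x} \<in> E} = {u} \<and> 0 < cF v + (dF {v, u} :: int) then insert v W else W))"

text \<open>The recursion consumes the order at its front, while the program extends it at its
  end.\<close>

lemma eliminate_snoc:
  "eliminate E A (vs @ [v]) cd =
    (let B = A - set vs - {v}; cd' = eliminate E A vs cd
     in (c_step E B v (fst cd') (snd cd'), d_step E B v (fst cd') (snd cd')))"
  by (induction vs arbitrary: A cd) (auto simp: Let_def Diff_insert2[symmetric] Diff_insert[symmetric] insert_commute)

lemma elim_order_snoc:
  "elim_order E A (vs @ [v]) \<longleftrightarrow> elim_order E A vs \<and> simplicial E (A - set vs) v"
  by (induction vs arbitrary: A) (auto simp: Diff_insert2[symmetric])

lemma elim_order_set: "elim_order E A vs \<Longrightarrow> set vs \<subseteq> A \<and> distinct vs"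
  by (induction vs arbitrary: A) (auto simp: simplicial_def)

lemma eliminate_fst_outside: "v \<notin> A \<Longrightarrow> fst (eliminate E A vs cd) v = fst cd v"
  by (induction vs arbitrary: A cd) (auto simp: c_step_def gain_def)

lemma eliminate_snd_outside: "v \<in> e \<Longrightarrow> v \<notin> A \<Longrightarrow> snd (eliminate E A vs cd) e = snd cd e"
  by (induction vs arbitrary: A cd) (auto simp: d_step_def)

lemma recover_subset: "recover E cF dF r vs \<subseteq> set vs"
proof (induction vs)
  case (Cons v vs)
  then show ?case by (auto simp: Let_def)
qed simp

text \<open>The weights of \<open>v\<close> do not change once \<open>v\<close> is eliminated, so the final weights show whether \<open>v\<close>
  had a positive gain at the time of its elimination.\<close>

lemma recover_tree:
  assumes ll: "loopless E" and o: "elim_order E A vs" and A: "A = set vs" and r: "r \<in> set vs"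
    and cd: "eliminate E A vs (c, d) = (cF, dF)"
  shows "tree_on E (recover E cF dF r vs) \<and> weight E c d (recover E cF dF r vs) = cF r"
  using o A r cd
proof (induction vs arbitrary: A c d)
  case (Cons v vs)
  let ?B = "A - {v}"
  let ?c = "c_step E ?B v c d" and ?d = "d_step E ?B v c d"
  let ?W = "recover E cF dF r vs"
  have v: "simplicial E A v" "elim_order E ?B vs" and AB: "A = insert v ?B"
    using Cons.prems by (auto simp: simplicial_def)
  have B: "?B = set vs" using elim_order_set[OF Cons.prems(1)] Cons.prems(2) by auto
  have el: "eliminate E ?B vs (?c, ?d) = (cF, dF)" using Cons.prems(4) by simp
  have cv: "cF v = c v"
    using eliminate_fst_outside[of v ?B E vs "(?c, ?d)"] el
    looplessD[OF ll, of v v] by (auto simp: c_step_def gain_def)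
  have dv: "dF {v, u} = d {v, u}" for u
    using eliminate_snd_outside[of v "{v, u}" ?B E vs "(?c, ?d)"] el by (auto simp: d_step_def)
  show ?case
  proof (cases "v = r")
    case True
    then show ?thesis using cv by (simp add: tree_on_singleton[OF ll] weight_singleton[OF ll])
  next
    case False
    then have "r \<in> set vs" using Cons.prems by simp
    from Cons.IH[OF v(2) B this el] have W: "tree_on E ?W" "weight E ?c ?d ?W = cF r" by auto
    have WB: "?W \<subseteq> ?B" using recover_subset[of E cF dF r vs] B by simp
    then have vW: "v \<notin> ?W" by blast
    have fin: "finite ?W" using W(1) by (rule tree_on_finite)
    have ws: "weight E ?c ?d ?W =
      (if \<exists>u. {x\<in>?W. {v, x} \<in> E} = {u}
       then weight E c d ?W + gain E ?B c d v (THE u. {x\<in>?W. {v, x} \<in> E} = {u}) else weight E c d ?W)"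
      using weight_step[OF ll _ W(1) WB, of v c d] v(1) AB by simp
    show ?thesis
    proof (cases "\<exists>u. {x\<in>?W. {v, x} \<in> E} = {u}")
      case True
      then obtain u where u: "{x\<in>?W. {v, x} \<in> E} = {u}" by blast
      then have "u \<in> ?B" "{v, u} \<in> E" using WB by auto
      then have g: "gain E ?B c d v u = max 0 (c v + d {v, u})" by (simp add: gain_def)
      have "weight E ?c ?d ?W = weight E c d ?W + max 0 (c v + d {v, u})"
        using ws g by (simp add: u)
      then show ?thesis using W False
        using weight_insert_leaf[OF ll fin vW u, of c d] tree_on_insert_leaf[OF ll W(1) vW u]
        by (auto simp: u Let_def cv dv)
    next
      case no: False
      then show ?thesis using W ws False by (auto simp: Let_def)
    qed
  qed
qed simp

lemma eliminate_optimal: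
  assumes ll: "loopless E" and o: "elim_order E A vs" and A: "A = set vs"
    and cd: "eliminate E A vs (c, d) = (cF, dF)"
    and W: "tree_on E W" "W \<subseteq> A"
  shows "\<exists>r\<in>set vs. weight E c d W \<le> cF r"
  using o A cd W
proof (induction vs arbitrary: A c d W)
  case Nil
  then show ?case using tree_on_nonempty[of W E] by auto
next
  case (Cons v vs)
  let ?B = "A - {v}"
  let ?c = "c_step E ?B v c d" and ?d = "d_step E ?B v c d"
  have v: "simplicial E A v" "elim_order E ?B vs" and AB: "A = insert v ?B"
    using Cons.prems by (auto simp: simplicial_def)
  have B: "?B = set vs" using elim_order_set[OF Cons.prems(1)] Cons.prems(2) by auto
  have el: "eliminate E ?B vs (?c, ?d) = (cF, dF)" using Cons.prems(3) by simp
  have ws: "weight E ?c ?d W' =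
      (if \<exists>u. {x\<in>W'. {v, x} \<in> E} = {u}
       then weight E c d W' + gain E ?B c d v (THE u. {x\<in>W'. {v, x} \<in> E} = {u}) else weight E c d W')"
    if "tree_on E W'" "W' \<subseteq> ?B" for W'
    using weight_step[OF ll _ that, of v c d] v(1) AB by simp
  show ?case
  proof (cases "W = {v}")
    case True
    have "cF v = c v"
      using eliminate_fst_outside[of v ?B E vs "(?c, ?d)"] el by (auto simp: c_step_def gain_def)
    with True show ?thesis by (simp add: weight_singleton[OF ll])
  next
    case False
    show ?thesis
    proof (cases "v \<in> W")
      case vW: True
      obtain u where u: "{x\<in>W - {v}. {v, x} \<in> E} = {u}" and t: "tree_on E (W - {v})"
        using tree_on_remove_simplicial[OF ll Cons.prems(4) vW False v(1) Cons.prems(5)] by blast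
      have sub: "W - {v} \<subseteq> ?B" using Cons.prems by blast
      have "u \<in> ?B" "{v, u} \<in> E" using u sub by blast+
      then have g: "c v + d {v, u} \<le> gain E ?B c d v u" by (simp add: gain_def)
      have "weight E c d W = weight E c d (W - {v}) + c v + d {v, u}"
        using weight_insert_leaf[OF ll tree_on_finite[OF t] _ u, of c d] vW by (simp add: insert_absorb)
      also have "\<dots> \<le> weight E ?c ?d (W - {v})"
        using g unfolding ws[OF t sub] u by simp
      finally show ?thesis using Cons.IH[OF v(2) B el t sub] by fastforce
    next
      case vW: False
      then have sub: "W \<subseteq> ?B" using Cons.prems by blast
      have "weight E c d W \<le> weight E ?c ?d W"
        using ws[OF Cons.prems(4) sub] by (simp add: gain_def)
      then show ?thesis using Cons.IH[OF v(2) B el Cons.prems(4) sub] by fastforce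
    qed
  qed
qed

section \<open>Reasoning about programs with bounded numbers\<close>

lemma bits_mono: "\<bar>k\<bar> \<le> M \<Longrightarrow> bits k \<le> bits M"
  unfolding bits_def by (intro add_mono floorlog_mono) auto

lemma bits_pos: "1 \<le> bits k"
  by (simp add: bits_def)

lemma bits_power_2: "bits (2 ^ k) = k + 2"
  using floorlog_power[of 1 2 k] by (simp add: bits_def nat_power_eq floorlog_def)

lemma abs_le_power_bits: "\<bar>k\<bar> \<le> 2 ^ bits k"
proof (cases "k = 0")
  case False
  then have "nat \<bar>k\<bar> < 2 ^ floorlog 2 (nat \<bar>k\<bar>)"
    using floorlog_bounds[of "nat \<bar>k\<bar>" 2] by simp
  also have "\<dots> \<le> 2 ^ bits k" by (intro power_increasing) (auto simp: bits_def)
  finally have "int (nat \<bar>k\<bar>) \<le> int (2 ^ bits k)" by simp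
  then show ?thesis by simp
qed simp

text \<open>Every charge for an expression is the length of a constant, an address, an operand or a
  result. Bounding all of them by \<open>M\<close> reduces the cost analysis to counting the
  charges, which is what \<open>asize\<close> does.\<close>

fun asafe :: "int \<Rightarrow> aexp \<Rightarrow> state \<Rightarrow> bool" where
  "asafe M (Const k) s \<longleftrightarrow> \<bar>k\<bar> \<le> M"
| "asafe M (Read a i) s \<longleftrightarrow> asafe M i s \<and> \<bar>s a (aval i s)\<bar> \<le> M"
| "asafe M (Op f x y) s \<longleftrightarrow> asafe M x s \<and> asafe M y s \<and> \<bar>aop_val f (aval x s) (aval y s)\<bar> \<le> M"

fun asize :: "aexp \<Rightarrow> nat" where
  "asize (Const k) = 1"
| "asize (Read a i) = asize i + 2"
| "asize (Op f x y) = asize x + asize y + 3"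

lemma asafe_aval: "asafe M e s \<Longrightarrow> \<bar>aval e s\<bar> \<le> M"
  by (cases e) auto

lemma acost_le: "asafe M e s \<Longrightarrow> acost e s \<le> asize e * bits M"
proof (induction e)
  case (Read a i)
  then show ?case using bits_mono[OF asafe_aval[of M i s]] bits_mono[of "s a (aval i s)" M]
    by (simp add: algebra_simps)
next
  case (Op f x y)
  then show ?case
    using bits_mono[OF asafe_aval[of M x s]] bits_mono[OF asafe_aval[of M y s]]
      bits_mono[of "aop_val f (aval x s) (aval y s)" M]
    by (simp add: algebra_simps)
qed (simp add: bits_mono)

text \<open>Both operands of \<open>And\<close> have to be safe whatever the first one evaluates to,
  in accordance with \<open>bcost\<close>.\<close>

fun bsafe :: "int \<Rightarrow> bexp \<Rightarrow> state \<Rightarrow> bool" where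
  "bsafe M (Less x y) s \<longleftrightarrow> asafe M x s \<and> asafe M y s"
| "bsafe M (Eq x y) s \<longleftrightarrow> asafe M x s \<and> asafe M y s"
| "bsafe M (Not b) s \<longleftrightarrow> bsafe M b s"
| "bsafe M (And b b') s \<longleftrightarrow> bsafe M b s \<and> bsafe M b' s"

fun bsize :: "bexp \<Rightarrow> nat" where
  "bsize (Less x y) = asize x + asize y + 2"
| "bsize (Eq x y) = asize x + asize y + 2"
| "bsize (Not b) = bsize b + 1"
| "bsize (And b b') = bsize b + bsize b' + 1"

lemma bcost_le: "bsafe M b s \<Longrightarrow> bcost b s \<le> bsize b * bits M"
proof (induction b)
  case (Less x y)
  then show ?case
    using bits_mono[OF asafe_aval[of M x s]] bits_mono[OF asafe_aval[of M y s]]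
      acost_le[of M x s] acost_le[of M y s] by (simp add: algebra_simps)
next
  case (Eq x y)
  then show ?case
    using bits_mono[OF asafe_aval[of M x s]] bits_mono[OF asafe_aval[of M y s]]
      acost_le[of M x s] acost_le[of M y s] by (simp add: algebra_simps)
next
  case (Not b)
  then show ?case using bits_pos[of M] by simp
next
  case (And b b')
  then show ?case using bits_pos[of M] by (simp add: algebra_simps)
qed

text \<open>A size of programs that charges every loop for \<open>m\<close> iterations; multiplied by the length of
  the largest number handled, it bounds the running time.\<close>

fun csize :: "nat \<Rightarrow> com \<Rightarrow> nat" where
  "csize m Skip = 1"
| "csize m (Write a i e) = asize i + asize e + 2"
| "csize m (Seq p q) = csize m p + csize m q"
| "csize m (If b p q) = bsize b + csize m p + csize m q"
| "csize m (While b p) = m * (bsize b + csize m p) + bsize b"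

text \<open>Every enclosing loop contributes one factor \<open>m\<close>, and the nesting depth of a
  fixed program is fixed.\<close>

lemma csize_poly: "\<exists>P. \<forall>m. csize m p = poly P m"
proof (induction p)
  case Skip
  show ?case by (intro exI[of _ "[:1:]"]) simp
next
  case (Write a i e)
  show ?case by (intro exI[of _ "[:asize i + asize e + 2:]"]) simp
next
  case (Seq p q)
  then obtain P Q where "\<forall>m. csize m p = poly P m" "\<forall>m. csize m q = poly Q m" by blast
  then show ?case by (intro exI[of _ "P + Q"]) simp
next
  case (If b p q)
  then obtain P Q where "\<forall>m. csize m p = poly P m" "\<forall>m. csize m q = poly Q m" by blast
  then show ?case by (intro exI[of _ "[:bsize b:] + P + Q"]) simp
next
  case (While b p)
  then obtain P where "\<forall>m. csize m p = poly P m" by blast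
  then show ?case by (intro exI[of _ "[:0, 1:] * ([:bsize b:] + P) + [:bsize b:]"]) simp
qed

text \<open>Termination, final state and running time in one relation. With \<open>M\<close> and
  \<open>m\<close> the same for all parts of a program, sequential composition only adds
  sizes.\<close>

definition reach :: "int \<Rightarrow> nat \<Rightarrow> com \<Rightarrow> state \<Rightarrow> state \<Rightarrow> bool" where
  "reach M m p s s' \<longleftrightarrow> (\<exists>t. exec p s t s' \<and> t \<le> csize m p * bits M)"

lemma reach_Seq:
  assumes "reach M m p s s'" "reach M m q s' s''"
  shows "reach M m (Seq p q) s s''"
proof -
  from assms obtain t t' where "exec p s t s'" "t \<le> csize m p * bits M"
      "exec q s' t' s''" "t' \<le> csize m q * bits M"
    by (auto simp: reach_def)
  then show ?thesis unfolding reach_def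
    by (intro exI[of _ "t + t'"]) (auto intro: exec.Seq simp: distrib_right)
qed

text \<open>Preconditions that also demand safety. Loops are rejected: they arise only through
  \<open>For\<close> and are handled by \<open>reach_For\<close>.\<close>

fun wp :: "int \<Rightarrow> com \<Rightarrow> (state \<Rightarrow> bool) \<Rightarrow> state \<Rightarrow> bool" where
  "wp M Skip Q s \<longleftrightarrow> Q s"
| "wp M (Write a i e) Q s \<longleftrightarrow>
     asafe M i s \<and> asafe M e s \<and> Q (s(a := (s a)(aval i s := aval e s)))"
| "wp M (Seq p q) Q s \<longleftrightarrow> wp M p (wp M q Q) s"
| "wp M (If b p q) Q s \<longleftrightarrow> bsafe M b s \<and> (if bval b s then wp M p Q s else wp M q Q s)"
| "wp M (While b p) Q s \<longleftrightarrow> False"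

lemma reach_wp: "wp M p Q s \<Longrightarrow> \<exists>s'. reach M m p s s' \<and> Q s'"
proof (induction p arbitrary: Q s)
  case Skip
  then show ?case using bits_pos[of M] by (auto simp: reach_def intro!: exec.Skip exI[of _ 1])
next
  case (Write a i e)
  then have "acost i s + acost e s + bits (aval i s) + bits (aval e s) \<le> csize m (Write a i e) * bits M"
    using acost_le[of M i s] acost_le[of M e s] bits_mono[OF asafe_aval[of M i s]]
      bits_mono[OF asafe_aval[of M e s]] by (simp add: algebra_simps)
  with Write show ?case unfolding reach_def using exec.Write by fastforce
next
  case (Seq p q)
  from Seq.prems have "wp M p (wp M q Q) s" by simp
  from Seq.IH(1)[OF this] obtain s' where "reach M m p s s'" "wp M q Q s'" by blast
  with Seq.IH(2) show ?case using reach_Seq by fastforce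
next
  case (If b p q)
  have b: "bcost b s \<le> bsize b * bits M" using If.prems by (simp add: bcost_le)
  show ?case
  proof (cases "bval b s")
    case True
    with If obtain s' t where s': "exec p s t s'" "t \<le> csize m p * bits M" "Q s'"
      by (fastforce simp: reach_def)
    then have "bcost b s + t \<le> csize m (If b p q) * bits M" using b by (simp add: algebra_simps)
    with s' exec.IfTrue[of b s p t s' q] True show ?thesis unfolding reach_def by blast
  next
    case False
    with If obtain s' t where s': "exec q s t s'" "t \<le> csize m q * bits M" "Q s'"
      by (fastforce simp: reach_def)
    then have "bcost b s + t \<le> csize m (If b p q) * bits M" using b by (simp add: algebra_simps)
    with s' exec.IfFalse[of b s q t s' p] False show ?thesis unfolding reach_def by blast
  qed
qed simp

section \<open>Frame reasoning and counting loops\<close>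

fun writes :: "com \<Rightarrow> nat set" where
  "writes Skip = {}"
| "writes (Write a i e) = {a}"
| "writes (Seq p q) = writes p \<union> writes q"
| "writes (If b p q) = writes p \<union> writes q"
| "writes (While b p) = writes p"

lemma exec_frame: "exec p s t s' \<Longrightarrow> a \<notin> writes p \<Longrightarrow> s' a = s a"
  by (induction rule: exec.induct) auto

lemma reach_frame: "reach M m p s s' \<Longrightarrow> a \<notin> writes p \<Longrightarrow> s' a = s a"
  by (auto simp: reach_def exec_frame)

text \<open>A scalar variable is cell 0 of an array of its own.\<close>

abbreviation Var :: "nat \<Rightarrow> aexp" where "Var x \<equiv> Read x (Const 0)"
abbreviation Assign :: "nat \<Rightarrow> aexp \<Rightarrow> com" (infix "::=" 62) where "x ::= e \<equiv> Write x (Const 0) e"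
abbreviation Add_syntax (infixl "\<oplus>" 65) where "x \<oplus> y \<equiv> Op Add x y"
abbreviation Sub_syntax (infixl "\<ominus>" 65) where "x \<ominus> y \<equiv> Op Sub x y"
abbreviation Mul_syntax (infixl "\<otimes>" 70) where "x \<otimes> y \<equiv> Op Mul x y"
abbreviation Div_syntax (infixl "\<oslash>" 70) where "x \<oslash> y \<equiv> Op Div x y"
abbreviation Seq_syntax (infixr ";;" 60) where "p ;; q \<equiv> Seq p q"

definition For :: "nat \<Rightarrow> aexp \<Rightarrow> com \<Rightarrow> com" where
  "For x e p = x ::= Const 0 ;; While (Less (Var x) e) (p ;; x ::= Var x \<oplus> Const 1)"

lemma writes_For [simp]: "writes (For x e p) = insert x (writes p)"
  by (auto simp: For_def)

text \<open>The invariant carries its own index \<open>k\<close>, and \<open>indep\<close> makes it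
  insensitive to the counter array, so initialising and incrementing \<open>x\<close> preserve it
  for free. By \<open>bound\<close> the limit keeps its value, which fixes the number of iterations
  at \<open>l\<close>.\<close>

lemma reach_For:
  fixes I :: "nat \<Rightarrow> state \<Rightarrow> bool"
  assumes init: "I 0 s"
    and step: "\<And>k s. k < l \<Longrightarrow> I k s \<Longrightarrow> s x 0 = int k \<Longrightarrow> \<exists>s'. reach M m p s s' \<and> I (Suc k) s'"
    and x: "x \<notin> writes p"
    and indep: "\<And>k s f. I k s \<Longrightarrow> I k (s(x := f))"
    and bound: "\<And>k s. I k s \<Longrightarrow> asafe M e s \<and> aval e s = int l"
    and M: "int l + 1 \<le> M" and lm: "l \<le> m"
  shows "\<exists>s'. reach M m (For x e p) s s' \<and> I l s'"
proof -
  let ?b = "Less (Var x) e" and ?q = "p ;; x ::= Var x \<oplus> Const 1"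
  \<comment> \<open>Induction on the number of remaining iterations; the summand
    \<open>bsize ?b\<close> outside the product pays for the last, failing test.\<close>
  have loop: "\<exists>t s'. exec (While ?b ?q) s t s' \<and>
      t \<le> ((l - k) * (bsize ?b + csize m ?q) + bsize ?b) * bits M \<and> I l s'"
    if "k \<le> l" "I k s" "s x 0 = int k" for k s
    using that
  proof (induction "l - k" arbitrary: k s)
    case 0
    then have kl: "k = l" by simp
    have "bsafe M ?b s" using 0 kl bound[OF 0(3)] M by auto
    from bcost_le[OF this] have "bcost ?b s \<le> bsize ?b * bits M" .
    moreover have "\<not> bval ?b s" using 0 kl bound[OF 0(3)] by simp
    ultimately show ?case using 0(3) kl exec.WhileFalse[of ?b s ?q]
      by (intro exI[of _ "bcost ?b s"] exI[of _ s]) (simp del: bcost.simps bsize.simps)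
  next
    case (Suc j)
    then have kl: "k < l" by simp
    have sf: "bsafe M ?b s" using Suc(3-5) kl bound[OF Suc(4)] M by auto
    from bcost_le[OF this] have b: "bcost ?b s \<le> bsize ?b * bits M" .
    have bt: "bval ?b s" using Suc(5) kl bound[OF Suc(4)] by simp
    from step[OF kl Suc(4,5)] obtain s1 where s1: "reach M m p s s1" "I (Suc k) s1" by blast
    have x1: "s1 x 0 = int k" using reach_frame[OF s1(1) x] Suc(5) by simp
    let ?s2 = "s1(x := (s1 x)(0 := int (Suc k)))"
    have "wp M (x ::= Var x \<oplus> Const 1) (\<lambda>s. s = ?s2) s1"
      using x1 kl M by (auto simp: add.commute)
    from reach_wp[OF this] have "reach M m (x ::= Var x \<oplus> Const 1) s1 ?s2"
      by simp
    from reach_Seq[OF s1(1) this] obtain t1 where t1: "exec ?q s t1 ?s2" "t1 \<le> csize m ?q * bits M"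
      unfolding reach_def by blast
    have "j = l - Suc k" "Suc k \<le> l" "I (Suc k) ?s2" "?s2 x 0 = int (Suc k)"
      using Suc(2) kl indep[OF s1(2)] by auto
    from Suc(1)[OF this] obtain t2 s' where
      s': "exec (While ?b ?q) ?s2 t2 s'"
        "t2 \<le> ((l - Suc k) * (bsize ?b + csize m ?q) + bsize ?b) * bits M" "I l s'" by blast
    have "l - k = Suc (l - Suc k)" using kl by simp
    then have "bcost ?b s + t1 + t2 \<le> ((l - k) * (bsize ?b + csize m ?q) + bsize ?b) * bits M"
      using b t1(2) s'(2) by (simp add: distrib_right del: bcost.simps bsize.simps csize.simps)
    moreover have "exec (While ?b ?q) s (bcost ?b s + t1 + t2) s'"
      using bt t1(1) s'(1) by (rule exec.WhileTrue)
    ultimately show ?case using s'(3) by blast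
  qed
  let ?s1 = "s(x := (s x)(0 := 0))"
  have "wp M (x ::= Const 0) (\<lambda>s. s = ?s1) s" using M by auto
  from reach_wp[OF this] have 1: "reach M m (x ::= Const 0) s ?s1" by simp
  have "0 \<le> l" "I 0 ?s1" "?s1 x 0 = int 0" using indep[OF init] by auto
  from loop[OF this] obtain t s' where
    t: "exec (While ?b ?q) ?s1 t s'" "t \<le> (l * (bsize ?b + csize m ?q) + bsize ?b) * bits M" "I l s'"
    unfolding minus_nat.diff_0 by blast
  note t(2)
  also have "(l * (bsize ?b + csize m ?q) + bsize ?b) * bits M \<le> csize m (While ?b ?q) * bits M"
    unfolding csize.simps(5) using lm by (intro mult_right_mono add_right_mono) auto
  finally have "reach M m (While ?b ?q) ?s1 s'" unfolding reach_def using t(1) by blast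
  from reach_Seq[OF 1 this] t(3) show ?thesis unfolding For_def by blast
qed

definition agree :: "nat set \<Rightarrow> state \<Rightarrow> state \<Rightarrow> bool" where
  "agree X s s' \<longleftrightarrow> (\<forall>a. a \<notin> X \<longrightarrow> s' a = s a)"

lemma reach_agree: "reach M m p s s' \<Longrightarrow> agree (writes p) s s'"
  by (auto simp: agree_def reach_frame)

lemma agreeD: "agree X s s' \<Longrightarrow> a \<notin> X \<Longrightarrow> s' a = s a"
  by (simp add: agree_def)

lemma agree_refl: "agree X s s"
  by (simp add: agree_def)

lemma agree_trans: "agree X s s' \<Longrightarrow> agree Y s' s'' \<Longrightarrow> X \<union> Y \<subseteq> Z \<Longrightarrow> agree Z s s''"
  unfolding agree_def by (metis Un_iff subsetD)

lemma agree_upd: "agree X s s' \<Longrightarrow> a \<in> X \<Longrightarrow> agree X s (s'(a := f))"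
  by (auto simp: agree_def)

text \<open>Relates a position in a row-major matrix to its row and column in the form in which the
  machine computes them: it has a division but no remainder, hence the column as
  \<open>k - (k div n) * n\<close>.\<close>

lemma index_split:
  assumes "k < n * (n::nat)"
  shows "k div n < n" "k mod n < n" "int k div int n = int (k div n)"
    "int k - int (k div n) * int n = int (k mod n)"
    "int (k div n) * int n + int (k mod n) = int k"
    "int (k div n) * int n \<le> int n * int n"
proof -
  have n: "0 < n" using assms by (cases n) auto
  show a: "k div n < n" using assms by (simp add: less_mult_imp_div_less)
  show "k mod n < n" using n by simp
  show "int k div int n = int (k div n)" by (simp add: of_nat_div)
  have "int k = int (k div n * n + k mod n)" by simp
  then show "int k - int (k div n) * int n = int (k mod n)"
    "int (k div n) * int n + int (k mod n) = int k" unfolding of_nat_add of_nat_mult by linarith+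
  show "int (k div n) * int n \<le> int n * int n" using a by (intro mult_right_mono) auto
qed

lemma index_bound:
  assumes "u < n" "w < (n::nat)"
  shows "u * n + w < n * n"  "int u * int n + int w < int n * int n"
proof -
  have "u * n + w < Suc u * n" using assms by simp
  also have "\<dots> \<le> n * n" using assms by (intro mult_right_mono) auto
  finally show "u * n + w < n * n" .
  then have "int (u * n + w) < int (n * n)" by linarith
  then show "int u * int n + int w < int n * int n" by simp
qed

section \<open>The program\<close>

text \<open>
  \<open>aC\<close> and \<open>aD\<close> hold the current vertex and edge weights, \<open>aADJ\<close> the adjacency matrix, \<open>aDEAD\<close> marks the
  eliminated vertices and \<open>aORD\<close> lists them in order; \<open>aNB\<close> and \<open>aGAIN\<close> hold the neighbours of the vertex
  \<open>vPICK\<close> being eliminated and their gains; \<open>aIN\<close> marks the vertices of the solution.  Matrices are stored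
  row by row, and \<open>vU\<close>, \<open>vW\<close> are recovered from the position \<open>vK\<close> of an entry.
  When the solution is built, \<open>vOK\<close> counts its neighbours of \<open>vPICK\<close> and \<open>vU\<close> is the last one found; it
  starts at 0 because both operands of \<open>And\<close> are charged, so the address must be small in any case.
\<close>

abbreviation (input) vN :: nat where "vN \<equiv> 2"
abbreviation (input) vDEN :: nat where "vDEN \<equiv> 3"
abbreviation (input) vI :: nat where "vI \<equiv> 4"
abbreviation (input) vJ :: nat where "vJ \<equiv> 5"
abbreviation (input) vK :: nat where "vK \<equiv> 6"
abbreviation (input) aC :: nat where "aC \<equiv> 7"
abbreviation (input) aD :: nat where "aD \<equiv> 8"
abbreviation (input) aADJ :: nat where "aADJ \<equiv> 9"
abbreviation (input) aDEAD :: nat where "aDEAD \<equiv> 10"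
abbreviation (input) aORD :: nat where "aORD \<equiv> 11"
abbreviation (input) vPICK :: nat where "vPICK \<equiv> 12"
abbreviation (input) vOK :: nat where "vOK \<equiv> 13"
abbreviation (input) aNB :: nat where "aNB \<equiv> 14"
abbreviation (input) aGAIN :: nat where "aGAIN \<equiv> 15"
abbreviation (input) vROOT :: nat where "vROOT \<equiv> 16"
abbreviation (input) aIN :: nat where "aIN \<equiv> 17"
abbreviation (input) vU :: nat where "vU \<equiv> 18"
abbreviation (input) vW :: nat where "vW \<equiv> 19"
abbreviation (input) vX :: nat where "vX \<equiv> 20"

text \<open>The common denominator is the plain product of all denominators, which avoids computing
  gcds. Entries of non-edges carry denominator 1 and do not disturb it.\<close>

definition den_body :: "aexp \<Rightarrow> com" where
  "den_body e = vDEN ::= Var vDEN \<otimes> Read 0 e"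

definition scale_c_body :: com where
  "scale_c_body = Write aC (Var vJ)
     (Read 0 (Const 2 \<otimes> Var vJ \<oplus> Const 1) \<otimes> (Var vDEN \<oslash> Read 0 (Const 2 \<otimes> Var vJ \<oplus> Const 2)))"

text \<open>The number \<open>n\<close> and the vertex weights fill cells 0 to \<open>2 * n\<close>
  of the input. The matrix follows in blocks of three cells: flag, numerator and denominator for
  \<open>j\<close> equal to 1, 2 and 3.\<close>

abbreviation (input) entry :: "int \<Rightarrow> aexp" where
  "entry j \<equiv> Const 2 \<otimes> Var vN \<oplus> Const 3 \<otimes> Var vK \<oplus> Const j"

definition scale_d_body :: com where
  "scale_d_body =
     Write aADJ (Var vK) (Read 0 (entry 1)) ;;
     Write aD (Var vK) (Read 0 (entry 2) \<otimes> (Var vDEN \<oslash> Read 0 (entry 3)))"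

definition load :: com where
  "load =
     (vN ::= Read 0 (Const 0) ;; vDEN ::= Const 1) ;;
     For vJ (Var vN) (den_body (Const 2 \<otimes> Var vJ \<oplus> Const 2)) ;;
     For vK (Var vN \<otimes> Var vN) (den_body (entry 3)) ;;
     For vJ (Var vN) scale_c_body ;;
     For vK (Var vN \<otimes> Var vN) scale_d_body"

text \<open>Searches for a violating pair. The cells involved are 0 or 1, so sum 0 says that both
  vertices are alive and not adjacent, and sum 2 that both are neighbours of
  \<open>vJ\<close>.\<close>

definition find_body :: com where
  "find_body =
     vU ::= Var vK \<oslash> Var vN ;;
     vW ::= Var vK \<ominus> Var vU \<otimes> Var vN ;;
     If (And (Eq (Read aDEAD (Var vU) \<oplus> Read aDEAD (Var vW) \<oplus> Read aADJ (Var vK)) (Const 0))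
          (And (Eq (Read aADJ (Var vJ \<otimes> Var vN \<oplus> Var vU) \<oplus> Read aADJ (Var vJ \<otimes> Var vN \<oplus> Var vW)) (Const 2))
            (Not (Eq (Var vU) (Var vW)))))
       (vOK ::= Const 0) Skip"

text \<open>An eliminated vertex starts with \<open>vOK = 0\<close> and is never picked. A later hit
  overwrites an earlier one; any simplicial vertex serves.\<close>

definition find_simplicial :: com where
  "find_simplicial =
     For vJ (Var vN)
       (vOK ::= Const 1 \<ominus> Read aDEAD (Var vJ) ;;
        For vK (Var vN \<otimes> Var vN) find_body ;;
        If (Eq (Var vOK) (Const 1)) (vPICK ::= Var vJ) Skip)"

text \<open>For a non-neighbour the cell of \<open>aD\<close> represents no edge and may hold any
  value within the bound; the factor \<open>aNB\<close> masks it.\<close>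

definition gain_body :: com where
  "gain_body =
     Write aNB (Var vJ) ((Const 1 \<ominus> Read aDEAD (Var vJ)) \<otimes> Read aADJ (Var vPICK \<otimes> Var vN \<oplus> Var vJ)) ;;
     vX ::= Read aC (Var vPICK) \<oplus> Read aD (Var vPICK \<otimes> Var vN \<oplus> Var vJ) ;;
     If (Less (Const 0) (Var vX))
       (Write aGAIN (Var vJ) (Read aNB (Var vJ) \<otimes> Var vX))
       (Write aGAIN (Var vJ) (Const 0))"

definition credit_body :: com where
  "credit_body = Write aC (Var vJ) (Read aC (Var vJ) \<oplus> Read aGAIN (Var vJ))"

text \<open>The flags also select the diagonal positions of neighbours. These represent no edge, but
  their cells may change and so must be included in the size bound.\<close>

definition debit_body :: com where
  "debit_body =
     vU ::= Var vK \<oslash> Var vN ;;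
     vW ::= Var vK \<ominus> Var vU \<otimes> Var vN ;;
     Write aD (Var vK) (Read aD (Var vK) \<ominus>
       Read aNB (Var vU) \<otimes> Read aNB (Var vW) \<otimes> (Read aGAIN (Var vU) \<oplus> Read aGAIN (Var vW)))"

definition eliminate_body :: com where
  "eliminate_body =
     find_simplicial ;;
     (Write aDEAD (Var vPICK) (Const 1) ;; Write aORD (Var vI) (Var vPICK)) ;;
     For vJ (Var vN) gain_body ;;
     For vJ (Var vN) credit_body ;;
     For vK (Var vN \<otimes> Var vN) debit_body"

definition root_body :: com where
  "root_body = If (Less (Read aC (Var vROOT)) (Read aC (Var vJ))) (vROOT ::= Var vJ) Skip"

definition find_root :: com where
  "find_root = vROOT ::= Const 0 ;; For vJ (Var vN) root_body"

definition count_body :: com where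
  "count_body =
     If (Eq (Read aIN (Var vJ) \<oplus> Read aADJ (Var vPICK \<otimes> Var vN \<oplus> Var vJ)) (Const 2))
       (vOK ::= Var vOK \<oplus> Const 1 ;; vU ::= Var vJ) Skip"

definition recover_body :: com where
  "recover_body =
     (vPICK ::= Read aORD (Var vN \<ominus> Const 1 \<ominus> Var vI) ;; vOK ::= Const 0 ;; vU ::= Const 0) ;;
     For vJ (Var vN) count_body ;;
     If (Eq (Var vPICK) (Var vROOT)) (Write aIN (Var vPICK) (Const 1))
       (If (And (Eq (Var vOK) (Const 1))
              (Less (Const 0) (Read aC (Var vPICK) \<oplus> Read aD (Var vPICK \<otimes> Var vN \<oplus> Var vU))))
         (Write aIN (Var vPICK) (Const 1)) Skip)"

definition output_body :: com where
  "output_body =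
     If (Eq (Read aIN (Var vJ)) (Const 1))
       (Write 0 (Var vK) (Var vJ) ;; vK ::= Var vK \<oplus> Const 1) Skip"

definition write_output :: com where
  "write_output = vK ::= Const 0 ;; For vJ (Var vN) output_body ;; 1 ::= Var vK"

definition solver :: com where
  "solver = load ;; For vI (Var vN) eliminate_body ;; find_root ;;
     For vI (Var vN) recover_body ;; write_output"

section \<open>Correctness of the elimination phase\<close>

text \<open>Only a lower bound on \<open>M\<close> is assumed, enough for addresses, counters and
  small constants. Bounds for the weights are separate hypotheses of the lemmas, and
  \<open>M\<close> gets its value in the final theorem.\<close>

locale ram_graph =
  fixes n :: nat and E :: "nat set set" and M :: int
  assumes ll: "loopless E" and M: "int n * int n + int n + 8 \<le> M"
begin

lemma M_ge: "int n + 8 \<le> M" "int n * int n + 8 \<le> M" "8 \<le> M" "0 \<le> M"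
  using M zero_le_square[of "int n"] by linarith+

lemma row_le_M: "u \<le> n \<Longrightarrow> int u * int n \<le> M"
  using mult_right_mono[of "int u" "int n" "int n"] M_ge by linarith

section \<open>Memory contents and the search for a simplicial vertex\<close>

definition graph_mem :: "state \<Rightarrow> bool" where
  "graph_mem s \<longleftrightarrow> s vN 0 = int n \<and>
     (\<forall>u<n. \<forall>w<n. s aADJ (int u * int n + int w) = (if {u, w} \<in> E then 1 else 0))"

lemma graph_memD:
  assumes "graph_mem s"
  shows "s vN 0 = int n"
    "\<And>u w. u < n \<Longrightarrow> w < n \<Longrightarrow> s aADJ (int u * int n + int w) = (if {u, w} \<in> E then 1 else 0)"
    "\<And>k. k < n * n \<Longrightarrow> s aADJ (int k) = (if {k div n, k mod n} \<in> E then 1 else 0)"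
proof -
  show a: "s vN 0 = int n"
    "\<And>u w. u < n \<Longrightarrow> w < n \<Longrightarrow> s aADJ (int u * int n + int w) = (if {u, w} \<in> E then 1 else 0)"
    using assms by (auto simp: graph_mem_def)
  show "s aADJ (int k) = (if {k div n, k mod n} \<in> E then 1 else 0)" if "k < n * n" for k
    using a(2)[OF index_split(1,2)[OF that]] index_split(5)[OF that] by simp
qed

lemma graph_mem_agree:
  "graph_mem s \<Longrightarrow> agree X s s' \<Longrightarrow> vN \<notin> X \<Longrightarrow> aADJ \<notin> X \<Longrightarrow> graph_mem s'"
  by (simp add: graph_mem_def agree_def)

definition dead_mem :: "nat set \<Rightarrow> state \<Rightarrow> bool" where
  "dead_mem A s \<longleftrightarrow> (\<forall>v<n. s aDEAD (int v) = (if v \<in> A then 0 else 1))"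

definition ok_pair :: "nat set \<Rightarrow> nat \<Rightarrow> nat \<Rightarrow> bool" where
  "ok_pair A v k \<longleftrightarrow>
    (let u = k div n; w = k mod n in
     u \<in> A \<and> w \<in> A \<and> {v, u} \<in> E \<and> {v, w} \<in> E \<and> u \<noteq> w \<longrightarrow> {u, w} \<in> E)"

lemma simplicial_ok_pair:
  assumes "A \<subseteq> {..<n}"
  shows "simplicial E A v \<longleftrightarrow> v \<in> A \<and> (\<forall>k<n*n. ok_pair A v k)"
proof -
  have "{u, w} \<in> E"
    if h: "\<forall>k<n*n. ok_pair A v k" "u \<in> A" "w \<in> A" "{v, u} \<in> E" "{v, w} \<in> E" "u \<noteq> w" for u w
  proof -
    have "u < n" "w < n" using h assms by auto
    then have "ok_pair A v (u * n + w)" "(u * n + w) div n = u" "(u * n + w) mod n = w"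
      using h(1) index_bound by auto
    then show ?thesis using h by (simp add: ok_pair_def)
  qed
  then show ?thesis unfolding simplicial_def ok_pair_def Let_def by blast
qed

lemma find_body_correct:
  assumes s: "graph_mem s" "dead_mem A s" "k < n * n" "v < n" "s vK 0 = int k" "s vJ 0 = int v"
    and ok: "s vOK 0 = 0 \<or> s vOK 0 = 1"
  shows "\<exists>s'. reach M m find_body s s' \<and>
     s' vOK 0 = (if ok_pair A v k then s vOK 0 else 0)"
proof -
  note g = graph_memD[OF s(1)] and i = index_split[OF s(3)]
  let ?u = "k div n" and ?w = "k mod n"
  define x y z p q where "x = s aDEAD (int ?u)" and "y = s aDEAD (int ?w)" and "z = s aADJ (int k)"
    and "p = s aADJ (int v * int n + int ?u)" and "q = s aADJ (int v * int n + int ?w)"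
  note xs = this
  have v: "x = (if ?u \<in> A then 0 else 1)" "y = (if ?w \<in> A then 0 else 1)"
    "z = (if {?u, ?w} \<in> E then 1 else 0)" "p = (if {v, ?u} \<in> E then 1 else 0)"
    "q = (if {v, ?w} \<in> E then 1 else 0)"
    unfolding xs using s(2,4) i(1,2) g(3)[OF s(3)] g(2)[OF s(4)] by (auto simp: dead_mem_def)
  have r: "0 \<le> x" "x \<le> 1" "0 \<le> y" "y \<le> 1" "0 \<le> z" "z \<le> 1" "0 \<le> p" "p \<le> 1" "0 \<le> q" "q \<le> 1"
    unfolding v by auto
  \<comment> \<open>The sums of 0/1 cells tested by the program express precisely that the pair
    violates \<open>ok_pair\<close>.\<close>
  have c: "(if x + y + z = 0 \<and> p + q = 2 \<and> ?u \<noteq> ?w then 0 else s vOK 0) = (if ok_pair A v k then s vOK 0 else 0)"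
    unfolding v ok_pair_def Let_def by auto
  have b: "int v * int n + int ?u < int n * int n" "int v * int n + int ?w < int n * int n"
    "int v * int n \<le> int n * int n" "int k < int n * int n"  "0 \<le> int v * int n"
    using index_bound(2) s(4) i s(3) by (auto intro: mult_right_mono simp flip: of_nat_mult)
  have b1: "int ?u * int n \<le> M" "int ?w * int n \<le> M"
    using i by (auto intro!: row_le_M)
  have b2: "int ?u \<le> int n" "int ?w \<le> int n" "int v \<le> int n" using i s(4) by auto
  have "wp M find_body (\<lambda>s'. s' vOK 0 = (if x + y + z = 0 \<and> p + q = 2 \<and> ?u \<noteq> ?w then 0 else s vOK 0)) s"
    unfolding find_body_def
    using r b b1 b2 M s(5,6)
    by (simp add: g(1) i(3,4) i(6) xs[symmetric] del: of_nat_mult of_nat_div of_nat_mod)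
  from reach_wp[OF this] show ?thesis unfolding c .
qed

lemma writes_find_body: "writes find_body = {vU, vW, vOK}"
  by (auto simp: find_body_def)

lemma find_simplicial_correct:
  assumes s0: "graph_mem s0" "dead_mem A s0" and A: "A \<subseteq> {..<n}" and ex: "\<exists>v. simplicial E A v"
    and m: "n * n \<le> m"
  shows "\<exists>s' p. reach M m find_simplicial s0 s' \<and> s' vPICK 0 = int p \<and> simplicial E A p"
proof -
  have nm: "n \<le> m" using m by (cases n) auto
  \<comment> \<open>Only the existence of a hit is recorded; which simplicial vertex has been picked
    is left open.\<close>
  define I where "I v s \<longleftrightarrow> agree {vJ, vK, vPICK, vOK, vU, vW} s0 s \<and>
    ((\<exists>u<v. simplicial E A u) \<longrightarrow> (\<exists>p. s vPICK 0 = int p \<and> simplicial E A p))" for v s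
  let ?p1 = "vOK ::= Const 1 \<ominus> Read aDEAD (Var vJ)"
  let ?p2 = "For vK (Var vN \<otimes> Var vN) find_body"
  let ?p3 = "If (Eq (Var vOK) (Const 1)) (vPICK ::= Var vJ) Skip"
  have "\<exists>s'. reach M m (For vJ (Var vN) (?p1 ;; ?p2 ;; ?p3)) s0 s' \<and> I n s'"
  proof (rule reach_For)
    show "I 0 s0" by (simp add: I_def agree_refl)
    show "vJ \<notin> writes (?p1 ;; ?p2 ;; ?p3)" by (simp add: writes_find_body)
    show "I k (s(vJ := f))" if "I k s" for k s f using that by (simp add: I_def agree_upd)
    show "asafe M (Var vN) s \<and> aval (Var vN) s = int n" if "I k s" for k s
      using graph_memD(1)[OF graph_mem_agree[OF s0(1), of _ s]] that M_ge by (auto simp: I_def)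
    show "int n + 1 \<le> M" using M_ge by linarith
    show "n \<le> m" by (rule nm)
  next
    fix v s assume v: "v < n" and Is: "I v s" and sv: "s vJ 0 = int v"
    have ag: "agree {vJ, vK, vPICK, vOK, vU, vW} s0 s" using Is by (simp add: I_def)
    have gs: "graph_mem s" by (rule graph_mem_agree[OF s0(1) ag]) auto
    have ds: "dead_mem A s" using s0(2) ag by (simp add: dead_mem_def agree_def)
    have "wp M ?p1 (\<lambda>s. s vOK 0 = (if v \<in> A then 1 else 0)) s"
      using v sv ds M_ge by (auto simp: dead_mem_def)
    then obtain s1 where s1: "reach M m ?p1 s s1" "s1 vOK 0 = (if v \<in> A then 1 else 0)"
      using reach_wp by blast
    have ag1: "agree {vOK} s s1" using reach_agree[OF s1(1)] by simp
    define J where "J k t \<longleftrightarrow> agree {vK, vU, vW, vOK} s1 t \<and>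
      t vOK 0 = (if v \<in> A \<and> (\<forall>k'<k. ok_pair A v k') then 1 else 0)" for k t
    have Jmem: "graph_mem t" "dead_mem A t" "t vJ 0 = int v" if "J k t" for k t
    proof -
      have ag2: "agree {vK, vU, vW, vOK} s t"
        using that by (intro agree_trans[OF ag1]) (auto simp: J_def)
      show "graph_mem t" by (rule graph_mem_agree[OF gs ag2]) auto
      show "dead_mem A t" "t vJ 0 = int v" using ag2 ds sv by (auto simp: dead_mem_def agree_def)
    qed
    have "\<exists>t. reach M m ?p2 s1 t \<and> J (n * n) t"
    proof (rule reach_For)
      show "J 0 s1" using s1(2) by (simp add: J_def agree_refl)
      show "vK \<notin> writes find_body" by (simp add: writes_find_body)
      show "J k (s(vK := f))" if "J k s" for k s f using that by (simp add: J_def agree_upd)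
      show "asafe M (Var vN \<otimes> Var vN) t \<and> aval (Var vN \<otimes> Var vN) t = int (n * n)"
        if "J k t" for k t
        using graph_memD(1)[OF Jmem(1)[OF that]] M_ge by (auto simp: abs_mult)
      show "int (n * n) + 1 \<le> M" using M by simp
      show "n * n \<le> m" by (rule m)
    next
      fix k t assume k: "k < n * n" and Jt: "J k t" and tk: "t vK 0 = int k"
      have "t vOK 0 = 0 \<or> t vOK 0 = 1" using Jt by (simp add: J_def)
      then obtain t' where t': "reach M m find_body t t'"
          "t' vOK 0 = (if ok_pair A v k then t vOK 0 else 0)"
        using find_body_correct[OF Jmem(1,2)[OF Jt] k v tk Jmem(3)[OF Jt]] by blast
      have "agree {vU, vW, vOK} t t'" using reach_agree[OF t'(1)] by (simp add: writes_find_body)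
      then have "agree {vK, vU, vW, vOK} s1 t'"
        using Jt by (auto simp: J_def intro: agree_trans)
      then have "J (Suc k) t'" using t'(2) Jt by (auto simp: J_def less_Suc_eq)
      with t'(1) show "\<exists>t'. reach M m find_body t t' \<and> J (Suc k) t'" by blast
    qed
    then obtain s2 where s2: "reach M m ?p2 s1 s2" "J (n * n) s2" by blast
    have ok: "s2 vOK 0 = (if simplicial E A v then 1 else 0)"
      using s2(2) by (simp add: J_def simplicial_ok_pair[OF A])
    have "wp M ?p3 (\<lambda>s3. s3 vPICK 0 = (if simplicial E A v then int v else s2 vPICK 0)) s2"
      using ok Jmem(3)[OF s2(2)] M_ge v by auto
    then obtain s3 where s3: "reach M m ?p3 s2 s3"
        "s3 vPICK 0 = (if simplicial E A v then int v else s2 vPICK 0)"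
      using reach_wp by blast
    have r: "reach M m (?p1 ;; ?p2 ;; ?p3) s s3"
      by (intro reach_Seq[OF s1(1)] reach_Seq[OF s2(1)] s3(1))
    have "agree {vK, vPICK, vOK, vU, vW} s s3"
      using reach_agree[OF r] by (simp add: writes_find_body insert_commute)
    then have "agree {vJ, vK, vPICK, vOK, vU, vW} s0 s3" by (rule agree_trans[OF ag]) auto
    moreover have "s2 vPICK 0 = s vPICK 0"
      using s2(2) ag1 by (simp add: J_def agree_def)
    ultimately have "I (Suc v) s3" using Is s3(2) by (auto simp: I_def less_Suc_eq)
    with r show "\<exists>s'. reach M m (?p1 ;; ?p2 ;; ?p3) s s' \<and> I (Suc v) s'" by blast
  qed
  moreover have "\<exists>u<n. simplicial E A u" using ex A by (auto simp: simplicial_def)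
  ultimately show ?thesis unfolding find_simplicial_def I_def by blast
qed

lemma writes_find_simplicial: "writes find_simplicial = {vJ, vK, vPICK, vOK, vU, vW}"
  by (auto simp: find_simplicial_def writes_find_body)

section \<open>One elimination step on the weights\<close>

definition weights_mem :: "(nat \<Rightarrow> int) \<Rightarrow> (nat set \<Rightarrow> int) \<Rightarrow> state \<Rightarrow> bool" where
  "weights_mem c d s \<longleftrightarrow> (\<forall>v<n. s aC (int v) = c v) \<and>
     (\<forall>u<n. \<forall>w<n. {u, w} \<in> E \<longrightarrow> s aD (int u * int n + int w) = d {u, w})"

text \<open>\<open>weights_mem\<close> leaves the cells of non-edges free, since those on the
  diagonal get altered. They are nevertheless read and charged, so this bound covers the whole
  matrix.\<close>

definition weights_le :: "int \<Rightarrow> state \<Rightarrow> bool" where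
  "weights_le b s \<longleftrightarrow> (\<forall>v<n. \<bar>s aC (int v)\<bar> \<le> b) \<and> (\<forall>k<n*n. \<bar>s aD (int k)\<bar> \<le> b)"

lemma weights_le_row:
  assumes "weights_le b s" "u < n" "w < n"
  shows "\<bar>s aD (int u * int n + int w)\<bar> \<le> b"
proof -
  have "int u * int n + int w = int (u * n + w)" by simp
  then show ?thesis using assms index_bound(1)[OF assms(2,3)] unfolding weights_le_def by metis
qed

definition nb :: "nat set \<Rightarrow> nat \<Rightarrow> nat \<Rightarrow> int" where
  "nb A p j = (if j \<in> A \<and> {p, j} \<in> E then 1 else 0)"

lemma gain_body_correct:
  assumes s: "graph_mem s" "dead_mem A s" "weights_mem c d s" "weights_le b s"
    and j: "j < n" "s vJ 0 = int j" and p: "p < n" "s vPICK 0 = int p" and b: "2 * b \<le> M"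
  shows "\<exists>s'. reach M m gain_body s s' \<and>
     s' aNB = (s aNB)(int j := nb A p j) \<and> s' aGAIN = (s aGAIN)(int j := gain E A c d p j)"
proof -
  note g = graph_memD[OF s(1)]
  define x y a e where "x = s aDEAD (int j)" and "y = s aADJ (int p * int n + int j)"
    and "a = s aC (int p)" and "e = s aD (int p * int n + int j)"
  note xs = this
  have x: "x = (if j \<in> A then 0 else 1)" and y: "y = (if {p, j} \<in> E then 1 else 0)"
    unfolding xs using s(2) g(2)[OF p(1) j(1)] j by (auto simp: dead_mem_def)
  have ac: "a = c p" unfolding xs using s(3) p by (simp add: weights_mem_def)
  \<comment> \<open>\<open>e\<close> is a weight only if \<open>{p, j}\<close> is an edge; otherwise
    the factor \<open>y = 0\<close> removes it.\<close>
  have ed: "e = d {p, j}" if "{p, j} \<in> E" unfolding xs using s(3) p j that by (simp add: weights_mem_def)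
  have nbxy: "nb A p j = (1 - x) * y" by (simp add: nb_def x y)
  have gx: "gain E A c d p j = (if 0 < a + e then (1 - x) * y * (a + e) else 0)"
    using ed by (auto simp: gain_def x y ac)
  have xy: "(x = 0 \<or> x = 1)" "(y = 0 \<or> y = 1)" by (simp_all add: x y)
  have ae: "\<bar>a\<bar> \<le> b" "\<bar>e\<bar> \<le> b"
    unfolding xs using s(4) p weights_le_row[OF s(4) p(1) j(1)] by (auto simp: weights_le_def)
  have n2: "int p * int n + int j < int n * int n" "0 \<le> int p * int n"
    using index_bound(2)[OF p(1) j(1)] by auto
  have abs: "\<bar>a\<bar> \<le> M" "\<bar>e\<bar> \<le> M" "\<bar>a + e\<bar> \<le> M" "a + e \<le> M" using ae b by linarith+
  have pn: "int p \<le> M" "int j \<le> M" "int p * int n \<le> M" "int p * int n + int j \<le> M"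
    using p j M_ge n2 row_le_M[of p] by auto
  have "wp M gain_body (\<lambda>s'. s' aNB = (s aNB)(int j := (1 - x) * y) \<and>
      s' aGAIN = (s aGAIN)(int j := (if 0 < a + e then (1 - x) * y * (a + e) else 0))) s"
    using xy
    by (elim disjE) (use abs pn j(2) p(2) M_ge in \<open>simp_all add: gain_body_def g(1) xs[symmetric]\<close>)
  then show ?thesis unfolding nbxy gx by (rule reach_wp)
qed

lemma writes_gain_body: "writes gain_body = {aNB, vX, aGAIN}"
  by (auto simp: gain_body_def)

lemma dead_mem_agree: "dead_mem A s \<Longrightarrow> agree X s s' \<Longrightarrow> aDEAD \<notin> X \<Longrightarrow> dead_mem A s'"
  by (simp add: dead_mem_def agree_def)

lemma weights_mem_agree:
  "weights_mem c d s \<Longrightarrow> agree X s s' \<Longrightarrow> aC \<notin> X \<Longrightarrow> aD \<notin> X \<Longrightarrow> weights_mem c d s'"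
  by (simp add: weights_mem_def agree_def)

lemma weights_le_agree:
  "weights_le b s \<Longrightarrow> agree X s s' \<Longrightarrow> aC \<notin> X \<Longrightarrow> aD \<notin> X \<Longrightarrow> weights_le b s'"
  by (simp add: weights_le_def agree_def)

lemma gain_loop_correct:
  assumes s: "graph_mem s0" "dead_mem A s0" "weights_mem c d s0" "weights_le b s0"
    and p: "p < n" "s0 vPICK 0 = int p" and b: "2 * b \<le> M" and m: "n \<le> m"
  shows "\<exists>s'. reach M m (For vJ (Var vN) gain_body) s0 s' \<and>
     (\<forall>j<n. s' aNB (int j) = nb A p j \<and> s' aGAIN (int j) = gain E A c d p j)"
proof -
  define I where "I k s \<longleftrightarrow> agree {vJ, aNB, vX, aGAIN} s0 s \<and>
     (\<forall>j<k. s aNB (int j) = nb A p j \<and> s aGAIN (int j) = gain E A c d p j)" for k s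
  have Imem: "graph_mem t" "dead_mem A t" "weights_mem c d t" "weights_le b t" "t vPICK 0 = int p"
    if "I k t" for k t
  proof -
    have ag: "agree {vJ, aNB, vX, aGAIN} s0 t" using that by (simp add: I_def)
    show "graph_mem t" "dead_mem A t" "weights_mem c d t" "weights_le b t"
      by (rule graph_mem_agree[OF s(1) ag] dead_mem_agree[OF s(2) ag]
          weights_mem_agree[OF s(3) ag] weights_le_agree[OF s(4) ag]; simp)+
    show "t vPICK 0 = int p" using agreeD[OF ag, of vPICK] p by simp
  qed
  have "\<exists>s'. reach M m (For vJ (Var vN) gain_body) s0 s' \<and> I n s'"
  proof (rule reach_For)
    show "I 0 s0" by (simp add: I_def agree_refl)
    show "vJ \<notin> writes gain_body" by (simp add: writes_gain_body)
    show "I k (s(vJ := f))" if "I k s" for k s f using that by (simp add: I_def agree_upd)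
    show "asafe M (Var vN) t \<and> aval (Var vN) t = int n" if "I k t" for k t
      using graph_memD(1)[OF Imem(1)[OF that]] M_ge by auto
    show "int n + 1 \<le> M" using M_ge by linarith
    show "n \<le> m" by (rule m)
  next
    fix k t assume k: "k < n" and It: "I k t" and tk: "t vJ 0 = int k"
    obtain t' where t': "reach M m gain_body t t'" "t' aNB = (t aNB)(int k := nb A p k)"
        "t' aGAIN = (t aGAIN)(int k := gain E A c d p k)"
      using gain_body_correct[OF Imem(1-4)[OF It] k tk p(1) Imem(5)[OF It] b] by blast
    have "agree {aNB, vX, aGAIN} t t'" using reach_agree[OF t'(1)] by (simp add: writes_gain_body)
    then have "agree {vJ, aNB, vX, aGAIN} s0 t'" using It by (auto simp: I_def intro: agree_trans)
    then have "I (Suc k) t'" using It t'(2,3) by (auto simp: I_def less_Suc_eq)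
    with t'(1) show "\<exists>t'. reach M m gain_body t t' \<and> I (Suc k) t'" by blast
  qed
  then show ?thesis unfolding I_def by blast
qed

lemma credit_loop_correct:
  assumes s: "s0 vN 0 = int n" and b: "\<forall>j<n. \<bar>s0 aC (int j)\<bar> \<le> b \<and> \<bar>s0 aGAIN (int j)\<bar> \<le> b'"
    "b + b' \<le> M" and m: "n \<le> m"
  shows "\<exists>s'. reach M m (For vJ (Var vN) credit_body) s0 s' \<and>
     (\<forall>j<n. s' aC (int j) = s0 aC (int j) + s0 aGAIN (int j))"
proof -
  define I where "I k s \<longleftrightarrow> agree {vJ, aC} s0 s \<and>
     (\<forall>j<n. s aC (int j) = (if j < k then s0 aC (int j) + s0 aGAIN (int j) else s0 aC (int j)))" for k s
  have "\<exists>s'. reach M m (For vJ (Var vN) credit_body) s0 s' \<and> I n s'"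
  proof (rule reach_For)
    show "I 0 s0" by (simp add: I_def agree_refl)
    show "vJ \<notin> writes credit_body" by (simp add: credit_body_def)
    show "I k (s(vJ := f))" if "I k s" for k s f using that by (simp add: I_def agree_upd)
    show "asafe M (Var vN) t \<and> aval (Var vN) t = int n" if "I k t" for k t
      using that s M_ge by (auto simp: I_def agree_def)
    show "int n + 1 \<le> M" using M_ge by linarith
    show "n \<le> m" by (rule m)
  next
    fix k t assume k: "k < n" and It: "I k t" and tk: "t vJ 0 = int k"
    have v: "t aC (int k) = s0 aC (int k)" "t aGAIN = s0 aGAIN"
      using It k by (auto simp: I_def agree_def)
    have ab: "\<bar>s0 aC (int k)\<bar> \<le> b" "\<bar>s0 aGAIN (int k)\<bar> \<le> b'" using b(1) k by auto
    have "\<bar>s0 aC (int k)\<bar> \<le> M" "\<bar>s0 aGAIN (int k)\<bar> \<le> M" "\<bar>s0 aC (int k) + s0 aGAIN (int k)\<bar> \<le> M"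
      using b(2) ab by linarith+
    then have "wp M credit_body (I (Suc k)) t"
      using It k tk M_ge v by (auto simp: credit_body_def I_def agree_upd less_Suc_eq)
    then show "\<exists>t'. reach M m credit_body t t' \<and> I (Suc k) t'" by (rule reach_wp)
  qed
  then show ?thesis unfolding I_def by auto
qed

definition debit :: "state \<Rightarrow> nat \<Rightarrow> int" where
  "debit s k = s aNB (int (k div n)) * s aNB (int (k mod n)) *
     (s aGAIN (int (k div n)) + s aGAIN (int (k mod n)))"

lemma debit_loop_correct:
  assumes s: "s0 vN 0 = int n"
    and b: "\<forall>j<n. (s0 aNB (int j) = 0 \<or> s0 aNB (int j) = 1) \<and> \<bar>s0 aGAIN (int j)\<bar> \<le> b'"
    "\<forall>k<n*n. \<bar>s0 aD (int k)\<bar> \<le> b" "b + 2 * b' \<le> M" and m: "n * n \<le> m"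
  shows "\<exists>s'. reach M m (For vK (Var vN \<otimes> Var vN) debit_body) s0 s' \<and>
     (\<forall>k<n*n. s' aD (int k) = s0 aD (int k) - debit s0 k)"
proof -
  define I where "I k s \<longleftrightarrow> agree {vK, vU, vW, aD} s0 s \<and>
     (\<forall>j<n*n. s aD (int j) = (if j < k then s0 aD (int j) - debit s0 j else s0 aD (int j)))" for k s
  have "\<exists>s'. reach M m (For vK (Var vN \<otimes> Var vN) debit_body) s0 s' \<and> I (n * n) s'"
  proof (rule reach_For)
    show "I 0 s0" by (simp add: I_def agree_refl)
    show "vK \<notin> writes debit_body" by (simp add: debit_body_def)
    show "I k (s(vK := f))" if "I k s" for k s f using that by (simp add: I_def agree_upd)
    show "asafe M (Var vN \<otimes> Var vN) t \<and> aval (Var vN \<otimes> Var vN) t = int (n * n)" if "I k t" for k t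
      using that s M_ge by (auto simp: I_def agree_def abs_mult)
    show "int (n * n) + 1 \<le> M" using M_ge by simp
    show "n * n \<le> m" by (rule m)
  next
    fix k t assume k: "k < n * n" and It: "I k t" and tk: "t vK 0 = int k"
    note i = index_split[OF k]
    let ?u = "k div n" and ?w = "k mod n"
    define x y g h e where "x = s0 aNB (int ?u)" and "y = s0 aNB (int ?w)" and "g = s0 aGAIN (int ?u)"
      and "h = s0 aGAIN (int ?w)" and "e = s0 aD (int k)"
    note xs = this
    have v: "t aNB = s0 aNB" "t aGAIN = s0 aGAIN" "t vN 0 = int n" "t aD (int k) = s0 aD (int k)"
      using It k s by (auto simp: I_def agree_def)
    have xy: "x = 0 \<or> x = 1" "y = 0 \<or> y = 1" unfolding xs using b(1) i by auto
    have gh: "\<bar>g\<bar> \<le> b'" "\<bar>h\<bar> \<le> b'" "\<bar>e\<bar> \<le> b" unfolding xs using b(1,2) i k by auto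
    have abs: "\<bar>g\<bar> \<le> M" "\<bar>h\<bar> \<le> M" "\<bar>e\<bar> \<le> M" "\<bar>g + h\<bar> \<le> M" "\<bar>e - (g + h)\<bar> \<le> M" "\<bar>e - g - h\<bar> \<le> M"
      using gh b(3) by linarith+
    have kb: "int k \<le> M" "int ?u \<le> M" "int ?w \<le> M" "int ?u * int n \<le> M"
      using M_ge i k row_le_M[of ?u] by (auto simp flip: of_nat_mult)
    define t' where "t' = t(vU := (t vU)(0 := int ?u), vW := (t vW)(0 := int ?w),
      aD := (t aD)(int k := e - x * y * (g + h)))"
    have "wp M debit_body (\<lambda>s. s = t') t"
      using xy unfolding t'_def
      by (elim disjE) (use abs kb tk M_ge v in \<open>simp_all add: debit_body_def i(3,4) xs[symmetric]
        del: of_nat_div of_nat_mod\<close>)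
    from reach_wp[OF this] have "reach M m debit_body t t'" by blast
    moreover have "I (Suc k) t'"
      using It k unfolding I_def t'_def by (auto simp: agree_def less_Suc_eq debit_def xs)
    ultimately show "\<exists>t'. reach M m debit_body t t' \<and> I (Suc k) t'" by blast
  qed
  then show ?thesis unfolding I_def by auto
qed

lemma writes_credit_body: "writes credit_body = {aC}"
  and writes_debit_body: "writes debit_body = {vU, vW, aD}"
  by (auto simp: credit_body_def debit_body_def)

lemma writes_eliminate_body:
  "writes eliminate_body = {vJ, vK, aC, aD, aDEAD, aORD, vPICK, vOK, aNB, aGAIN, vU, vW, vX}"
  by (auto simp: eliminate_body_def writes_find_simplicial writes_gain_body writes_credit_body
      writes_debit_body)

lemma gain_le:
  assumes "weights_mem c d s" "weights_le b s" "A \<subseteq> {..<n}" "p < n" "0 \<le> b"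
  shows "\<bar>gain E A c d p j\<bar> \<le> 2 * b"
proof (cases "j \<in> A \<and> {p, j} \<in> E")
  case True
  then have j: "j < n" using assms(3) by auto
  have "c p = s aC (int p)" "d {p, j} = s aD (int p * int n + int j)"
    using assms(1,4) j True by (auto simp: weights_mem_def)
  moreover have "\<bar>s aC (int p)\<bar> \<le> b" "\<bar>s aD (int p * int n + int j)\<bar> \<le> b"
    using assms(2,4) weights_le_row[OF assms(2,4) j] by (auto simp: weights_le_def)
  ultimately show ?thesis using assms(5) by (auto simp: gain_def)
qed (use assms(5) in \<open>auto simp: gain_def\<close>)

text \<open>Origin of the factor five: a gain is at most \<open>2 * b\<close>, so a vertex weight
  rises to at most \<open>3 * b\<close>, while an edge weight may lose two gains and reach
  \<open>5 * b\<close> in absolute value.\<close>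

lemma eliminate_body_correct:
  assumes s: "graph_mem s" "dead_mem A s" "weights_mem c d s" "weights_le b s"
    and i: "i < n" "s vI 0 = int i" and A: "A \<subseteq> {..<n}" and ex: "\<exists>v. simplicial E A v"
    and b: "5 * b \<le> M" "0 \<le> b" and m: "n * n \<le> m"
  shows "\<exists>s' p. reach M m eliminate_body s s' \<and> simplicial E A p \<and> dead_mem (A - {p}) s' \<and>
     weights_mem (c_step E (A - {p}) p c d) (d_step E (A - {p}) p c d) s' \<and>
     weights_le (5 * b) s' \<and> s' aORD = (s aORD)(int i := int p)"
proof -
  have nm: "n \<le> m" using m by (cases n) auto
  obtain s1 p where s1: "reach M m find_simplicial s s1" "s1 vPICK 0 = int p" and p: "simplicial E A p"
    using find_simplicial_correct[OF s(1,2) A ex m] by blast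
  have pn: "p < n" using p A by (auto simp: simplicial_def)
  have ag1: "agree {vJ, vK, vPICK, vOK, vU, vW} s s1"
    using reach_agree[OF s1(1)] by (simp add: writes_find_simplicial)
  let ?B = "A - {p}"
  let ?p2 = "Write aDEAD (Var vPICK) (Const 1) ;; Write aORD (Var vI) (Var vPICK)"
  define s2 where "s2 = s1(aDEAD := (s1 aDEAD)(int p := 1), aORD := (s1 aORD)(int i := int p))"
  have "s1 vI 0 = int i" using ag1 i by (simp add: agree_def)
  then have "wp M ?p2 (\<lambda>t. t = s2) s1" using s1(2) pn i M_ge by (simp add: s2_def)
  from reach_wp[OF this] have r2: "reach M m ?p2 s1 s2" by blast
  have ag2: "agree {vJ, vK, vPICK, vOK, vU, vW, aDEAD, aORD} s s2"
    using ag1 by (simp add: agree_def s2_def)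
  have m2: "graph_mem s2" "weights_mem c d s2" "weights_le b s2"
    by (rule graph_mem_agree[OF s(1) ag2] weights_mem_agree[OF s(3) ag2]
        weights_le_agree[OF s(4) ag2]; simp)+
  have d2: "dead_mem ?B s2"
    using s(2) ag1 by (simp add: dead_mem_def s2_def agree_def)
  have p2: "s2 vPICK 0 = int p" using s1(2) by (simp add: s2_def)
  let ?g = "gain E ?B c d p"
  obtain s3 where s3: "reach M m (For vJ (Var vN) gain_body) s2 s3"
    "\<forall>j<n. s3 aNB (int j) = nb ?B p j \<and> s3 aGAIN (int j) = ?g j"
    using gain_loop_correct[OF m2(1) d2 m2(2,3) pn p2 _ nm] b by auto
  have ag3: "agree {vJ, aNB, vX, aGAIN} s2 s3"
    using reach_agree[OF s3(1)] by (simp add: writes_gain_body)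
  have m3: "graph_mem s3" "weights_mem c d s3" "weights_le b s3"
    by (rule graph_mem_agree[OF m2(1) ag3] weights_mem_agree[OF m2(2) ag3]
        weights_le_agree[OF m2(3) ag3]; simp)+
  have gle: "\<bar>?g j\<bar> \<le> 2 * b" for j
    using gain_le[OF s(3,4) _ pn b(2), of ?B j] A by blast
  have "\<forall>j<n. \<bar>s3 aC (int j)\<bar> \<le> b \<and> \<bar>s3 aGAIN (int j)\<bar> \<le> 2 * b"
    using m3(3) s3(2) gle by (simp add: weights_le_def)
  then obtain s4 where s4: "reach M m (For vJ (Var vN) credit_body) s3 s4"
    "\<forall>j<n. s4 aC (int j) = s3 aC (int j) + s3 aGAIN (int j)"
    using credit_loop_correct[of s3 b "2 * b" m] graph_memD(1)[OF m3(1)] b nm by auto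
  have ag4: "agree {vJ, aC} s3 s4"
    using reach_agree[OF s4(1)] by (simp add: writes_credit_body)
  have e4: "s4 aNB = s3 aNB" "s4 aGAIN = s3 aGAIN" "s4 aD = s3 aD" "s4 vN = s3 vN"
    using ag4 by (auto simp: agree_def)
  have nb01: "nb ?B p j = 0 \<or> nb ?B p j = 1" for j by (simp add: nb_def)
  have "\<forall>j<n. (s4 aNB (int j) = 0 \<or> s4 aNB (int j) = 1) \<and> \<bar>s4 aGAIN (int j)\<bar> \<le> 2 * b"
    using s3(2) gle nb01 by (simp add: e4)
  moreover have "\<forall>k<n*n. \<bar>s4 aD (int k)\<bar> \<le> b" using m3(3) by (simp add: e4 weights_le_def)
  ultimately obtain s5 where s5: "reach M m (For vK (Var vN \<otimes> Var vN) debit_body) s4 s5"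
    "\<forall>k<n*n. s5 aD (int k) = s4 aD (int k) - debit s4 k"
    using debit_loop_correct[of s4 "2 * b" b m] graph_memD(1)[OF m3(1)] b m by (auto simp: e4)
  have ag5: "agree {vK, vU, vW, aD} s4 s5"
    using reach_agree[OF s5(1)] by (simp add: writes_debit_body insert_commute)
  have r: "reach M m eliminate_body s s5"
    unfolding eliminate_body_def
    by (intro reach_Seq[OF s1(1)] reach_Seq[OF r2] reach_Seq[OF s3(1)] reach_Seq[OF s4(1)] s5(1))
  have deb: "debit s4 k = nb ?B p (k div n) * nb ?B p (k mod n) * (?g (k div n) + ?g (k mod n))"
    if "k < n * n" for k
    using s3(2) index_split(1,2)[OF that] by (simp add: debit_def e4)
  have "dead_mem ?B s5" using d2 ag3 ag4 ag5 by (simp add: dead_mem_def agree_def)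
  moreover have "s5 aORD = (s aORD)(int i := int p)"
    using ag1 ag3 ag4 ag5 by (simp add: agree_def s2_def)
  moreover have "weights_mem (c_step E ?B p c d) (d_step E ?B p c d) s5"
    unfolding weights_mem_def
  proof (intro conjI allI impI)
    fix v assume "v < n"
    then show "s5 aC (int v) = c_step E ?B p c d v"
      using ag5 s4(2) s3(2) m3(2) by (simp add: agree_def c_step_def weights_mem_def)
  next
    fix u w assume uw: "u < n" "w < n" "{u, w} \<in> E"
    \<comment> \<open>Distinct ends make the sum over \<open>{u, w}\<close> in \<open>d_step\<close>
      a sum of two gains.\<close>
    then have ne: "u \<noteq> w" using looplessD[OF ll] by blast
    have k: "u * n + w < n * n" "(u * n + w) div n = u" "(u * n + w) mod n = w"
      using index_bound(1)[OF uw(1,2)] uw by auto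
    have "s5 aD (int (u * n + w)) = s3 aD (int u * int n + int w) - nb ?B p u * nb ?B p w * (?g u + ?g w)"
      using s5(2)[rule_format, OF k(1)] deb[OF k(1)] k(2,3) by (simp add: e4)
    also have "s3 aD (int u * int n + int w) = d {u, w}" using m3(2) uw by (simp add: weights_mem_def)
    also have "d {u, w} - nb ?B p u * nb ?B p w * (?g u + ?g w) = d_step E ?B p c d {u, w}"
      using ne by (auto simp: d_step_def nb_def)
    finally show "s5 aD (int u * int n + int w) = d_step E ?B p c d {u, w}" by simp
  qed
  moreover have "weights_le (5 * b) s5"
    unfolding weights_le_def
  proof (intro conjI allI impI)
    fix v assume v: "v < n"
    have "s5 aC (int v) = s3 aC (int v) + ?g v"
      using ag5 s4(2) s3(2) v by (simp add: agree_def)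
    moreover have "\<bar>s3 aC (int v)\<bar> \<le> b" using m3(3) v by (simp add: weights_le_def)
    ultimately show "\<bar>s5 aC (int v)\<bar> \<le> 5 * b" using gle[of v] b(2) by linarith
  next
    fix k assume k: "k < n * n"
    have "s5 aD (int k) = s3 aD (int k) - debit s4 k" using s5(2) k by (simp add: e4)
    moreover have "\<bar>s3 aD (int k)\<bar> \<le> b" using m3(3) k by (simp add: weights_le_def)
    moreover have "\<bar>debit s4 k\<bar> \<le> 4 * b"
    proof -
      let ?u = "k div n" and ?w = "k mod n"
      have "debit s4 k = 0 \<or> debit s4 k = ?g ?u + ?g ?w"
        using deb[OF k] nb01[of ?u] nb01[of ?w] by auto
      then show ?thesis using gle[of ?u] gle[of ?w] b(2) by linarith
    qed
    ultimately show "\<bar>s5 aD (int k)\<bar> \<le> 5 * b" by linarith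
  qed
  ultimately show ?thesis using r p by blast
qed

section \<open>The elimination loop\<close>

definition order_mem :: "nat list \<Rightarrow> state \<Rightarrow> bool" where
  "order_mem vs s \<longleftrightarrow> (\<forall>i<length vs. s aORD (int i) = int (vs ! i))"

text \<open>The invariant hides the order found so far behind an existential quantifier and lets the
  weight bound grow by a factor 5 per round, so that \<open>5 ^ n * b\<close> within
  \<open>M\<close> suffices for all rounds.\<close>

lemma eliminate_loop_correct:
  assumes s0: "graph_mem s0" "dead_mem {..<n} s0" "weights_mem c d s0" "weights_le b s0"
    and ch: "chordal E" and b: "5 ^ n * b \<le> M" "0 \<le> b" and m: "n * n \<le> m"
  shows "\<exists>s' vs cF dF. reach M m (For vI (Var vN) eliminate_body) s0 s' \<and>
     elim_order E {..<n} vs \<and> set vs = {..<n} \<and> length vs = n \<and>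
     order_mem vs s' \<and> eliminate E {..<n} vs (c, d) = (cF, dF) \<and> weights_mem cF dF s' \<and>
     weights_le (5 ^ n * b) s'"
proof -
  have nm: "n \<le> m" using m by (cases n) auto
  define X where "X = {vI, vJ, vK, aC, aD, aDEAD, aORD, vPICK, vOK, aNB, aGAIN, vU, vW, vX}"
  define I where "I k s \<longleftrightarrow> agree X s0 s \<and> (\<exists>vs. length vs = k \<and>
     elim_order E {..<n} vs \<and> order_mem vs s \<and> dead_mem ({..<n} - set vs) s \<and>
     weights_mem (fst (eliminate E {..<n} vs (c, d))) (snd (eliminate E {..<n} vs (c, d))) s \<and>
     weights_le (5 ^ k * b) s)" for k s
  have Ig: "graph_mem t" if "I k t" for k t
    by (rule graph_mem_agree[OF s0(1), of X]) (use that in \<open>auto simp: I_def X_def\<close>)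
  have "\<exists>s'. reach M m (For vI (Var vN) eliminate_body) s0 s' \<and> I n s'"
  proof (rule reach_For)
    show "I 0 s0" using s0 by (auto simp: I_def agree_refl order_mem_def)
    show "vI \<notin> writes eliminate_body" by (simp add: writes_eliminate_body)
    show "I k (s(vI := f))" if "I k s" for k s f
      using that by (simp add: I_def X_def agree_upd order_mem_def dead_mem_def weights_mem_def weights_le_def)
    show "asafe M (Var vN) t \<and> aval (Var vN) t = int n" if "I k t" for k t
      using graph_memD(1)[OF Ig[OF that]] M_ge by auto
    show "int n + 1 \<le> M" using M_ge by linarith
    show "n \<le> m" by (rule nm)
  next
    fix k t assume k: "k < n" and It: "I k t" and tk: "t vI 0 = int k"
    then obtain vs where vs: "length vs = k" "elim_order E {..<n} vs" "order_mem vs t"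
      "dead_mem ({..<n} - set vs) t"
      "weights_mem (fst (eliminate E {..<n} vs (c, d))) (snd (eliminate E {..<n} vs (c, d))) t"
      "weights_le (5 ^ k * b) t" and ag: "agree X s0 t"
      by (auto simp: I_def)
    let ?A = "{..<n} - set vs"
    \<comment> \<open>Fewer than \<open>n\<close> vertices have been eliminated, so one is left and
      Dirac's theorem provides a simplicial one.\<close>
    have "card (set vs) < n" using vs(1) k card_length[of vs] by linarith
    then have "?A \<noteq> {}" using card_mono[of "set vs" "{..<n}"] by auto
    then have ex: "\<exists>v. simplicial E ?A v" by (intro chordal_simplicial[OF ch ll]) auto
    have "(5::int) ^ Suc k * b \<le> 5 ^ n * b" using k b(2) by (intro mult_right_mono power_increasing) auto
    then have bk: "5 * (5 ^ k * b) \<le> M" "0 \<le> 5 ^ k * b" using b by auto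
    obtain t' p where t': "reach M m eliminate_body t t'" "simplicial E ?A p" "dead_mem (?A - {p}) t'"
      "weights_mem (c_step E (?A - {p}) p (fst (eliminate E {..<n} vs (c, d))) (snd (eliminate E {..<n} vs (c, d))))
         (d_step E (?A - {p}) p (fst (eliminate E {..<n} vs (c, d))) (snd (eliminate E {..<n} vs (c, d)))) t'"
      "weights_le (5 * (5 ^ k * b)) t'" "t' aORD = (t aORD)(int k := int p)"
      using eliminate_body_correct[OF Ig[OF It] vs(4-6) k tk _ ex bk m] by blast
    have "agree X s0 t'"
      using reach_agree[OF t'(1)] ag by (auto simp: X_def writes_eliminate_body intro: agree_trans)
    moreover have "elim_order E {..<n} (vs @ [p])"
      using vs(2) t'(2) by (simp add: elim_order_snoc)
    moreover have "order_mem (vs @ [p]) t'"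
      using vs(1,3) t'(6) by (auto simp: order_mem_def nth_append less_Suc_eq)
    moreover have "?A - {p} = {..<n} - set (vs @ [p])" by auto
    ultimately have "I (Suc k) t'" unfolding I_def
      using vs(1) t'(3-5) by (intro conjI exI[of _ "vs @ [p]"]) (auto simp: eliminate_snoc Let_def mult.assoc)
    with t'(1) show "\<exists>t'. reach M m eliminate_body t t' \<and> I (Suc k) t'" by blast
  qed
  then obtain s' vs where s': "reach M m (For vI (Var vN) eliminate_body) s0 s'"
    "length vs = n" "elim_order E {..<n} vs" "order_mem vs s'"
    "weights_mem (fst (eliminate E {..<n} vs (c, d))) (snd (eliminate E {..<n} vs (c, d))) s'"
    "weights_le (5 ^ n * b) s'" by (auto simp: I_def)
  \<comment> \<open>An elimination order has no repetitions, and \<open>n\<close> distinct vertices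
    below \<open>n\<close> are all of them.\<close>
  have "set vs = {..<n}"
    using elim_order_set[OF s'(3)] s'(2) by (intro card_subset_eq) (auto simp: distinct_card)
  then show ?thesis using s' by (metis prod.collapse)
qed

section \<open>Correctness of the solution phase\<close>

lemma writes_find_root: "writes find_root = {vJ, vROOT}"
  by (auto simp: find_root_def root_body_def)

text \<open>In the empty graph \<open>vROOT\<close> keeps the value 0, which is not a vertex; hence
  the implication in the conclusion.\<close>

lemma find_root_correct:
  assumes s: "s0 vN 0 = int n" and b: "\<forall>v<n. \<bar>s0 aC (int v)\<bar> \<le> M" and m: "n \<le> m"
  shows "\<exists>s' r. reach M m find_root s0 s' \<and> s' vROOT 0 = int r \<and> (0 < n \<longrightarrow> r < n) \<and>
    (\<forall>v<n. s0 aC (int v) \<le> s0 aC (int r))"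
proof -
  define s1 where "s1 = s0(vROOT := (s0 vROOT)(0 := 0))"
  have "wp M (vROOT ::= Const 0) (\<lambda>t. t = s1) s0" using M_ge by (simp add: s1_def)
  from reach_wp[OF this] have r1: "reach M m (vROOT ::= Const 0) s0 s1" by blast
  define I where "I k s \<longleftrightarrow> agree {vJ, vROOT} s0 s \<and>
    (\<exists>r. (0 < n \<longrightarrow> r < n) \<and> s vROOT 0 = int r \<and> (\<forall>v<k. s0 aC (int v) \<le> s0 aC (int r)))" for k s
  have "\<exists>s'. reach M m (For vJ (Var vN) root_body) s1 s' \<and> I n s'"
  proof (rule reach_For)
    show "I 0 s1" by (auto simp: I_def agree_def s1_def)
    show "vJ \<notin> writes root_body" by (simp add: root_body_def)
    show "I k (s(vJ := f))" if "I k s" for k s f using that by (simp add: I_def agree_upd)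
    show "asafe M (Var vN) t \<and> aval (Var vN) t = int n" if "I k t" for k t
      using that s M_ge by (auto simp: I_def agree_def)
    show "int n + 1 \<le> M" using M_ge by linarith
    show "n \<le> m" by (rule m)
  next
    fix k t assume k: "k < n" and It: "I k t" and tk: "t vJ 0 = int k"
    then obtain r where r: "r < n" "t vROOT 0 = int r" "\<forall>v<k. s0 aC (int v) \<le> s0 aC (int r)"
      and ag: "agree {vJ, vROOT} s0 t" by (auto simp: I_def)
    have tC: "t aC = s0 aC" using ag by (simp add: agree_def)
    define r' where "r' = (if s0 aC (int r) < s0 aC (int k) then k else r)"
    have "r' < n" "\<forall>v<Suc k. s0 aC (int v) \<le> s0 aC (int r')"
      using r k by (auto simp: r'_def less_Suc_eq intro: order_trans[OF _ less_imp_le])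
    moreover have "wp M root_body (\<lambda>t'. agree {vJ, vROOT} s0 t' \<and> t' vROOT 0 = int r') t"
      using r k tk tC b M_ge ag by (auto simp: root_body_def r'_def agree_def)
    ultimately have "wp M root_body (I (Suc k)) t"
      using r k tk tC b M_ge ag by (auto simp: root_body_def r'_def I_def agree_def)
    then show "\<exists>t'. reach M m root_body t t' \<and> I (Suc k) t'" by (rule reach_wp)
  qed
  then obtain s' where "reach M m (For vJ (Var vN) root_body) s1 s'" "I n s'" by blast
  then show ?thesis using reach_Seq[OF r1] unfolding find_root_def I_def by blast
qed

definition in_mem :: "nat set \<Rightarrow> state \<Rightarrow> bool" where
  "in_mem W s \<longleftrightarrow> (\<forall>v<n. s aIN (int v) = (if v \<in> W then 1 else 0))"

text \<open>There is a unique neighbour exactly if the count is 1, and then it is the last one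
  found. The bound \<open>u < n\<close> holds in all cases, so the address computed from
  \<open>vU\<close> is safe even when the count is not 1.\<close>

lemma count_loop_correct:
  assumes s: "graph_mem s0" "in_mem W s0" "s0 vPICK 0 = int p" "p < n" "s0 vOK 0 = 0" "s0 vU 0 = 0"
    and m: "n \<le> m"
  shows "\<exists>s' u. reach M m (For vJ (Var vN) count_body) s0 s' \<and> s' vU 0 = int u \<and> u < n \<and>
    \<bar>s' vOK 0\<bar> \<le> M \<and> (\<forall>z. {x\<in>W \<inter> {..<n}. {p, x} \<in> E} = {z} \<longleftrightarrow> s' vOK 0 = 1 \<and> z = u)"
proof -
  define S where "S k = {x\<in>W \<inter> {..<k}. {p, x} \<in> E}" for k
  define I where "I k s \<longleftrightarrow> agree {vJ, vOK, vU} s0 s \<and> s vOK 0 = int (card (S k)) \<and>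
    (\<exists>u<n. s vU 0 = int u \<and> (S k \<noteq> {} \<longrightarrow> u \<in> S k))" for k s
  have fin: "finite (S k)" for k by (simp add: S_def)
  have S_Suc: "S (Suc k) = (if k \<in> W \<and> {p, k} \<in> E then insert k (S k) else S k)" "k \<notin> S k" for k
    by (auto simp: S_def less_Suc_eq)
  have "\<exists>s'. reach M m (For vJ (Var vN) count_body) s0 s' \<and> I n s'"
  proof (rule reach_For)
    show "I 0 s0" using s(4-6) by (auto simp: I_def agree_refl S_def)
    show "vJ \<notin> writes count_body" by (simp add: count_body_def)
    show "I k (s(vJ := f))" if "I k s" for k s f using that by (simp add: I_def agree_upd)
    show "asafe M (Var vN) t \<and> aval (Var vN) t = int n" if "I k t" for k t
      using that graph_memD(1)[OF s(1)] M_ge by (auto simp: I_def agree_def)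
    show "int n + 1 \<le> M" using M_ge by linarith
    show "n \<le> m" by (rule m)
  next
    fix k t assume k: "k < n" and It: "I k t" and tk: "t vJ 0 = int k"
    then obtain u where u: "u < n" "t vU 0 = int u" "S k \<noteq> {} \<longrightarrow> u \<in> S k" and
      ag: "agree {vJ, vOK, vU} s0 t" and cnt: "t vOK 0 = int (card (S k))" by (auto simp: I_def)
    define x y where "x = t aIN (int k)" and "y = t aADJ (int p * int n + int k)"
    have x: "x = (if k \<in> W then 1 else 0)" using ag s(2) k by (simp add: x_def in_mem_def agree_def)
    have y: "y = (if {p, k} \<in> E then 1 else 0)"
      using ag graph_memD(2)[OF s(1,4) k] by (simp add: y_def agree_def)
    have xy: "(x = 0 \<or> x = 1)" "(y = 0 \<or> y = 1)" by (simp_all add: x y)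
    have tv: "t vN 0 = int n" "t vPICK 0 = int p"
      using ag graph_memD(1)[OF s(1)] s(3) by (auto simp: agree_def)
    have "card (S k) \<le> card {..<n}" using k by (intro card_mono) (auto simp: S_def)
    then have cb: "int (card (S k)) + 1 \<le> M" "int (card (S k)) \<le> M" using M_ge by auto
    have pn: "int p \<le> M" "int k \<le> M" "int p * int n \<le> M" "int p * int n + int k \<le> M"
      using s(4) k M_ge index_bound(2)[OF s(4) k] row_le_M[of p] by auto
    define t' where "t' = (if x + y = 2 then t(vOK := (t vOK)(0 := int (card (S k)) + 1),
      vU := (t vU)(0 := int k)) else t)"
    have "wp M count_body (\<lambda>s. s = t') t"
      using xy
      by (elim disjE) (use tv pn cb tk cnt M_ge in \<open>simp_all add: t'_def count_body_def
          x_def[symmetric] y_def[symmetric]\<close>)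
    from reach_wp[OF this] have r: "reach M m count_body t t'" by blast
    have "I (Suc k) t'"
    proof (cases "k \<in> W \<and> {p, k} \<in> E")
      case True
      then have "x + y = 2" by (simp add: x y)
      then show ?thesis using True ag k S_Suc fin by (auto simp: I_def t'_def agree_def)
    next
      case False
      then have "x + y \<noteq> 2" by (auto simp: x y)
      then show ?thesis using False It S_Suc by (auto simp: I_def t'_def)
    qed
    with r show "\<exists>t'. reach M m count_body t t' \<and> I (Suc k) t'" by blast
  qed
  then obtain s' u where s': "reach M m (For vJ (Var vN) count_body) s0 s'" "s' vOK 0 = int (card (S n))"
    "u < n" "s' vU 0 = int u" "S n \<noteq> {} \<longrightarrow> u \<in> S n" by (auto simp: I_def)
  have "S n = {z} \<longleftrightarrow> s' vOK 0 = 1 \<and> z = u" for z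
  proof
    assume "S n = {z}"
    then show "s' vOK 0 = 1 \<and> z = u" using s'(2,5) by auto
  next
    assume h: "s' vOK 0 = 1 \<and> z = u"
    then have "card (S n) = 1" using s'(2) by simp
    then obtain y where "S n = {y}" by (auto simp: card_1_singleton_iff)
    with s'(5) h show "S n = {z}" by auto
  qed
  moreover have "card (S n) \<le> card {..<n}" by (intro card_mono) (auto simp: S_def)
  then have "\<bar>s' vOK 0\<bar> \<le> M" using s'(2) M_ge by simp
  ultimately show ?thesis using s'(1,3,4) unfolding S_def by blast
qed

lemma writes_recover_body: "writes recover_body = {vJ, vPICK, vOK, vU, aIN}"
  by (auto simp: recover_body_def count_body_def)

text \<open>Used where the root is reached: \<open>recover\<close> then returns \<open>{r}\<close>,
  whereas the program adds a mark to the set it has, which must therefore be empty.\<close>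

lemma recover_notin: "r \<notin> set vs \<Longrightarrow> recover E' cF dF r vs = {}"
  by (induction vs) (auto simp: Let_def)

lemma recover_body_correct:
  assumes s: "graph_mem s" "in_mem (recover E c d r vs) s" "weights_mem c d s" "weights_le b s"
    and i: "s vI 0 = int i" "i < n" and p: "s aORD (int (n - 1 - i)) = int p" "p < n"
    and r: "s vROOT 0 = int r" "r < n" and vs: "set vs \<subseteq> {..<n}" "p \<notin> set vs"
    and b: "2 * b \<le> M" and m: "n \<le> m"
  shows "\<exists>s'. reach M m recover_body s s' \<and> in_mem (recover E c d r (p # vs)) s'"
proof -
  let ?W = "recover E c d r vs"
  let ?p1 = "vPICK ::= Read aORD (Var vN \<ominus> Const 1 \<ominus> Var vI) ;; vOK ::= Const 0 ;; vU ::= Const 0"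
  let ?p3 = "If (Eq (Var vPICK) (Var vROOT)) (Write aIN (Var vPICK) (Const 1))
       (If (And (Eq (Var vOK) (Const 1))
              (Less (Const 0) (Read aC (Var vPICK) \<oplus> Read aD (Var vPICK \<otimes> Var vN \<oplus> Var vU))))
         (Write aIN (Var vPICK) (Const 1)) Skip)"
  have n: "s vN 0 = int n" using graph_memD(1)[OF s(1)] .
  have ni: "int (n - 1 - i) = int n - 1 - int i" using i(2) by simp
  have p1: "s aORD (int n - 1 - int i) = int p" using p(1) unfolding ni .
  define s1 where "s1 = s(vPICK := (s vPICK)(0 := int p), vOK := (s vOK)(0 := 0), vU := (s vU)(0 := 0))"
  have "wp M ?p1 (\<lambda>t. t = s1) s"
    using n i p(2) M_ge by (simp add: s1_def p1)
  from reach_wp[OF this] have r1: "reach M m ?p1 s s1" by blast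
  have ag1: "agree {vPICK, vOK, vU} s s1" by (simp add: s1_def agree_def)
  have m1: "graph_mem s1" by (rule graph_mem_agree[OF s(1) ag1]) simp_all
  have in1: "in_mem ?W s1" using s(2) by (simp add: in_mem_def s1_def)
  obtain s2 u where s2: "reach M m (For vJ (Var vN) count_body) s1 s2" "s2 vU 0 = int u" "u < n"
    "\<bar>s2 vOK 0\<bar> \<le> M" "\<forall>z. {x\<in>?W \<inter> {..<n}. {p, x} \<in> E} = {z} \<longleftrightarrow> s2 vOK 0 = 1 \<and> z = u"
    using count_loop_correct[OF m1 in1 _ p(2) _ _ m] by (auto simp: s1_def)
  have ag2: "agree {vJ, vOK, vU} s1 s2"
    using reach_agree[OF s2(1)] by (simp add: count_body_def insert_commute)
  have ag: "agree {vJ, vPICK, vOK, vU} s s2" by (rule agree_trans[OF ag1 ag2]) auto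
  have Wn: "?W \<subseteq> {..<n}" using recover_subset[of E c d r vs] vs(1) by blast
  then have "?W \<inter> {..<n} = ?W" by blast
  then have ok: "{x\<in>?W. {p, x} \<in> E} = {z} \<longleftrightarrow> s2 vOK 0 = 1 \<and> z = u" for z using s2(5) by simp
  have v2: "s2 vPICK 0 = int p" "s2 vROOT 0 = int r" "s2 vN 0 = int n"
    using ag2 r(1) n by (auto simp: agree_def s1_def)
  have in2: "in_mem ?W s2" using s(2) ag by (simp add: in_mem_def agree_def)
  have w2: "weights_mem c d s2" "weights_le b s2"
    by (rule weights_mem_agree[OF s(3) ag] weights_le_agree[OF s(4) ag]; simp)+
  define a e where "a = s2 aC (int p)" and "e = s2 aD (int p * int n + int u)"
  have ac: "a = c p" using w2(1) p by (simp add: a_def weights_mem_def)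
  have ed: "e = d {p, u}" if "{p, u} \<in> E" using w2(1) p(2) s2(3) that by (simp add: e_def weights_mem_def)
  have "\<bar>a\<bar> \<le> b" "\<bar>e\<bar> \<le> b"
    using w2(2) p weights_le_row[OF w2(2) p(2) s2(3)] by (auto simp: a_def e_def weights_le_def)
  then have abs: "\<bar>a\<bar> \<le> M" "\<bar>e\<bar> \<le> M" "\<bar>a + e\<bar> \<le> M" using b by linarith+
  have ub: "int p \<le> M" "int u \<le> M" "int r \<le> M" "int p * int n \<le> M" "int p * int n + int u \<le> M"
    using p s2(3) r M_ge index_bound(2)[OF p(2) s2(3)] row_le_M[of p] by auto
  define Q where "Q \<longleftrightarrow> p = r \<or> s2 vOK 0 = 1 \<and> 0 < a + e"
  have "wp M ?p3 (\<lambda>t. t aIN = (if Q then (s2 aIN)(int p := 1) else s2 aIN)) s2"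
    using abs ub v2 s2(2,4) M_ge
    by (simp add: Q_def a_def[symmetric] e_def[symmetric])
  then obtain s3 where s3: "reach M m ?p3 s2 s3"
      "s3 aIN = (if Q then (s2 aIN)(int p := 1) else s2 aIN)" using reach_wp by blast
  have "in_mem (if Q then insert p ?W else ?W) s3"
    using in2 s3(2) by (auto simp: in_mem_def)
  moreover have "recover E c d r (p # vs) = (if Q then insert p ?W else ?W)"
  proof (cases "p = r")
    case True
    then show ?thesis using recover_notin[of r vs] vs(2) by (simp add: Q_def)
  next
    case False
    \<comment> \<open>A count of 1 makes \<open>u\<close> a neighbour of \<open>p\<close>, so
      \<open>e\<close> is an actual edge weight whenever the comparison decides.\<close>
    have "{p, u} \<in> E" if "s2 vOK 0 = 1" using ok[of u] that by blast
    then have "(\<exists>z. {x\<in>?W. {p, x} \<in> E} = {z} \<and> 0 < c p + d {p, z}) \<longleftrightarrow> Q"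
      unfolding ok Q_def using False ed ac by auto
    then show ?thesis using False by (simp add: Let_def)
  qed
  ultimately show ?thesis
    using reach_Seq[OF r1 reach_Seq[OF s2(1) s3(1)]] unfolding recover_body_def by auto
qed

lemma recover_loop_correct:
  assumes s: "graph_mem s0" "in_mem {} s0" "weights_mem c d s0" "weights_le b s0"
    and ord: "order_mem vs s0" "length vs = n" "set vs = {..<n}"
    and r: "s0 vROOT 0 = int r" "0 < n \<Longrightarrow> r < n"
    and b: "2 * b \<le> M" and m: "n \<le> m"
  shows "\<exists>s'. reach M m (For vI (Var vN) recover_body) s0 s' \<and> in_mem (recover E c d r vs) s'"
proof -
  define X where "X = {vI, vJ, vPICK, vOK, vU, aIN}"
  \<comment> \<open>After \<open>k\<close> rounds the last \<open>k\<close> eliminated vertices have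
    been treated; they form the suffix of \<open>vs\<close> from position
    \<open>n - k\<close>.\<close>
  define I where "I k s \<longleftrightarrow> agree X s0 s \<and> in_mem (recover E c d r (drop (n - k) vs)) s" for k s
  have Imem: "graph_mem t" "weights_mem c d t" "weights_le b t" "order_mem vs t" "t vROOT 0 = int r"
    if "I k t" for k t
  proof -
    have ag: "agree X s0 t" using that by (simp add: I_def)
    show "graph_mem t" by (rule graph_mem_agree[OF s(1) ag]) (simp_all add: X_def)
    show "weights_mem c d t" by (rule weights_mem_agree[OF s(3) ag]) (simp_all add: X_def)
    show "weights_le b t" by (rule weights_le_agree[OF s(4) ag]) (simp_all add: X_def)
    show "order_mem vs t" "t vROOT 0 = int r"
      using ord(1) r(1) ag by (auto simp: order_mem_def agree_def X_def)
  qed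
  have "\<exists>s'. reach M m (For vI (Var vN) recover_body) s0 s' \<and> I n s'"
  proof (rule reach_For)
    show "I 0 s0" using s(2) ord(2) by (simp add: I_def agree_refl)
    show "vI \<notin> writes recover_body" by (simp add: writes_recover_body)
    show "I k (s(vI := f))" if "I k s" for k s f
      using that by (simp add: I_def X_def agree_upd in_mem_def)
    show "asafe M (Var vN) t \<and> aval (Var vN) t = int n" if "I k t" for k t
      using graph_memD(1)[OF Imem(1)[OF that]] M_ge by auto
    show "int n + 1 \<le> M" using M_ge by linarith
    show "n \<le> m" by (rule m)
  next
    fix k t assume k: "k < n" and It: "I k t" and tk: "t vI 0 = int k"
    have rn: "r < n" using r(2) k by simp
    let ?vs = "drop (n - k) vs" and ?p = "vs ! (n - 1 - k)"
    have dist: "distinct vs" using ord(2,3) by (simp add: card_distinct)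
    have ds: "drop (n - Suc k) vs = ?p # ?vs"
      using k ord(2) Cons_nth_drop_Suc[of "n - 1 - k" vs] by (simp add: Suc_diff_Suc)
    have "?p \<in> set vs" using k ord(2) by simp
    then have p: "?p < n" using ord(3) by blast
    have "?p \<notin> set ?vs" using distinct_drop[OF dist, of "n - Suc k"] unfolding ds by simp
    moreover have "set ?vs \<subseteq> {..<n}" using set_drop_subset[of "n - k" vs] ord(3) by simp
    moreover have "n - 1 - k < length vs" using k ord(2) by simp
    then have "t aORD (int (n - 1 - k)) = int ?p"
      using Imem(4)[OF It] unfolding order_mem_def by blast
    moreover have "in_mem (recover E c d r ?vs) t" using It by (simp add: I_def)
    ultimately obtain t' where t': "reach M m recover_body t t'"
      "in_mem (recover E c d r (?p # ?vs)) t'"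
      using recover_body_correct[OF Imem(1)[OF It] _ Imem(2,3)[OF It] tk k _ p Imem(5)[OF It] rn _ _ b m]
      by blast
    have "agree X s0 t'"
      using reach_agree[OF t'(1)] It by (auto simp: X_def I_def writes_recover_body intro: agree_trans)
    then have "I (Suc k) t'" using t'(2) by (simp add: I_def ds)
    with t'(1) show "\<exists>t'. reach M m recover_body t t' \<and> I (Suc k) t'" by blast
  qed
  then show ?thesis by (auto simp: I_def)
qed

text \<open>The output overwrites the input in array 0; input left beyond the new length is ignored
  by \<open>output_is\<close>. Scanning the vertices in increasing order produces the sorted list
  that the encoding asks for.\<close>

lemma write_output_correct:
  assumes s: "s0 vN 0 = int n" "in_mem W s0" and W: "W \<subseteq> {..<n}" and m: "n \<le> m"
  shows "\<exists>s'. reach M m write_output s0 s' \<and> output_is s' (encode_vertex_set W)"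
proof -
  define s1 where "s1 = s0(vK := (s0 vK)(0 := 0))"
  have "wp M (vK ::= Const 0) (\<lambda>t. t = s1) s0" using M_ge by (simp add: s1_def)
  from reach_wp[OF this] have r1: "reach M m (vK ::= Const 0) s0 s1" by blast
  define ys where "ys k = filter (\<lambda>j. j \<in> W) [0..<k]" for k
  have ys_Suc: "ys (Suc k) = ys k @ (if k \<in> W then [k] else [])" for k by (simp add: ys_def)
  have len: "length (ys k) \<le> k" for k unfolding ys_def by (metis length_filter_le length_upt diff_zero)
  define I where "I k s \<longleftrightarrow> agree {0, vJ, vK} s0 s \<and> s vK 0 = int (length (ys k)) \<and>
    (\<forall>i<length (ys k). s 0 (int i) = int (ys k ! i))" for k s
  have "\<exists>s'. reach M m (For vJ (Var vN) output_body) s1 s' \<and> I n s'"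
  proof (rule reach_For)
    show "I 0 s1" by (auto simp: I_def agree_def s1_def ys_def)
    show "vJ \<notin> writes output_body" by (simp add: output_body_def)
    show "I k (s(vJ := f))" if "I k s" for k s f using that by (simp add: I_def agree_upd)
    show "asafe M (Var vN) t \<and> aval (Var vN) t = int n" if "I k t" for k t
      using that s M_ge by (auto simp: I_def agree_def)
    show "int n + 1 \<le> M" using M_ge by linarith
    show "n \<le> m" by (rule m)
  next
    fix k t assume k: "k < n" and It: "I k t" and tk: "t vJ 0 = int k"
    have tin: "t aIN (int k) = (if k \<in> W then 1 else 0)"
      using It s(2) k by (simp add: I_def agree_def in_mem_def)
    have lk: "int (length (ys k)) + 1 \<le> M" using len[of k] k M_ge by linarith
    have "wp M output_body (I (Suc k)) t"
      using It tk tin lk k M_ge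
      by (auto simp: output_body_def I_def ys_Suc agree_upd nth_append less_Suc_eq)
    then show "\<exists>t'. reach M m output_body t t' \<and> I (Suc k) t'" by (rule reach_wp)
  qed
  then obtain s2 where s2: "reach M m (For vJ (Var vN) output_body) s1 s2" "I n s2" by blast
  have "finite W" using W finite_subset by blast
  moreover have "set (ys n) = W" using W by (auto simp: ys_def)
  moreover have "sorted (ys n)" "distinct (ys n)" by (simp_all add: ys_def sorted_wrt_filter)
  ultimately have ysW: "ys n = sorted_list_of_set W"
    by (metis sorted_list_of_set.idem_if_sorted_distinct)
  have "wp M (1 ::= Var vK) (\<lambda>s. output_is s (encode_vertex_set W)) s2"
    using s2(2) M_ge len[of n]
    by (auto simp: I_def output_is_def encode_vertex_set_def ysW[symmetric])
  from reach_wp[OF this] obtain s3 where "reach M m (1 ::= Var vK) s2 s3"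
    "output_is s3 (encode_vertex_set W)" by blast
  then show ?thesis
    using reach_Seq[OF r1 reach_Seq[OF s2(1)]] unfolding write_output_def by blast
qed

end

section \<open>Correctness of the input phase\<close>

lemma writes_load: "writes load = {vN, vDEN, vJ, vK, aC, aD, aADJ}"
  by (auto simp: load_def den_body_def scale_c_body_def scale_d_body_def)

text \<open>A scaled weight is a numerator times a quotient of the product of
  \<open>n + n * n\<close> denominators, all bounded by \<open>B\<close>; this explains the exponent
  \<open>n + n * n + 1\<close>. The bound \<open>M3\<close> covers the addresses of the input
  cells.\<close>

locale ram_input = ram_graph +
  fixes cn cd dn dd :: "nat \<Rightarrow> int" and B :: int
  assumes c_le: "\<And>v. v < n \<Longrightarrow> \<bar>cn v\<bar> \<le> B \<and> 1 \<le> cd v \<and> cd v \<le> B"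
    and d_le: "\<And>k. k < n * n \<Longrightarrow> \<bar>dn k\<bar> \<le> B \<and> 1 \<le> dd k \<and> dd k \<le> B"
    and B: "1 \<le> B" "B ^ (n + n * n + 1) \<le> M"
    and M3: "3 * (int n * int n) + 2 * int n + 8 \<le> M"
begin

definition input_mem :: "state \<Rightarrow> bool" where
  "input_mem s \<longleftrightarrow> s 0 0 = int n \<and>
     (\<forall>v<n. s 0 (2 * int v + 1) = cn v \<and> s 0 (2 * int v + 2) = cd v) \<and>
     (\<forall>k<n*n. s 0 (2 * int n + 3 * int k + 1) = (if {k div n, k mod n} \<in> E then 1 else 0) \<and>
        s 0 (2 * int n + 3 * int k + 2) = dn k \<and> s 0 (2 * int n + 3 * int k + 3) = dd k)"

definition c_den :: int where "c_den = (\<Prod>v<n. cd v)"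
definition d_den :: int where "d_den = (\<Prod>k<n*n. dd k)"
definition den :: int where "den = c_den * d_den"

lemma prod_bounds:
  fixes f :: "nat \<Rightarrow> int"
  assumes "\<And>k. k < l \<Longrightarrow> 1 \<le> f k \<and> f k \<le> B"
  shows "1 \<le> (\<Prod>k<l. f k)" "(\<Prod>k<l. f k) \<le> B ^ l"
  using assms
proof (induction l)
  case (Suc l)
  {
    case 1
    then show ?case using Suc.IH(1) mult_mono[of 1 "prod f {..<l}" 1 "f l"] by fastforce
  next
    case 2
    then show ?case using Suc.IH mult_mono[of "prod f {..<l}" "B ^ l" "f l" B] B(1) by (fastforce simp: mult.commute)
  }
qed simp_all

lemma den_bounds: "1 \<le> c_den" "c_den \<le> B ^ n" "1 \<le> d_den" "d_den \<le> B ^ (n * n)"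
  "1 \<le> den" "den \<le> B ^ (n + n * n)" "den \<le> M" "c_den \<le> M"
proof -
  show c: "1 \<le> c_den" "c_den \<le> B ^ n" and d: "1 \<le> d_den" "d_den \<le> B ^ (n * n)"
    unfolding c_den_def d_den_def using prod_bounds[of n cd] prod_bounds[of "n * n" dd] c_le d_le by auto
  show "1 \<le> den" unfolding den_def using mult_mono[of 1 c_den 1 d_den] c d by simp
  show e: "den \<le> B ^ (n + n * n)"
    unfolding den_def power_add using c d B by (intro mult_mono) auto
  have "B ^ (n + n * n) \<le> M"
    using power_increasing[of "n + n * n" "n + n * n + 1" B] B by linarith
  then show "den \<le> M" using e by simp
  have "B ^ n \<le> B ^ (n + n * n + 1)" using B by (intro power_increasing) auto
  then show "c_den \<le> M" using c B by linarith
qed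

lemma B_le_M: "B \<le> M"
proof -
  have "B \<le> B ^ (n + n * n + 1)" by (rule self_le_power) (use B in auto)
  then show ?thesis using B by linarith
qed

lemma scaled_le:
  assumes "\<bar>x\<bar> \<le> B" "1 \<le> y"
  shows "\<bar>x * (den div y)\<bar> \<le> B ^ (n + n * n + 1)" "0 \<le> den div y" "den div y \<le> M"
proof -
  have "den div y \<le> den div 1" using assms den_bounds by (intro zdiv_mono2) auto
  then have *: "den div y \<le> den" by simp
  show **: "0 \<le> den div y" using assms den_bounds by (simp add: pos_imp_zdiv_nonneg_iff)
  show "den div y \<le> M" using * den_bounds by simp
  have "\<bar>x * (den div y)\<bar> = \<bar>x\<bar> * (den div y)" using ** by (simp add: abs_mult)
  also have "\<dots> \<le> B * B ^ (n + n * n)"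
    using assms(1) * ** den_bounds(6) B by (intro mult_mono) auto
  finally show "\<bar>x * (den div y)\<bar> \<le> B ^ (n + n * n + 1)" by simp
qed

lemma entry_bounds:
  "v < n \<Longrightarrow> 2 * int v + 2 \<le> M" "k < n * n \<Longrightarrow> 2 * int n + 3 * int k + 3 \<le> M"
proof -
  show "v < n \<Longrightarrow> 2 * int v + 2 \<le> M" using M3 zero_le_square[of "int n"] by linarith
  assume "k < n * n"
  then have "int k + 1 \<le> int n * int n" by (simp flip: of_nat_mult)
  then show "2 * int n + 3 * int k + 3 \<le> M" using M3 by linarith
qed

lemma den_c_loop_correct:
  assumes s: "input_mem s0" "s0 vN 0 = int n" "s0 vDEN 0 = 1" and m: "n \<le> m"
  shows "\<exists>s'. reach M m (For vJ (Var vN) (den_body (Const 2 \<otimes> Var vJ \<oplus> Const 2))) s0 s' \<and>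
    s' vDEN 0 = c_den"
proof -
  define I where "I k s \<longleftrightarrow> agree {vJ, vDEN} s0 s \<and> s vDEN 0 = (\<Prod>v<k. cd v) \<and> k \<le> n" for k s
  have "\<exists>s'. reach M m (For vJ (Var vN) (den_body (Const 2 \<otimes> Var vJ \<oplus> Const 2))) s0 s' \<and> I n s'"
  proof (rule reach_For)
    show "I 0 s0" using s(3) by (simp add: I_def agree_refl)
    show "vJ \<notin> writes (den_body (Const 2 \<otimes> Var vJ \<oplus> Const 2))" by (simp add: den_body_def)
    show "I k (s(vJ := f))" if "I k s" for k s f using that by (simp add: I_def agree_upd)
    show "asafe M (Var vN) t \<and> aval (Var vN) t = int n" if "I k t" for k t
      using that s(2) M_ge by (auto simp: I_def agree_def)
    show "int n + 1 \<le> M" using M_ge by linarith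
    show "n \<le> m" by (rule m)
  next
    fix k t assume k: "k < n" and It: "I k t" and tk: "t vJ 0 = int k"
    have t0: "t 0 (2 * int k + 2) = cd k"
      using It s(1) k by (simp add: I_def agree_def input_mem_def)
    \<comment> \<open>The partial products have to be bounded both before and after the
      multiplication by \<open>cd k\<close>.\<close>
    have "(\<Prod>v<j. cd v) \<le> M \<and> 1 \<le> (\<Prod>v<j. cd v)" if "j \<le> n" for j
    proof -
      have "(\<Prod>v<j. cd v) \<le> B ^ j" "1 \<le> (\<Prod>v<j. cd v)"
        using that c_le by (intro prod_bounds; simp)+
      moreover have "B ^ j \<le> B ^ (n + n * n + 1)" using that B by (intro power_increasing) auto
      ultimately show ?thesis using B by linarith
    qed
    from this[of k] this[of "Suc k"] k
    have "(\<Prod>v<k. cd v) \<le> M" "1 \<le> (\<Prod>v<k. cd v)" "(\<Prod>v<k. cd v) * cd k \<le> M" "1 \<le> (\<Prod>v<k. cd v) * cd k"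
      by auto
    then have "wp M (den_body (Const 2 \<otimes> Var vJ \<oplus> Const 2)) (I (Suc k)) t"
      using It tk t0 k M_ge c_le[OF k] B_le_M entry_bounds(1)[OF k]
      by (simp add: den_body_def I_def agree_upd)
    then show "\<exists>t'. reach M m (den_body (Const 2 \<otimes> Var vJ \<oplus> Const 2)) t t' \<and> I (Suc k) t'"
      by (rule reach_wp)
  qed
  then show ?thesis by (auto simp: I_def c_den_def)
qed

lemma den_d_loop_correct:
  assumes s: "input_mem s0" "s0 vN 0 = int n" "s0 vDEN 0 = c_den" and m: "n * n \<le> m"
  shows "\<exists>s'. reach M m (For vK (Var vN \<otimes> Var vN) (den_body (entry 3))) s0 s' \<and> s' vDEN 0 = den"
proof -
  \<comment> \<open>In the product the outer \<open>k\<close> limits the range and the inner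
    \<open>k\<close> is the bound variable.\<close>
  define I where "I k s \<longleftrightarrow> agree {vK, vDEN} s0 s \<and> s vDEN 0 = c_den * (\<Prod>k<k. dd k)" for k s
  have "\<exists>s'. reach M m (For vK (Var vN \<otimes> Var vN) (den_body (entry 3))) s0 s' \<and> I (n * n) s'"
  proof (rule reach_For)
    show "I 0 s0" using s(3) by (simp add: I_def agree_refl)
    show "vK \<notin> writes (den_body (entry 3))" by (simp add: den_body_def)
    show "I k (s(vK := f))" if "I k s" for k s f using that by (simp add: I_def agree_upd)
    show "asafe M (Var vN \<otimes> Var vN) t \<and> aval (Var vN \<otimes> Var vN) t = int (n * n)" if "I k t" for k t
      using that s M_ge by (auto simp: I_def agree_def abs_mult)
    show "int (n * n) + 1 \<le> M" using M_ge by simp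
    show "n * n \<le> m" by (rule m)
  next
    fix k t assume k: "k < n * n" and It: "I k t" and tk: "t vK 0 = int k"
    have t0: "t 0 (2 * int n + 3 * int k + 3) = dd k" and tn: "t vN 0 = int n"
      using It s(1,2) k by (simp_all add: I_def agree_def input_mem_def)
    have "c_den * (\<Prod>k<j. dd k) \<le> M \<and> 1 \<le> c_den * (\<Prod>k<j. dd k)" if "j \<le> n * n" for j
    proof -
      have p: "(\<Prod>v<j. dd v) \<le> B ^ j" "1 \<le> (\<Prod>v<j. dd v)"
        using that d_le by (intro prod_bounds; simp)+
      have "c_den * (\<Prod>v<j. dd v) \<le> B ^ n * B ^ j" using p den_bounds B by (intro mult_mono) auto
      also have "\<dots> = B ^ (n + j)" by (simp add: power_add)
      also have "\<dots> \<le> B ^ (n + n * n + 1)" using that B by (intro power_increasing) auto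
      finally show ?thesis using B mult_mono[of 1 c_den 1 "\<Prod>v<j. dd v"] p den_bounds by simp
    qed
    from this[of k] this[of "Suc k"] k
    have "c_den * (\<Prod>v<k. dd v) \<le> M" "1 \<le> c_den * (\<Prod>v<k. dd v)"
      "c_den * (\<Prod>v<k. dd v) * dd k \<le> M" "1 \<le> c_den * (\<Prod>v<k. dd v) * dd k"
      by (auto simp: mult.assoc)
    then have "wp M (den_body (entry 3)) (I (Suc k)) t"
      using It tk t0 tn k M_ge d_le[OF k] B_le_M entry_bounds(2)[OF k]
      by (simp add: den_body_def I_def agree_upd)
    then show "\<exists>t'. reach M m (den_body (entry 3)) t t' \<and> I (Suc k) t'"
      by (rule reach_wp)
  qed
  then show ?thesis by (auto simp: I_def den_def d_den_def)
qed

lemma scale_c_loop_correct: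
  assumes s: "input_mem s0" "s0 vN 0 = int n" "s0 vDEN 0 = den" and m: "n \<le> m"
  shows "\<exists>s'. reach M m (For vJ (Var vN) scale_c_body) s0 s' \<and>
    (\<forall>v<n. s' aC (int v) = cn v * (den div cd v))"
proof -
  define I where "I k s \<longleftrightarrow> agree {vJ, aC} s0 s \<and> (\<forall>v<k. s aC (int v) = cn v * (den div cd v))" for k s
  have "\<exists>s'. reach M m (For vJ (Var vN) scale_c_body) s0 s' \<and> I n s'"
  proof (rule reach_For)
    show "I 0 s0" by (simp add: I_def agree_refl)
    show "vJ \<notin> writes scale_c_body" by (simp add: scale_c_body_def)
    show "I k (s(vJ := f))" if "I k s" for k s f using that by (simp add: I_def agree_upd)
    show "asafe M (Var vN) t \<and> aval (Var vN) t = int n" if "I k t" for k t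
      using that s(2) M_ge by (auto simp: I_def agree_def)
    show "int n + 1 \<le> M" using M_ge by linarith
    show "n \<le> m" by (rule m)
  next
    fix k t assume k: "k < n" and It: "I k t" and tk: "t vJ 0 = int k"
    have t0: "t 0 (2 * int k + 1) = cn k" "t 0 (2 * int k + 2) = cd k" "t vDEN 0 = den"
      using It s k by (simp_all add: I_def agree_def input_mem_def)
    have sc: "\<bar>cn k * (den div cd k)\<bar> \<le> M" "0 \<le> den div cd k" "den div cd k \<le> M"
      using scaled_le[of "cn k" "cd k"] c_le[OF k] B by auto
    have "wp M scale_c_body (I (Suc k)) t"
      using It tk t0 k M_ge c_le[OF k] B_le_M entry_bounds(1)[OF k] sc den_bounds
      by (auto simp add: scale_c_body_def I_def agree_upd less_Suc_eq)
    then show "\<exists>t'. reach M m scale_c_body t t' \<and> I (Suc k) t'" by (rule reach_wp)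
  qed
  then show ?thesis by (auto simp: I_def)
qed

lemma scale_d_loop_correct:
  assumes s: "input_mem s0" "s0 vN 0 = int n" "s0 vDEN 0 = den" and m: "n * n \<le> m"
  shows "\<exists>s'. reach M m (For vK (Var vN \<otimes> Var vN) scale_d_body) s0 s' \<and>
    (\<forall>k<n*n. s' aADJ (int k) = (if {k div n, k mod n} \<in> E then 1 else 0) \<and>
       s' aD (int k) = dn k * (den div dd k))"
proof -
  define I where "I k s \<longleftrightarrow> agree {vK, aADJ, aD} s0 s \<and>
    (\<forall>j<k. s aADJ (int j) = (if {j div n, j mod n} \<in> E then 1 else 0) \<and>
       s aD (int j) = dn j * (den div dd j))" for k s
  have "\<exists>s'. reach M m (For vK (Var vN \<otimes> Var vN) scale_d_body) s0 s' \<and> I (n * n) s'"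
  proof (rule reach_For)
    show "I 0 s0" by (simp add: I_def agree_refl)
    show "vK \<notin> writes scale_d_body" by (simp add: scale_d_body_def)
    show "I k (s(vK := f))" if "I k s" for k s f using that by (simp add: I_def agree_upd)
    show "asafe M (Var vN \<otimes> Var vN) t \<and> aval (Var vN \<otimes> Var vN) t = int (n * n)" if "I k t" for k t
      using that s M_ge by (auto simp: I_def agree_def abs_mult)
    show "int (n * n) + 1 \<le> M" using M_ge by simp
    show "n * n \<le> m" by (rule m)
  next
    fix k t assume k: "k < n * n" and It: "I k t" and tk: "t vK 0 = int k"
    define x where "x = (if {k div n, k mod n} \<in> E then 1 else 0 :: int)"
    have x: "\<bar>x\<bar> \<le> M" using M_ge by (simp add: x_def)
    have t0: "t 0 (2 * int n + 3 * int k + 1) = x" "t 0 (2 * int n + 3 * int k + 2) = dn k"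
      "t 0 (2 * int n + 3 * int k + 3) = dd k" "t vDEN 0 = den" "t vN 0 = int n"
      using It s k by (simp_all add: I_def agree_def input_mem_def x_def)
    have sc: "\<bar>dn k * (den div dd k)\<bar> \<le> M" "0 \<le> den div dd k" "den div dd k \<le> M"
      using scaled_le[of "dn k" "dd k"] d_le[OF k] B by auto
    define t' where "t' = t(aADJ := (t aADJ)(int k := x), aD := (t aD)(int k := dn k * (den div dd k)))"
    have "wp M scale_d_body (\<lambda>s. s = t') t"
      using tk t0 M_ge d_le[OF k] B_le_M entry_bounds(2)[OF k] sc den_bounds x
      by (simp add: scale_d_body_def t'_def)
    from reach_wp[OF this] have "reach M m scale_d_body t t'" by blast
    moreover have "I (Suc k) t'"
      using It by (auto simp: I_def t'_def agree_def less_Suc_eq x_def)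
    ultimately show "\<exists>t'. reach M m scale_d_body t t' \<and> I (Suc k) t'" by blast
  qed
  then show ?thesis by (auto simp: I_def)
qed

definition scaled_c :: "nat \<Rightarrow> int" where "scaled_c v = cn v * (den div cd v)"

text \<open>The hypothesis on \<open>d\<close> ties a function of unordered edges to matrix
  positions: the cells at \<open>u * n + w\<close> and at \<open>w * n + u\<close> must give the
  same weight.\<close>

lemma load_correct:
  assumes s: "input_mem s" and m: "n * n \<le> m"
    and d: "\<And>u w. u < n \<Longrightarrow> w < n \<Longrightarrow> {u, w} \<in> E \<Longrightarrow>
      d {u, w} = dn (u * n + w) * (den div dd (u * n + w))"
  shows "\<exists>s'. reach M m load s s' \<and> graph_mem s' \<and> weights_mem scaled_c d s' \<and>
    weights_le (B ^ (n + n * n + 1)) s'"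
proof -
  have nm: "n \<le> m" using m by (cases n) auto
  let ?p1 = "vN ::= Read 0 (Const 0) ;; vDEN ::= Const 1"
  define s1 where "s1 = s(vN := (s vN)(0 := int n), vDEN := (s vDEN)(0 := 1))"
  have "wp M ?p1 (\<lambda>t. t = s1) s" using s M_ge by (simp add: s1_def input_mem_def)
  from reach_wp[OF this] have r1: "reach M m ?p1 s s1" by blast
  have s1: "s1 0 = s 0" "s1 vN 0 = int n" "s1 vDEN 0 = 1" by (simp_all add: s1_def)
  have im: "input_mem t" if "t 0 = s 0" for t using s that by (simp add: input_mem_def)
  obtain s2 where s2: "reach M m (For vJ (Var vN) (den_body (Const 2 \<otimes> Var vJ \<oplus> Const 2))) s1 s2"
    "s2 vDEN 0 = c_den" using den_c_loop_correct[OF im[of s1, OF s1(1)] s1(2,3) nm] by blast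
  have t2: "s2 0 = s 0" "s2 vN 0 = int n"
    using reach_frame[OF s2(1), of 0] reach_frame[OF s2(1), of vN] s1 by (simp_all add: den_body_def)
  obtain s3 where s3: "reach M m (For vK (Var vN \<otimes> Var vN) (den_body (entry 3))) s2 s3"
    "s3 vDEN 0 = den" using den_d_loop_correct[OF im[of s2, OF t2(1)] t2(2) s2(2) m] by blast
  have t3: "s3 0 = s 0" "s3 vN 0 = int n"
    using reach_frame[OF s3(1), of 0] reach_frame[OF s3(1), of vN] t2 by (simp_all add: den_body_def)
  obtain s4 where s4: "reach M m (For vJ (Var vN) scale_c_body) s3 s4"
    "\<forall>v<n. s4 aC (int v) = cn v * (den div cd v)"
    using scale_c_loop_correct[OF im[of s3, OF t3(1)] t3(2) s3(2) nm] by blast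
  have t4: "s4 0 = s 0" "s4 vN 0 = int n" "s4 vDEN 0 = den"
    using reach_frame[OF s4(1), of 0] reach_frame[OF s4(1), of vN] reach_frame[OF s4(1), of vDEN] t3 s3(2)
    by (simp_all add: scale_c_body_def)
  obtain s5 where s5: "reach M m (For vK (Var vN \<otimes> Var vN) scale_d_body) s4 s5"
    "\<forall>k<n*n. s5 aADJ (int k) = (if {k div n, k mod n} \<in> E then 1 else 0) \<and>
       s5 aD (int k) = dn k * (den div dd k)"
    using scale_d_loop_correct[OF im[of s4, OF t4(1)] t4(2,3) m] by blast
  have t5: "s5 vN 0 = int n" "s5 aC = s4 aC"
    using reach_frame[OF s5(1), of vN] reach_frame[OF s5(1), of aC] t4 by (simp_all add: scale_d_body_def)
  have uw: "s5 aADJ (int u * int n + int w) = (if {u, w} \<in> E then 1 else 0)"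
    "s5 aD (int u * int n + int w) = dn (u * n + w) * (den div dd (u * n + w))"
    if "u < n" "w < n" for u w
  proof -
    have "(u * n + w) div n = u" "(u * n + w) mod n = w" using that by auto
    then show "s5 aADJ (int u * int n + int w) = (if {u, w} \<in> E then 1 else 0)"
      "s5 aD (int u * int n + int w) = dn (u * n + w) * (den div dd (u * n + w))"
      using s5(2)[rule_format, OF index_bound(1)[OF that]] by simp_all
  qed
  have "graph_mem s5" using t5(1) uw(1) by (simp add: graph_mem_def)
  moreover have "weights_mem scaled_c d s5"
    using s4(2) t5(2) uw(2) d by (simp add: weights_mem_def scaled_c_def)
  moreover have "weights_le (B ^ (n + n * n + 1)) s5"
    unfolding weights_le_def using s4(2) s5(2) t5(2) scaled_le(1) c_le d_le by simp
  moreover have "reach M m load s s5"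
    unfolding load_def
    by (intro reach_Seq[OF r1] reach_Seq[OF s2(1)] reach_Seq[OF s3(1)] reach_Seq[OF s4(1)] s5(1))
  ultimately show ?thesis by blast
qed

text \<open>The factor 2 in \<open>M5\<close> pays for the sum of a vertex weight and an edge weight
  formed while the tree is recovered. The two zero arrays say that initially no vertex is eliminated
  or chosen.\<close>

lemma solver_correct:
  assumes s: "input_mem s" "s aDEAD = (\<lambda>_. 0)" "s aIN = (\<lambda>_. 0)"
    and ch: "chordal E" and M5: "2 * (5 ^ n * B ^ (n + n * n + 1)) \<le> M" and m: "n * n \<le> m"
    and d: "\<And>u w. u < n \<Longrightarrow> w < n \<Longrightarrow> {u, w} \<in> E \<Longrightarrow>
      d {u, w} = dn (u * n + w) * (den div dd (u * n + w))"
  shows "\<exists>s' vs cF dF r. reach M m solver s s' \<and>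
    output_is s' (encode_vertex_set (recover E cF dF r vs)) \<and>
    elim_order E {..<n} vs \<and> set vs = {..<n} \<and> eliminate E {..<n} vs (scaled_c, d) = (cF, dF) \<and>
    (0 < n \<longrightarrow> r < n) \<and> (\<forall>v<n. cF v \<le> cF r)"
proof -
  let ?b = "B ^ (n + n * n + 1)" and ?b' = "5 ^ n * B ^ (n + n * n + 1)"
  have nm: "n \<le> m" using m by (cases n) auto
  have b: "0 \<le> ?b" "?b' \<le> M" using B M5 M_ge by auto
  obtain s1 where s1: "reach M m load s s1" "graph_mem s1" "weights_mem scaled_c d s1" "weights_le ?b s1"
    using load_correct[OF s(1) m d] by blast
  have ag1: "agree {vN, vDEN, vJ, vK, aC, aD, aADJ} s s1"
    using reach_agree[OF s1(1)] by (simp add: writes_load)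
  have "dead_mem {..<n} s1" using ag1 s(2) by (simp add: dead_mem_def agree_def)
  then obtain s2 vs cF dF where s2: "reach M m (For vI (Var vN) eliminate_body) s1 s2"
    "elim_order E {..<n} vs" "set vs = {..<n}" "length vs = n" "order_mem vs s2"
    "eliminate E {..<n} vs (scaled_c, d) = (cF, dF)" "weights_mem cF dF s2" "weights_le ?b' s2"
    using eliminate_loop_correct[OF s1(2) _ s1(3,4) ch b(2,1) m] by blast
  define X where "X = insert vI (writes eliminate_body)"
  have ag2: "agree X s1 s2" using reach_agree[OF s2(1)] by (simp add: X_def)
  have g2: "graph_mem s2"
    by (rule graph_mem_agree[OF s1(2) ag2]) (simp_all add: X_def writes_eliminate_body)
  have "\<forall>v<n. \<bar>s2 aC (int v)\<bar> \<le> M" using s2(8) b(2) by (force simp: weights_le_def)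
  then obtain s3 r where s3: "reach M m find_root s2 s3" "s3 vROOT 0 = int r" "0 < n \<longrightarrow> r < n"
    "\<forall>v<n. s2 aC (int v) \<le> s2 aC (int r)"
    using find_root_correct[of s2 m] graph_memD(1)[OF g2] nm by blast
  have ag3: "agree {vJ, vROOT} s2 s3" using reach_agree[OF s3(1)] by (simp add: writes_find_root)
  have m3: "graph_mem s3" "weights_mem cF dF s3" "weights_le ?b' s3" "order_mem vs s3"
  proof -
    show "graph_mem s3" by (rule graph_mem_agree[OF g2 ag3]) simp_all
    show "weights_mem cF dF s3" by (rule weights_mem_agree[OF s2(7) ag3]) simp_all
    show "weights_le ?b' s3" by (rule weights_le_agree[OF s2(8) ag3]) simp_all
    show "order_mem vs s3" using s2(5) ag3 by (simp add: order_mem_def agree_def)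
  qed
  have "s3 aIN = s aIN" using ag1 ag2 ag3 by (simp add: agree_def X_def writes_eliminate_body)
  then have "in_mem {} s3" using s(3) by (simp add: in_mem_def)
  then obtain s4 where s4: "reach M m (For vI (Var vN) recover_body) s3 s4"
    "in_mem (recover E cF dF r vs) s4"
    using recover_loop_correct[OF m3(1) _ m3(2-4) s2(4,3) s3(2) _ M5 nm] s3(3) by blast
  have n4: "s4 vN 0 = int n"
    using reach_frame[OF s4(1), of vN] graph_memD(1)[OF m3(1)] by (simp add: writes_recover_body)
  have "recover E cF dF r vs \<subseteq> {..<n}" using recover_subset[of E cF dF r vs] s2(3) by simp
  then obtain s5 where s5: "reach M m write_output s4 s5"
    "output_is s5 (encode_vertex_set (recover E cF dF r vs))"
    using write_output_correct[OF n4 s4(2) _ nm] by blast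
  have "reach M m solver s s5"
    unfolding solver_def
    by (intro reach_Seq[OF s1(1)] reach_Seq[OF s2(1)] reach_Seq[OF s3(1)] reach_Seq[OF s4(1)] s5(1))
  moreover have "\<forall>v<n. cF v \<le> cF r"
  proof (intro allI impI)
    fix v assume "v < n"
    with s3(3,4) s2(7) show "cF v \<le> cF r" by (auto simp: weights_mem_def)
  qed
  ultimately show ?thesis using s5(2) s2(2,3,6) s3(3) by blast
qed

end

section \<open>Layout and length of the encoded input\<close>

lemma length_concat_map_uniform:
  assumes "\<And>x. length (f x) = l"
  shows "length (concat (map f xs)) = l * length xs"
  by (induction xs) (use assms in auto)

lemma nth_concat_map_uniform:
  assumes "\<And>x. length (f x) = l" "i < length xs" "j < l"
  shows "concat (map f xs) ! (l * i + j) = f (xs ! i) ! j"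
  using assms(2)
proof (induction xs arbitrary: i)
  case (Cons x xs)
  show ?case
  proof (cases i)
    case 0
    then show ?thesis using assms by (simp add: nth_append)
  next
    case (Suc i')
    then show ?thesis using Cons assms by (simp add: nth_append)
  qed
qed simp

lemma encode_instance_nth:
  fixes n E c d
  defines "xs \<equiv> encode_instance n E c d"
  shows "length xs = 2 * n + 3 * (n * n) + 1" "xs ! 0 = int n"
    "v < n \<Longrightarrow> xs ! (2 * v + 1) = fst (quotient_of (c v)) \<and> xs ! (2 * v + 2) = snd (quotient_of (c v))"
    "k < n * n \<Longrightarrow> j < 3 \<Longrightarrow> xs ! (2 * n + 3 * k + 1 + j) =
       (if {k div n, k mod n} \<in> E then 1 # encode_rat (d {k div n, k mod n}) else [0, 0, 1]) ! j"
proof -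
  define f where "f v = encode_rat (c v)" for v
  define g where "g = (\<lambda>(u, v). if {u, v} \<in> E then 1 # encode_rat (d {u, v}) else [0, 0, 1])"
  let ?P = "List.product [0..<n] [0..<n]"
  have f: "length (f v) = 2" for v by (simp add: f_def encode_rat_def)
  have g: "length (g p) = 3" for p by (simp add: g_def encode_rat_def split: prod.split)
  have xs: "xs = int n # concat (map f [0..<n]) @ concat (map g ?P)"
    by (simp add: xs_def encode_instance_def f_def[abs_def] g_def)
  have lf: "length (concat (map f [0..<n])) = 2 * n" using length_concat_map_uniform[of f, OF f] by simp
  have lg: "length (concat (map g ?P)) = 3 * (n * n)" using length_concat_map_uniform[of g, OF g] by simp
  show "length xs = 2 * n + 3 * (n * n) + 1" "xs ! 0 = int n" using lf lg by (simp_all add: xs)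
  show "xs ! (2 * v + 1) = fst (quotient_of (c v)) \<and> xs ! (2 * v + 2) = snd (quotient_of (c v))"
    if v: "v < n"
  proof -
    have "xs ! (2 * v + 1 + j) = f v ! j" if "j < 2" for j
    proof -
      have "xs ! (2 * v + 1 + j) = concat (map f [0..<n]) ! (2 * v + j)"
        using v that lf by (simp add: xs nth_append)
      then show ?thesis using nth_concat_map_uniform[of f 2 v "[0..<n]" j, OF f] v that by simp
    qed
    from this[of 0] this[of 1] show ?thesis by (simp add: f_def encode_rat_def)
  qed
  show "xs ! (2 * n + 3 * k + 1 + j) =
       (if {k div n, k mod n} \<in> E then 1 # encode_rat (d {k div n, k mod n}) else [0, 0, 1]) ! j"
    if k: "k < n * n" and j: "j < 3"
  proof -
    have "xs ! (2 * n + 3 * k + 1 + j) = concat (map g ?P) ! (3 * k + j)"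
      using lf by (simp add: xs nth_append)
    also have "\<dots> = g (?P ! k) ! j" using nth_concat_map_uniform[of g 3 k ?P j, OF g] k j by simp
    also have "?P ! k = (k div n, k mod n)"
      using k index_split(1,2)[OF k] by (simp add: product_nth)
    finally show ?thesis by (simp add: g_def)
  qed
qed

text \<open>Every entry is charged at least one bit. As the full adjacency matrix is part of the
  input, this bounds \<open>n * n\<close>, and hence all iteration counts, by the input
  length.\<close>

lemma length_le_input_length: "length xs \<le> input_length xs"
  unfolding input_length_def
proof (induction xs)
  case (Cons x xs)
  then show ?case using bits_pos[of x] by simp
qed simp

lemma nth_le_input_length:
  assumes "i < length xs"
  shows "\<bar>xs ! i\<bar> \<le> 2 ^ input_length xs"
proof -
  have "bits (xs ! i) \<le> input_length xs"
    unfolding input_length_def using assms by (intro member_le_sum_list) auto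
  then have "(2::int) ^ bits (xs ! i) \<le> 2 ^ input_length xs" by (intro power_increasing) auto
  then show ?thesis using abs_le_power_bits[of "xs ! i"] by linarith
qed

lemma initial_state_nth: "i < length xs \<Longrightarrow> initial_state xs 0 (int i) = xs ! i"
  by (simp add: initial_state_def)

text \<open>The division by the denominator is exact, so integer scaling agrees with multiplication
  by \<open>D\<close>.\<close>

lemma of_int_scaled:
  assumes "snd (quotient_of q) dvd D"
  shows "of_int (fst (quotient_of q) * (D div snd (quotient_of q))) = (of_int D * q :: rat)"
proof -
  obtain a b where ab: "quotient_of q = (a, b)" by force
  obtain k where k: "D = b * k" using assms ab by auto
  have "b > 0" "q = of_int a / of_int b"
    using quotient_of_denom_pos[OF ab] quotient_of_div[OF ab] by auto
  then show ?thesis using ab k by (simp add: field_simps)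
qed

text \<open>Induced trees are nonempty, so the graph without vertices has none and the answer is
  then the empty set.\<close>

theorem corollary1p4:
  shows "\<exists>(prog :: com) (p :: nat poly).
    \<forall>(n :: nat) (E :: nat set set) (c :: nat \<Rightarrow> rat) (d :: nat set \<Rightarrow> rat).
      simple_graph {..<n} E \<and> chordal E \<longrightarrow>
      (\<exists>(W :: nat set) (t :: nat).
         halts_with prog (encode_instance n E c d) t (encode_vertex_set W) \<and>
         t \<le> poly p (input_length (encode_instance n E c d)) \<and>
         (if n = 0 then W = {} else max_induced_tree {..<n} E c d W))"
proof -
  obtain P where P: "\<And>m. csize m solver = poly P m" using csize_poly by blast
  have "\<exists>W t. halts_with solver (encode_instance n E c d) t (encode_vertex_set W) \<and>
         t \<le> poly (P * [:10, 3, 1:]) (input_length (encode_instance n E c d)) \<and>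
         (if n = 0 then W = {} else max_induced_tree {..<n} E c d W)"
    if sg: "simple_graph {..<n} E" and ch: "chordal E" for n E and c :: "nat \<Rightarrow> rat" and d
  proof -
    define xs where "xs = encode_instance n E c d"
    define L where "L = input_length xs"
    \<comment> \<open>The exponent collects the demands on \<open>M\<close>: \<open>L * L\<close>
      from \<open>2 ^ L\<close> raised to \<open>n + n * n + 1\<close>, which is at most
      \<open>L\<close>; \<open>3 * L\<close> from \<open>5 ^ n\<close>, which is at most
      \<open>8 ^ L\<close>; and 8 for the factor 2 and the small constants.\<close>
    define M :: int where "M = 2 ^ (L * L + 3 * L + 8)"
    define cn cd where "cn v = fst (quotient_of (c v))" and "cd v = snd (quotient_of (c v))" for v
    define dn dd where "dn k = (if {k div n, k mod n} \<in> E then fst (quotient_of (d {k div n, k mod n})) else 0)"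
      and "dd k = (if {k div n, k mod n} \<in> E then snd (quotient_of (d {k div n, k mod n})) else 1)" for k
    note enc = encode_instance_nth[where n = n and E = E and c = c and d = d, folded xs_def]
    have len: "2 * n + 3 * (n * n) + 1 \<le> L"
      using length_le_input_length[of xs] enc(1) by (simp add: L_def)
    have encd: "xs ! (2 * n + 3 * k + 1) = (if {k div n, k mod n} \<in> E then 1 else 0)"
      "xs ! (2 * n + 3 * k + 2) = dn k" "xs ! (2 * n + 3 * k + 3) = dd k" if "k < n * n" for k
    proof -
      have *: "xs ! i = (if {k div n, k mod n} \<in> E
          then [1, fst (quotient_of (d {k div n, k mod n})), snd (quotient_of (d {k div n, k mod n}))]
          else [0, 0, 1]) ! j" if "j < 3" "i = 2 * n + 3 * k + 1 + j" for i j
        using enc(4)[OF \<open>k < n * n\<close> that(1)] that(2) by (simp add: encode_rat_def)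
      show "xs ! (2 * n + 3 * k + 1) = (if {k div n, k mod n} \<in> E then 1 else 0)"
        by (subst *[of 0]) simp_all
      show "xs ! (2 * n + 3 * k + 2) = dn k" by (subst *[of 1]) (simp_all add: dn_def)
      show "xs ! (2 * n + 3 * k + 3) = dd k" by (subst *[of 2]) (simp_all add: dd_def)
    qed
    \<comment> \<open>Addresses and counters stay below the exponent of \<open>M\<close>, hence
      below \<open>M\<close> itself.\<close>
    have pow: "int x \<le> M" if "x \<le> L * L + 3 * L + 8" for x
    proof -
      have "x < 2 ^ x" by (rule less_exp)
      also have "(2::nat) ^ x \<le> 2 ^ (L * L + 3 * L + 8)" using that by (intro power_increasing) auto
      finally have "int x \<le> int (2 ^ (L * L + 3 * L + 8))" by linarith
      then show ?thesis by (simp add: M_def)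
    qed
    have ll: "loopless E" using sg by (auto simp: simple_graph_def loopless_def)
    have M5: "2 * (5 ^ n * (2 ^ L) ^ (n + n * n + 1)) \<le> M"
    proof -
      have "(5::int) ^ n \<le> 8 ^ n" by (intro power_mono) auto
      also have "(8::int) ^ n \<le> 8 ^ L" using len by (intro power_increasing) auto
      also have "(8::int) ^ L = 2 ^ (3 * L)" by (simp add: power_mult)
      finally have 1: "(5::int) ^ n \<le> 2 ^ (3 * L)" .
      have "((2::int) ^ L) ^ (n + n * n + 1) \<le> (2 ^ L) ^ L" using len by (intro power_increasing) auto
      then have "((2::int) ^ L) ^ (n + n * n + 1) \<le> 2 ^ (L * L)" by (simp only: power_mult)
      with 1 have "(5::int) ^ n * (2 ^ L) ^ (n + n * n + 1) \<le> 2 ^ (3 * L) * 2 ^ (L * L)"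
        by (intro mult_mono) auto
      also have "\<dots> = 2 ^ (3 * L + L * L)" by (simp add: power_add)
      finally have "2 * (5 ^ n * (2 ^ L) ^ (n + n * n + 1)) \<le> (2::int) ^ (Suc (3 * L + L * L))" by simp
      also have "\<dots> \<le> M" unfolding M_def by (intro power_increasing) auto
      finally show ?thesis .
    qed
    interpret ram_input n E M cn cd dn dd "2 ^ L"
    proof unfold_locales
      show "loopless E" by (rule ll)
      show "int n * int n + int n + 8 \<le> M" using pow[of "n * n + n + 8"] len by simp
      show "3 * (int n * int n) + 2 * int n + 8 \<le> M" using pow[of "3 * (n * n) + 2 * n + 8"] len by simp
      show "(1::int) \<le> 2 ^ L" by simp
      have "1 * (2 ^ L) ^ (n + n * n + 1) \<le> (5::int) ^ n * (2 ^ L) ^ (n + n * n + 1)"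
        by (intro mult_right_mono) auto
      moreover have "0 \<le> (5::int) ^ n * (2 ^ L) ^ (n + n * n + 1)" by simp
      ultimately show "(2 ^ L) ^ (n + n * n + 1) \<le> M" using M5 by linarith
      show "\<bar>cn v\<bar> \<le> 2 ^ L \<and> 1 \<le> cd v \<and> cd v \<le> 2 ^ L" if "v < n" for v
        using nth_le_input_length[of "2 * v + 1" xs] nth_le_input_length[of "2 * v + 2" xs]
          enc(1) enc(3)[OF that] that quotient_of_denom_pos'[of "c v"]
        by (simp add: L_def cn_def cd_def)
      show "\<bar>dn k\<bar> \<le> 2 ^ L \<and> 1 \<le> dd k \<and> dd k \<le> 2 ^ L" if "k < n * n" for k
      proof -
        have "1 \<le> dd k" using quotient_of_denom_pos'[of "d {k div n, k mod n}"] by (simp add: dd_def)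
        then show ?thesis
          using nth_le_input_length[of "2 * n + 3 * k + 2" xs] nth_le_input_length[of "2 * n + 3 * k + 3" xs]
            enc(1) encd[OF that] that by (simp add: L_def)
      qed
    qed
    \<comment> \<open>Defined on all sets, but only for edges of the graph is the denominator known
      to divide \<open>den\<close>.\<close>
    define e where "e x = fst (quotient_of (d x)) * (den div snd (quotient_of (d x)))" for x
    have st: "initial_state xs 0 i = xs ! j" if "i = int j" "j < length xs" for i j
      using that initial_state_nth by simp
    have im: "input_mem (initial_state xs)"
      unfolding input_mem_def
    proof (intro conjI allI impI)
      show "initial_state xs 0 0 = int n" using enc(1,2) st[of 0 0] by simp
    next
      fix v assume v: "v < n"
      show "initial_state xs 0 (2 * int v + 1) = cn v" "initial_state xs 0 (2 * int v + 2) = cd v"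
        using st[of "2 * int v + 1" "2 * v + 1"] st[of "2 * int v + 2" "2 * v + 2"] v enc(1) enc(3)[OF v]
        by (simp_all add: cn_def cd_def)
    next
      fix k assume k: "k < n * n"
      show "initial_state xs 0 (2 * int n + 3 * int k + 1) = (if {k div n, k mod n} \<in> E then 1 else 0)"
        "initial_state xs 0 (2 * int n + 3 * int k + 2) = dn k"
        "initial_state xs 0 (2 * int n + 3 * int k + 3) = dd k"
        using st[of "2 * int n + 3 * int k + 1" "2 * n + 3 * k + 1"]
          st[of "2 * int n + 3 * int k + 2" "2 * n + 3 * k + 2"]
          st[of "2 * int n + 3 * int k + 3" "2 * n + 3 * k + 3"] k enc(1) encd[OF k]
        by simp_all
    qed
    have ed: "e {u, w} = dn (u * n + w) * (den div dd (u * n + w))"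
      if "u < n" "w < n" "{u, w} \<in> E" for u w
    proof -
      have "(u * n + w) div n = u" "(u * n + w) mod n = w" using that by auto
      then show ?thesis using that by (simp add: e_def dn_def dd_def)
    qed
    \<comment> \<open>The iteration bound \<open>m\<close> is instantiated with the input length
      itself.\<close>
    have nL: "n * n \<le> L" using len by simp
    obtain s' vs cF dF r where run: "reach M L solver (initial_state xs) s'"
      "output_is s' (encode_vertex_set (recover E cF dF r vs))"
      and el: "elim_order E {..<n} vs" "set vs = {..<n}" "eliminate E {..<n} vs (scaled_c, e) = (cF, dF)"
      and r: "0 < n \<longrightarrow> r < n" "\<forall>v<n. cF v \<le> cF r"
      using solver_correct[OF im _ _ ch M5 nL ed] by (auto simp: initial_state_def)
    let ?W = "recover E cF dF r vs"
    obtain t where t: "exec solver (initial_state xs) t s'" "t \<le> csize L solver * bits M"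
      using run(1) by (auto simp: reach_def)
    have halt: "halts_with solver xs t (encode_vertex_set ?W)"
      using t(1) run(2) by (auto simp: halts_with_def)
    \<comment> \<open>The length of \<open>2 ^ k\<close> is \<open>k + 2\<close>, one of the bits
      being the sign; hence the constant 10.\<close>
    have "bits M = poly [:10, 3, 1:] L" unfolding M_def bits_power_2 by (simp add: algebra_simps)
    then have time: "t \<le> poly (P * [:10, 3, 1:]) L" using t(2) by (simp only: P poly_mult)
    have sub: "?W \<subseteq> {..<n}" using recover_subset[of E cF dF r vs] el(2) by simp
    \<comment> \<open>All weights are multiplied by the same positive number, so comparing integer
      weights compares the rational ones.\<close>
    have scale: "of_int (weight E scaled_c e X) = of_int den * tree_weight E c d X"
      if X: "X \<subseteq> {..<n}" for X
    proof -
      have "of_int (scaled_c v) = of_int den * c v" if "v \<in> X" for v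
      proof -
        have "cd v dvd c_den" unfolding c_den_def using that X by (intro dvd_prodI) auto
        then have "cd v dvd den" by (simp add: den_def)
        then show ?thesis using of_int_scaled[of "c v" den] by (simp add: scaled_c_def cn_def cd_def)
      qed
      moreover have "of_int (e x) = of_int den * d x" if "x \<in> edges_in E X" for x
      proof -
        have "x \<in> E" "x \<subseteq> X" using that by (auto simp: edges_in_def)
        \<comment> \<open>Both ends lie below \<open>n\<close>, so the edge has a matrix position
          and its denominator is a factor of \<open>d_den\<close>.\<close>
        then obtain u w where uw: "x = {u, w}" "u < n" "w < n" "{u, w} \<in> E"
          using loopless_edgeE[OF ll, of x] X by (metis insert_subset lessThan_iff subsetD)
        have "dd (u * n + w) dvd d_den" unfolding d_den_def
          using index_bound(1)[OF uw(2,3)] by (intro dvd_prodI) auto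
        moreover have "(u * n + w) div n = u" "(u * n + w) mod n = w" using uw by auto
        ultimately have "snd (quotient_of (d x)) dvd den" using uw by (simp add: dd_def den_def)
        then show ?thesis using of_int_scaled by (simp add: e_def)
      qed
      ultimately show ?thesis
        by (simp add: weight_def tree_weight_def distrib_left sum_distrib_left)
    qed
    have "max_induced_tree {..<n} E c d ?W" if n: "0 < n"
      unfolding max_induced_tree_def
    proof (intro conjI allI impI)
      have rv: "r \<in> set vs" using r(1) n el(2) by simp
      have W: "is_tree ?W (edges_in E ?W)" "weight E scaled_c e ?W = cF r"
        using recover_tree[OF ll el(1) _ rv el(3)] el(2) by auto
      show "induced_tree {..<n} E ?W" using W(1) sub by (simp add: induced_tree_def)
      fix X assume X: "induced_tree {..<n} E X"
      then obtain v where v: "v < n" "weight E scaled_c e X \<le> cF v"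
        using eliminate_optimal[OF ll el(1) _ el(3), of X] el(2) by (auto simp: induced_tree_def)
      have "weight E scaled_c e X \<le> weight E scaled_c e ?W" using v r(2) W(2) by force
      then have "(of_int (weight E scaled_c e X) :: rat) \<le> of_int (weight E scaled_c e ?W)" by simp
      then have "of_int den * tree_weight E c d X \<le> of_int den * tree_weight E c d ?W"
        using scale[OF sub] scale[of X] X by (simp add: induced_tree_def)
      moreover have "(0::rat) < of_int den" using den_bounds(5) by simp
      ultimately show "tree_weight E c d X \<le> tree_weight E c d ?W" by simp
    qed
    moreover have "?W = {}" if "n = 0" using sub that by simp
    ultimately show ?thesis using halt time unfolding xs_def L_def by (intro exI[of _ ?W] exI[of _ t]) auto
  qed
  then show ?thesis by blast
qed

end
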